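(* Let $(X,d,\mu)$ be a quasi-metric-measure space where the measure $\mu$ is doubling, i.e., there is a constant $C_\mu\in[1,\infty)$ with $\mu(B_d(x,2r))\le C_\mu\,\mu(B_d(x,r))$ for all $x\in X$ and $r\in(0,\infty)$. Suppose that the embedding $M^{\alpha,p}(X,d,\mu)\hookrightarrow L^{\tilde p}(X,\mu)$ is compact for some $\alpha,p\in(0,\infty)$ and $\tilde p\in(0,p]$ with $\alpha\preceq\mathrm{ind}(X,d)$. Then the following statements are valid for all $\beta,u\in(0,\infty)$ and every dimensional exponent $s\in(0,\infty)$ of $\mu$, i.e., every $s$ such that $\mu(B_d(x,\lambda r))\le 4^s\lambda^s\mu(B_d(x,r))$ for all $x\in X$, $r\in(0,\infty)$, $\lambda\in[1,\infty)$: (1) If $\beta u<s$, then $M^{\beta,u}(X,d,\mu)\hookrightarrow L^{su/(s-\beta u)}(X,\mu)$ continuously, and for each fixed $\tilde q\in(0,su/(s-\beta u))$ the embedding $M^{\beta,u}(X,d,\mu)\hookrightarrow L^{\tilde q}(X,\mu)$ is compact. (2) If $\beta u>s$, then $M^{\beta,u}(X,d,\mu)\hookrightarrow\mathcal C^{\beta-s/u}(X,d)$ continuously, and for each fixed $\gamma\in(0,\beta-s/u)$ the embedding $M^{\beta,u}(X,d,\mu)\hookrightarrow\mathcal C^\gamma(X,d)$ is compact. Moreover, the embedding $M^{\beta,u}(X,d,\mu)\hookrightarrow L^{\tilde q}(X,\mu)$ is compact for all $\tilde q\in(0,\infty)$.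
   Context: A quasi-metric space $(X,d)$ is a set $X$ with at least two elements and a function $d:X\times X\to[0,\infty)$ for which there are constants $C_0,C_1\in(0,\infty)$ such that for all $x,y,z\in X$: $d(x,y)=0$ iff $x=y$; $d(y,x)\le C_0 d(x,y)$; $d(x,y)\le C_1\max\{d(x,z),d(z,y)\}$ (symmetry is not required). For a quasi-metric $\rho$, $C_\rho:=\sup\frac{\rho(x,y)}{\max\{\rho(x,z),\rho(z,y)\}}\in[1,\infty)$, the supremum over all $x,y,z\in X$ not all equal. Balls are $B_d(x,r):=\{y\in X:d(x,y)<r\}$. The topology $\tau_d$ consists of all $\mathcal O\subseteq X$ such that for each $x\in\mathcal O$ there is $r>0$ with $B_d(x,r)\subseteq\mathcal O$. A quasi-metric-measure space $(X,d,\mu)$ is a quasi-metric space with a nonnegative measure $\mu$ on a $\sigma$-algebra containing the Borel sets of $\tau_d$, such that all $d$-balls are measurable and $\mu(B_d(x,r))\in(0,\infty)$ for all $x\in X$, $r\in(0,\infty)$. Quasi-metrics $d,\rho$ on $X$ are equivalent ($\rho\approx d$) if $\kappa^{-1}\rho\le d\le\kappa\rho$ on $X\times X$ for some constant $\kappa>0$. The lower smoothness index is $\mathrm{ind}(X,d):=\sup_{\rho\approx d}(\log_2 C_\rho)^{-1}\in(0,\infty]$ (with $1/0:=\infty$). The notation $\alpha\preceq\mathrm{ind}(X,d)$ means $\alpha\le\mathrm{ind}(X,d)$, where $\alpha=\mathrm{ind}(X,d)$ is permitted only when this supremum is attained. For a doubling measure, the dimensional-exponent inequality holds for every $s\in(0,\infty)$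 with $s\ge\log_2 C_\mu$. Hajłasz–Sobolev space: for $\alpha,p\in(0,\infty)$ and measurable $f:X\to\mathbb R$, $\mathcal D_d^\alpha(f)$ is the set of nonnegative measurable functions $g$ on $X$ for which there is a measurable $E\subseteq X$ with $\mu(E)=0$ and $|f(x)-f(y)|\le[d(x,y)]^\alpha(g(x)+g(y))$ for all $x,y\in X\setminus E$. $M^{\alpha,p}(X,d,\mu)$ is the set of $f\in L^p(X,\mu)$ with finite (quasi-)norm $\|f\|_{L^p(X,\mu)}+\inf_{g\in\mathcal D_d^\alpha(f)}\|g\|_{L^p(X,\mu)}$. Hölder space: for $\beta\in(0,\infty)$, $\mathcal C^\beta(X,d)$ is the set of bounded $f:X\to\mathbb R$ with finite norm $\sup_{x\in X}|f(x)|+\sup_{x\ne y}\frac{|f(x)-f(y)|}{[d(x,y)]^\beta}$. Functions are identified when equal $\mu$-a.e.; an embedding into $\mathcal C^\beta(X,d)$ means that each function agrees $\mu$-a.e. with a (necessarily unique) element of $\mathcal C^\beta(X,d)$. An embedding is continuous if this natural map is well defined and bounded for the (quasi-)norms; it is compact if it moreover maps bounded sets to totally bounded sets. *)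

theory Defs
  imports "HOL-Analysis.Analysis"
begin

subsection \<open>Quasi-metric spaces\<close>

text \<open>A quasi-metric on a set \<open>X\<close> is a total function of which only the values on \<open>X \<times> X\<close> matter.\<close>

definition quasi_metric_on :: "'a set \<Rightarrow> ('a \<Rightarrow> 'a \<Rightarrow> real) \<Rightarrow> bool" where
  "quasi_metric_on X d \<longleftrightarrow>
     (\<exists>x\<in>X. \<exists>y\<in>X. x \<noteq> y) \<and>
     (\<forall>x\<in>X. \<forall>y\<in>X. 0 \<le> d x y) \<and>
     (\<forall>x\<in>X. \<forall>y\<in>X. d x y = 0 \<longleftrightarrow> x = y) \<and>
     (\<exists>C0>0. \<forall>x\<in>X. \<forall>y\<in>X. d y x \<le> C0 * d x y) \<and>
     (\<exists>C1>0. \<forall>x\<in>X. \<forall>y\<in>X. \<forall>z\<in>X. d x y \<le> C1 * max (d x z) (d z y))"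

definition qm_const :: "'a set \<Rightarrow> ('a \<Rightarrow> 'a \<Rightarrow> real) \<Rightarrow> real" where
  "qm_const X \<rho> = Sup {\<rho> x y / max (\<rho> x z) (\<rho> z y) | x y z.
     x \<in> X \<and> y \<in> X \<and> z \<in> X \<and> \<not> (x = y \<and> y = z)}"

definition qm_ball :: "'a set \<Rightarrow> ('a \<Rightarrow> 'a \<Rightarrow> real) \<Rightarrow> 'a \<Rightarrow> real \<Rightarrow> 'a set" where
  "qm_ball X d x r = {y \<in> X. d x y < r}"

definition qm_opens :: "'a set \<Rightarrow> ('a \<Rightarrow> 'a \<Rightarrow> real) \<Rightarrow> 'a set set" where
  "qm_opens X d = {U. U \<subseteq> X \<and> (\<forall>x\<in>U. \<exists>r>0. qm_ball X d x r \<subseteq> U)}"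

definition qm_equiv :: "'a set \<Rightarrow> ('a \<Rightarrow> 'a \<Rightarrow> real) \<Rightarrow> ('a \<Rightarrow> 'a \<Rightarrow> real) \<Rightarrow> bool" where
  "qm_equiv X \<rho> d \<longleftrightarrow>
     quasi_metric_on X \<rho> \<and>
     (\<exists>\<kappa>>0. \<forall>x\<in>X. \<forall>y\<in>X. inverse \<kappa> * \<rho> x y \<le> d x y \<and> d x y \<le> \<kappa> * \<rho> x y)"

text \<open>The quotients are taken in the extended reals, where \<open>1 / 0 = \<infinity>\<close>.\<close>

definition lower_smoothness_index :: "'a set \<Rightarrow> ('a \<Rightarrow> 'a \<Rightarrow> real) \<Rightarrow> ereal" where
  "lower_smoothness_index X d =
     (SUP \<rho>\<in>{\<rho>. qm_equiv X \<rho> d}. 1 / ereal (log 2 (qm_const X \<rho>)))"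

definition below_smoothness_index :: "real \<Rightarrow> 'a set \<Rightarrow> ('a \<Rightarrow> 'a \<Rightarrow> real) \<Rightarrow> bool" where
  "below_smoothness_index \<alpha> X d \<longleftrightarrow>
     ereal \<alpha> \<le> lower_smoothness_index X d \<and>
     (ereal \<alpha> = lower_smoothness_index X d \<longrightarrow>
       (\<exists>\<rho>. qm_equiv X \<rho> d \<and>
          1 / ereal (log 2 (qm_const X \<rho>)) = lower_smoothness_index X d))"

subsection \<open>Quasi-metric-measure spaces\<close>

definition quasi_metric_measure_space :: "'a measure \<Rightarrow> ('a \<Rightarrow> 'a \<Rightarrow> real) \<Rightarrow> bool" where
  "quasi_metric_measure_space M d \<longleftrightarrow>
     quasi_metric_on (space M) d \<and>
     sigma_sets (space M) (qm_opens (space M) d) \<subseteq> sets M \<and>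
     (\<forall>x\<in>space M. \<forall>r>0. qm_ball (space M) d x r \<in> sets M \<and>
        0 < emeasure M (qm_ball (space M) d x r) \<and>
        emeasure M (qm_ball (space M) d x r) < \<infinity>)"

definition doubling_measure :: "'a measure \<Rightarrow> ('a \<Rightarrow> 'a \<Rightarrow> real) \<Rightarrow> bool" where
  "doubling_measure M d \<longleftrightarrow>
     (\<exists>C\<ge>1. \<forall>x\<in>space M. \<forall>r>0.
        emeasure M (qm_ball (space M) d x (2 * r)) \<le>
          ennreal C * emeasure M (qm_ball (space M) d x r))"

definition dimensional_exponent :: "'a measure \<Rightarrow> ('a \<Rightarrow> 'a \<Rightarrow> real) \<Rightarrow> real \<Rightarrow> bool" where
  "dimensional_exponent M d s \<longleftrightarrow>
     0 < s \<and>
     (\<forall>x\<in>space M. \<forall>r>0. \<forall>l\<ge>1.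
        emeasure M (qm_ball (space M) d x (l * r)) \<le>
          ennreal (4 powr s * l powr s) * emeasure M (qm_ball (space M) d x r))"

subsection \<open>Function spaces\<close>

text \<open>
  The elements of a function space are functions, not classes modulo equality almost
  everywhere; the identification is made in the definition of embeddings below.
  Values outside \<open>space M\<close> are irrelevant throughout.
\<close>

record 'a fun_space =
  fs_carrier :: "('a \<Rightarrow> real) set"
  fs_norm :: "('a \<Rightarrow> real) \<Rightarrow> ennreal"

definition Lp_norm :: "'a measure \<Rightarrow> real \<Rightarrow> ('a \<Rightarrow> real) \<Rightarrow> ennreal" where
  "Lp_norm M p f =
     (let I = (\<integral>\<^sup>+x. ennreal (\<bar>f x\<bar> powr p) \<partial>M)
      in if I = \<infinity> then \<infinity> else ennreal (enn2real I powr (1 / p)))"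

definition Lp_space :: "'a measure \<Rightarrow> real \<Rightarrow> 'a fun_space" where
  "Lp_space M p =
     \<lparr>fs_carrier = {f \<in> borel_measurable M. Lp_norm M p f < \<infinity>}, fs_norm = Lp_norm M p\<rparr>"

definition hajlasz_gradients ::
  "'a measure \<Rightarrow> ('a \<Rightarrow> 'a \<Rightarrow> real) \<Rightarrow> real \<Rightarrow> ('a \<Rightarrow> real) \<Rightarrow> ('a \<Rightarrow> real) set" where
  "hajlasz_gradients M d \<alpha> f =
     {g \<in> borel_measurable M. (\<forall>x\<in>space M. 0 \<le> g x) \<and>
        (\<exists>E\<in>null_sets M. \<forall>x\<in>space M - E. \<forall>y\<in>space M - E.
           \<bar>f x - f y\<bar> \<le> d x y powr \<alpha> * (g x + g y))}"

definition hajlasz_norm ::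
  "'a measure \<Rightarrow> ('a \<Rightarrow> 'a \<Rightarrow> real) \<Rightarrow> real \<Rightarrow> real \<Rightarrow> ('a \<Rightarrow> real) \<Rightarrow> ennreal" where
  "hajlasz_norm M d \<alpha> p f = Lp_norm M p f + (INF g\<in>hajlasz_gradients M d \<alpha> f. Lp_norm M p g)"

definition hajlasz_sobolev_space ::
  "'a measure \<Rightarrow> ('a \<Rightarrow> 'a \<Rightarrow> real) \<Rightarrow> real \<Rightarrow> real \<Rightarrow> 'a fun_space" where
  "hajlasz_sobolev_space M d \<alpha> p =
     \<lparr>fs_carrier = {f \<in> fs_carrier (Lp_space M p). hajlasz_norm M d \<alpha> p f < \<infinity>},
      fs_norm = hajlasz_norm M d \<alpha> p\<rparr>"

definition hoelder_norm ::
  "'a set \<Rightarrow> ('a \<Rightarrow> 'a \<Rightarrow> real) \<Rightarrow> real \<Rightarrow> ('a \<Rightarrow> real) \<Rightarrow> ennreal" where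
  "hoelder_norm X d \<beta> f =
     (SUP x\<in>X. ennreal \<bar>f x\<bar>) +
     (SUP x\<in>X. SUP y\<in>X - {x}. ennreal (\<bar>f x - f y\<bar> / d x y powr \<beta>))"

text \<open>Finiteness of the norm includes boundedness.\<close>

definition hoelder_space :: "'a set \<Rightarrow> ('a \<Rightarrow> 'a \<Rightarrow> real) \<Rightarrow> real \<Rightarrow> 'a fun_space" where
  "hoelder_space X d \<beta> =
     \<lparr>fs_carrier = {f. hoelder_norm X d \<beta> f < \<infinity>}, fs_norm = hoelder_norm X d \<beta>\<rparr>"

subsection \<open>Embeddings\<close>

text \<open>
  The representatives in \<open>B\<close> of the functions in \<open>F\<close>.  The natural map sends the class of \<open>f\<close>
  to the class of its representatives.
\<close>

definition ae_image :: "'a measure \<Rightarrow> 'a fun_space \<Rightarrow> ('a \<Rightarrow> real) set \<Rightarrow> ('a \<Rightarrow> real) set" where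
  "ae_image M B F = {g \<in> fs_carrier B. \<exists>f\<in>F. AE x in M. f x = g x}"

definition fs_bounded :: "'a fun_space \<Rightarrow> ('a \<Rightarrow> real) set \<Rightarrow> bool" where
  "fs_bounded A F \<longleftrightarrow>
     F \<subseteq> fs_carrier A \<and> (\<exists>K::real. \<forall>f\<in>F. fs_norm A f \<le> ennreal K)"

definition fs_totally_bounded :: "'a fun_space \<Rightarrow> ('a \<Rightarrow> real) set \<Rightarrow> bool" where
  "fs_totally_bounded B G \<longleftrightarrow>
     G \<subseteq> fs_carrier B \<and>
     (\<forall>\<epsilon>::real. \<epsilon> > 0 \<longrightarrow>
       (\<exists>K. finite K \<and> K \<subseteq> G \<and> (\<forall>g\<in>G. \<exists>k\<in>K. fs_norm B (\<lambda>x. g x - k x) < ennreal \<epsilon>)))"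

text \<open>
  The bound is required for every representative in \<open>B\<close>.  In Lebesgue spaces all
  representatives have the same norm, and in Hoelder spaces the representative is unique on
  \<open>space M\<close> because balls have positive measure.
\<close>

definition continuous_embedding :: "'a measure \<Rightarrow> 'a fun_space \<Rightarrow> 'a fun_space \<Rightarrow> bool" where
  "continuous_embedding M A B \<longleftrightarrow>
     (\<forall>f\<in>fs_carrier A. ae_image M B {f} \<noteq> {}) \<and>
     (\<exists>C::real. \<forall>f\<in>fs_carrier A. \<forall>g\<in>ae_image M B {f}. fs_norm B g \<le> ennreal C * fs_norm A f)"

definition compact_embedding :: "'a measure \<Rightarrow> 'a fun_space \<Rightarrow> 'a fun_space \<Rightarrow> bool" where
  "compact_embedding M A B \<longleftrightarrow>
     continuous_embedding M A B \<and>
     (\<forall>F. fs_bounded A F \<longrightarrow> fs_totally_bounded B (ae_image M B F))"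

end

theory Submission
  imports Defs
begin

text \<open>
  Compactness for one pair of exponents enters through one consequence: \<open>X\<close> is bounded
  (\<open>bounded_if_compact_embedding\<close>).  An unbounded space carries a sequence of disjointly supported
  bumps that is bounded in the Sobolev space of order \<open>\<alpha>\<close> but uniformly separated in \<open>L\<^sup>q\<close>
  for \<open>q \<le> p\<close>.  The bumps have to be Hoelder continuous of order \<open>\<alpha>\<close>, and this is where the smoothness index
  is needed: for \<open>\<alpha>\<close> up to the index, Frink's chain construction turns a power of an equivalent
  quasi-metric into functions that are Lipschitz for it (\<open>smooth_distance_functions\<close>).

  On a bounded space the whole space is a ball, so a dimensional exponent \<open>s\<close> gives finite total
  mass and the lower bound \<open>b * r powr s\<close> for the mass of balls.
  Let \<open>g\<close> be a gradient of \<open>f\<close>, and let \<open>A\<close> bound the norms of both.  By Markov's inequality every ball of radius \<open>r\<close> contains a point where \<open>g\<close> is at most a constant times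
  \<open>A * r powr (- (s / u))\<close>.  A chain of such points, with geometrically growing radii, leads from any
  point outside a null set to a large scale (\<open>chain_to_scale\<close>), and the increments of \<open>f\<close> along
  it are at most multiples of \<open>A * r powr (\<beta> - s / u)\<close>.  If \<open>\<beta> * u < s\<close>, the first increment
  dominates and \<open>f\<close> is bounded by a constant plus a multiple of the power \<open>1 - \<beta> * u / s\<close> of \<open>g\<close>,
  which gives the Sobolev inequality (\<open>subcritical_bound\<close>).  If \<open>\<beta> * u > s\<close>, the last increment dominates and \<open>f\<close> is Hoelder
  continuous of order \<open>\<beta> - s / u\<close> (\<open>supercritical_bound\<close>).  Since values at single
  points are compared rather than averages over balls, the argument covers exponents below one.

  Compactness rests on the finite covers of \<open>X\<close> by small balls that the volume bound provides.
  Off a set of small measure the functions of a bounded family are bounded and equicontinuous, so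
  they are determined, up to a small error, by finitely many rounded samples
  (\<open>equicontinuous_net\<close>).  The exceptional sets contribute little in \<open>L\<^sup>q\<close> when the family is
  bounded in \<open>L\<^sup>w\<close> for some \<open>w > q\<close>.  In the Hoelder case there are none, and the seminorm of lower order
  interpolates between the supremum norm and the seminorm of the order \<open>\<beta> - s / u\<close>.
\<close>

section \<open>Lebesgue and Sobolev norms\<close>

text \<open>
  All estimates below are made for the integral of a power: it is handled in the same way for every
  positive exponent, while the norm is only a quasi-norm for exponents below one.
\<close>

lemma Lp_norm_le_iff:
  assumes "0 < p" "0 \<le> c"
  shows "Lp_norm M p f \<le> ennreal c \<longleftrightarrow> (\<integral>\<^sup>+x. ennreal (\<bar>f x\<bar> powr p) \<partial>M) \<le> ennreal (c powr p)"
proof (cases "(\<integral>\<^sup>+x. ennreal (\<bar>f x\<bar> powr p) \<partial>M)")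
  case (real r)
  have "r powr (1/p) \<le> c \<longleftrightarrow> r \<le> c powr p"
  proof
    assume "r powr (1/p) \<le> c"
    then have "(r powr (1/p)) powr p \<le> c powr p"
      using assms by (intro powr_mono2) auto
    then show "r \<le> c powr p" using assms real by (simp add: powr_powr)
  next
    assume "r \<le> c powr p"
    then have "r powr (1/p) \<le> (c powr p) powr (1/p)"
      using assms real by (intro powr_mono2) auto
    then show "r powr (1/p) \<le> c" using assms by (simp add: powr_powr)
  qed
  then show ?thesis using real assms by (simp add: Lp_norm_def Let_def)
qed (simp add: Lp_norm_def Let_def top_unique)

lemma Lp_norm_le:
  assumes "0 < p" "0 \<le> c" "(\<integral>\<^sup>+x. ennreal (\<bar>f x\<bar> powr p) \<partial>M) \<le> ennreal (c powr p)"
  shows "Lp_norm M p f \<le> ennreal c"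
  using assms Lp_norm_le_iff by blast

lemma Lp_norm_cong_AE:
  assumes "AE x in M. f x = g x"
  shows "Lp_norm M p f = Lp_norm M p g"
proof -
  have "(\<integral>\<^sup>+x. ennreal (\<bar>f x\<bar> powr p) \<partial>M) = (\<integral>\<^sup>+x. ennreal (\<bar>g x\<bar> powr p) \<partial>M)"
    using assms by (intro nn_integral_cong_AE) auto
  then show ?thesis by (simp add: Lp_norm_def)
qed

lemma powr_add_le:
  fixes a b p :: real
  assumes "0 \<le> a" "0 \<le> b" "0 < p"
  shows "(a + b) powr p \<le> 2 powr p * (a powr p + b powr p)"
proof -
  have "(a + b) powr p \<le> (2 * max a b) powr p"
    using assms by (intro powr_mono2) auto
  also have "\<dots> = 2 powr p * (max a b) powr p"
    using assms by (simp add: powr_mult)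
  also have "\<dots> \<le> 2 powr p * (a powr p + b powr p)"
    by (intro mult_left_mono) (auto simp: max_def)
  finally show ?thesis .
qed

lemma max_powr:
  fixes a b p :: real
  assumes "0 \<le> a" "0 \<le> b" "0 \<le> p"
  shows "max a b powr p = max (a powr p) (b powr p)"
  using powr_mono2[of p a b] powr_mono2[of p b a] assms by (auto simp: max_def)

lemma powr_of_power:
  fixes a x :: real
  assumes "0 < x"
  shows "(x ^ n) powr a = (x powr a) ^ n"
  using assms by (induction n) (auto simp: powr_mult)

text \<open>
  Below the level \<open>N\<close> the first term dominates, above it the second.  This replaces Hoelder's
  inequality when an integrability exponent is lowered on a space of finite measure.
\<close>

lemma split_powr_le:
  fixes t N q w :: real
  assumes "0 \<le> t" "0 < N" "0 < q" "q \<le> w"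
  shows "t powr q \<le> N powr q + N powr (q - w) * t powr w"
proof (cases "t \<le> N")
  case True
  then have "t powr q \<le> N powr q" using assms by (intro powr_mono2) auto
  then show ?thesis by (simp add: add_increasing2)
next
  case False
  then have "t powr (q - w) \<le> N powr (q - w)" using assms by (intro powr_mono2') auto
  then have "t powr (q - w) * t powr w \<le> N powr (q - w) * t powr w" by (intro mult_right_mono) auto
  then show ?thesis using False assms by (simp add: add_increasing flip: powr_add)
qed

lemma nn_integral_powr_diff_le:
  fixes f g h :: "'a \<Rightarrow> real"
  assumes [measurable]: "f \<in> borel_measurable M" "g \<in> borel_measurable M"
    "h \<in> borel_measurable M" and p: "0 < p"
    and "(\<integral>\<^sup>+x. ennreal (\<bar>f x - h x\<bar> powr p) \<partial>M) \<le> ennreal a"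
    and "(\<integral>\<^sup>+x. ennreal (\<bar>g x - h x\<bar> powr p) \<partial>M) \<le> ennreal b" and "0 \<le> a" "0 \<le> b"
  shows "(\<integral>\<^sup>+x. ennreal (\<bar>f x - g x\<bar> powr p) \<partial>M) \<le> ennreal (2 powr p * (a + b))"
proof -
  have "(\<integral>\<^sup>+x. ennreal (\<bar>f x - g x\<bar> powr p) \<partial>M) \<le>
      (\<integral>\<^sup>+x. ennreal (2 powr p) * (ennreal (\<bar>f x - h x\<bar> powr p) + ennreal (\<bar>g x - h x\<bar> powr p)) \<partial>M)"
  proof (rule nn_integral_mono)
    fix x
    have "\<bar>f x - g x\<bar> powr p \<le> (\<bar>f x - h x\<bar> + \<bar>g x - h x\<bar>) powr p"
      using p by (intro powr_mono2) auto
    also have "\<dots> \<le> 2 powr p * (\<bar>f x - h x\<bar> powr p + \<bar>g x - h x\<bar> powr p)"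
      using p by (intro powr_add_le) auto
    finally show "ennreal (\<bar>f x - g x\<bar> powr p) \<le> ennreal (2 powr p) *
        (ennreal (\<bar>f x - h x\<bar> powr p) + ennreal (\<bar>g x - h x\<bar> powr p))"
      by (simp flip: ennreal_mult ennreal_plus)
  qed
  also have "\<dots> = ennreal (2 powr p) * ((\<integral>\<^sup>+x. ennreal (\<bar>f x - h x\<bar> powr p) \<partial>M) +
      (\<integral>\<^sup>+x. ennreal (\<bar>g x - h x\<bar> powr p) \<partial>M))"
    by (subst nn_integral_cmult) (auto simp: nn_integral_add)
  also have "\<dots> \<le> ennreal (2 powr p) * (ennreal a + ennreal b)"
    using assms by (intro mult_left_mono add_mono) auto
  also have "\<dots> = ennreal (2 powr p * (a + b))"
    using assms by (simp flip: ennreal_mult ennreal_plus)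
  finally show ?thesis .
qed

lemma nn_integral_powr_indicator:
  assumes "B \<in> sets M" "emeasure M B = ennreal m" "0 \<le> c" "0 \<le> m"
  shows "(\<integral>\<^sup>+x. ennreal (\<bar>c * indicator B x\<bar> powr p) \<partial>M) = ennreal (c powr p * m)"
proof -
  have "(\<integral>\<^sup>+x. ennreal (\<bar>c * indicator B x\<bar> powr p) \<partial>M) = (\<integral>\<^sup>+x. ennreal (c powr p) * indicator B x \<partial>M)"
    using assms(3) by (intro nn_integral_cong) (auto simp: indicator_def)
  then show ?thesis using assms by (simp add: nn_integral_cmult_indicator ennreal_mult)
qed

text \<open>
  One number \<open>A\<close> controls both the function and the gradient.  The norm is an infimum over gradients
  that need not be attained, so \<open>A\<close> ranges over the numbers strictly above the norm.
\<close>

definition hajlasz_pair ::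
  "'a measure \<Rightarrow> ('a \<Rightarrow> 'a \<Rightarrow> real) \<Rightarrow> real \<Rightarrow> real \<Rightarrow> real \<Rightarrow> ('a \<Rightarrow> real) \<Rightarrow> ('a \<Rightarrow> real) \<Rightarrow> 'a set \<Rightarrow> bool"
  where
  "hajlasz_pair M d \<beta> u A f g E \<longleftrightarrow>
     f \<in> borel_measurable M \<and> g \<in> borel_measurable M \<and> E \<in> null_sets M \<and>
     (\<forall>x\<in>space M. 0 \<le> g x) \<and>
     (\<forall>x\<in>space M - E. \<forall>y\<in>space M - E. \<bar>f x - f y\<bar> \<le> d x y powr \<beta> * (g x + g y)) \<and>
     (\<integral>\<^sup>+x. ennreal (\<bar>f x\<bar> powr u) \<partial>M) \<le> ennreal (A powr u) \<and>
     (\<integral>\<^sup>+x. ennreal (\<bar>g x\<bar> powr u) \<partial>M) \<le> ennreal (A powr u)"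

lemma hajlasz_pair_if_norm_less:
  assumes "f \<in> fs_carrier (hajlasz_sobolev_space M d \<beta> u)"
    and "fs_norm (hajlasz_sobolev_space M d \<beta> u) f < ennreal A" "0 < u"
  shows "\<exists>g E. hajlasz_pair M d \<beta> u A f g E"
proof -
  have A: "0 < A" using assms(2) by (cases "A > 0") (auto simp: ennreal_neg)
  have n: "Lp_norm M u f + (INF g\<in>hajlasz_gradients M d \<beta> f. Lp_norm M u g) < ennreal A"
    using assms(2) by (simp add: hajlasz_sobolev_space_def hajlasz_norm_def)
  have f: "Lp_norm M u f \<le> ennreal A"
    by (rule order.trans[OF _ less_imp_le[OF n]]) (simp add: add_increasing2)
  have "(INF g\<in>hajlasz_gradients M d \<beta> f. Lp_norm M u g) < ennreal A"
    by (rule le_less_trans[OF _ n]) (simp add: add_increasing)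
  then obtain g where g: "g \<in> hajlasz_gradients M d \<beta> f" "Lp_norm M u g < ennreal A"
    by (auto simp: INF_less_iff)
  then obtain E where "E \<in> null_sets M"
    "\<forall>x\<in>space M - E. \<forall>y\<in>space M - E. \<bar>f x - f y\<bar> \<le> d x y powr \<beta> * (g x + g y)"
    unfolding hajlasz_gradients_def by blast
  moreover have "(\<integral>\<^sup>+x. ennreal (\<bar>f x\<bar> powr u) \<partial>M) \<le> ennreal (A powr u)"
    using f A assms(3) by (simp add: Lp_norm_le_iff)
  moreover have "(\<integral>\<^sup>+x. ennreal (\<bar>g x\<bar> powr u) \<partial>M) \<le> ennreal (A powr u)"
    using less_imp_le[OF g(2)] A assms(3) by (simp add: Lp_norm_le_iff)
  moreover have "f \<in> borel_measurable M"
    using assms(1) by (simp add: hajlasz_sobolev_space_def Lp_space_def)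
  moreover have "g \<in> borel_measurable M" "\<forall>x\<in>space M. 0 \<le> g x"
    using g(1) unfolding hajlasz_gradients_def by blast+
  ultimately show ?thesis unfolding hajlasz_pair_def by blast
qed

lemma hajlasz_pair_cong_AE:
  assumes "hajlasz_pair M d \<beta> u A f g E" "AE x in M. f x = h x" "h \<in> borel_measurable M"
  shows "\<exists>E'. hajlasz_pair M d \<beta> u A h g E'"
proof -
  obtain N where N: "{x\<in>space M. f x \<noteq> h x} \<subseteq> N" "N \<in> null_sets M"
    using assms(2) by (auto simp: eventually_ae_filter)
  have "(\<integral>\<^sup>+x. ennreal (\<bar>f x\<bar> powr u) \<partial>M) = (\<integral>\<^sup>+x. ennreal (\<bar>h x\<bar> powr u) \<partial>M)"
    using assms(2) by (intro nn_integral_cong_AE) auto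
  moreover have eq: "f x = h x" if "x \<in> space M - (E \<union> N)" for x using that N by auto
  moreover have "\<bar>h x - h y\<bar> \<le> d x y powr \<beta> * (g x + g y)"
    if "x \<in> space M - (E \<union> N)" "y \<in> space M - (E \<union> N)" for x y
  proof -
    have "\<bar>f x - f y\<bar> \<le> d x y powr \<beta> * (g x + g y)"
      using that assms(1) unfolding hajlasz_pair_def by blast
    then show ?thesis using eq[OF that(1)] eq[OF that(2)] by simp
  qed
  moreover have "E \<union> N \<in> null_sets M"
    using assms(1) N(2) unfolding hajlasz_pair_def by blast
  ultimately have "hajlasz_pair M d \<beta> u A h g (E \<union> N)"
    using assms(1,3) unfolding hajlasz_pair_def by simp
  then show ?thesis by blast
qed

text \<open>
  Turns estimates for every \<open>A\<close> strictly above the norm \<open>N\<close> into an estimate by \<open>N\<close> itself.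
\<close>

lemma ennreal_le_mult_if_bounds:
  assumes "N < \<infinity>" "0 \<le> C" "\<And>A::real. N < ennreal A \<Longrightarrow> y \<le> ennreal (C * A)"
  shows "y \<le> ennreal C * N"
proof -
  obtain n where n: "N = ennreal n" "0 \<le> n" using assms(1) by (cases N) auto
  have eps: "y \<le> ennreal (C * n) + ennreal e" if "0 < e" for e :: real
  proof -
    have "y \<le> ennreal (C * (n + e / (C + 1)))"
      using assms that n by (intro assms(3)) (auto simp: ennreal_less_iff)
    also have "\<dots> \<le> ennreal (C * n + e)"
      using assms that by (intro ennreal_leI) (auto simp: field_simps)
    finally show ?thesis using n assms that by simp
  qed
  have "y \<le> ennreal (C * n)" by (rule ennreal_le_epsilon) (rule eps)
  then show ?thesis using n assms by (simp add: ennreal_mult)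
qed

lemma continuous_embedding_LpI:
  assumes "0 < u" "0 < q" "0 \<le> C"
    and bound: "\<And>A f g E. 0 < A \<Longrightarrow> hajlasz_pair M d \<beta> u A f g E \<Longrightarrow>
      (\<integral>\<^sup>+x. ennreal (\<bar>f x\<bar> powr q) \<partial>M) \<le> ennreal ((C * A) powr q)"
  shows "continuous_embedding M (hajlasz_sobolev_space M d \<beta> u) (Lp_space M q)"
proof -
  let ?H = "hajlasz_sobolev_space M d \<beta> u"
  have *: "Lp_norm M q f \<le> ennreal C * fs_norm ?H f" if f: "f \<in> fs_carrier ?H" for f
  proof (rule ennreal_le_mult_if_bounds)
    show "fs_norm ?H f < \<infinity>" using f by (auto simp: hajlasz_sobolev_space_def)
    fix A assume A: "fs_norm ?H f < ennreal A"
    then have "0 < A" by (cases "A > 0") (auto simp: ennreal_neg)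
    then show "Lp_norm M q f \<le> ennreal (C * A)"
      using hajlasz_pair_if_norm_less[OF f A] assms by (auto intro!: Lp_norm_le bound)
  qed fact
  show ?thesis
    unfolding continuous_embedding_def
  proof (intro conjI ballI exI[of _ C])
    fix f assume f: "f \<in> fs_carrier ?H"
    then have "ennreal C * fs_norm ?H f < \<infinity>"
      by (auto simp: hajlasz_sobolev_space_def ennreal_mult_less_top)
    then have "Lp_norm M q f < \<infinity>" using *[OF f] by (rule order.strict_trans1[rotated])
    then have "f \<in> ae_image M (Lp_space M q) {f}"
      using f by (auto simp: ae_image_def Lp_space_def hajlasz_sobolev_space_def)
    then show "ae_image M (Lp_space M q) {f} \<noteq> {}" by blast
    fix g assume "g \<in> ae_image M (Lp_space M q) {f}"
    then have "AE x in M. f x = g x" by (auto simp: ae_image_def)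
    then show "fs_norm (Lp_space M q) g \<le> ennreal C * fs_norm ?H f"
      using *[OF f] Lp_norm_cong_AE[of f g M q] by (simp add: Lp_space_def)
  qed
qed

section \<open>Metrization of quasi-metrics\<close>

text \<open>
  Frink's metrization argument.  Let \<open>a\<close> be the distance of the end points, and cut the chain at the
  last point \<open>w r\<close> whose distance to the end is still at least \<open>a / 2\<close>.  By the relaxed triangle
  inequality the distance from the start to \<open>w (Suc r)\<close> is then at least \<open>a / 2\<close> as well.
  Averaging the two bounds avoids the factor two, and induction applies to the two overlapping pieces.  The link between them is
  counted twice, which is why the two end links enter with half of the weight of the others.
\<close>

lemma frink_chain_inequality:
  fixes D :: "'a \<Rightarrow> 'a \<Rightarrow> real" and w :: "nat \<Rightarrow> 'a"
  assumes nonneg: "\<And>x y. x \<in> X \<Longrightarrow> y \<in> X \<Longrightarrow> 0 \<le> D x y"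
    and relaxed: "\<And>x y z. x \<in> X \<Longrightarrow> y \<in> X \<Longrightarrow> z \<in> X \<Longrightarrow> D x y \<le> 2 * max (D x z) (D z y)"
    and w: "\<And>i. w i \<in> X" and "m + 2 \<le> n"
  shows "D (w m) (w n) + 2 * D (w m) (w (Suc m)) + 2 * D (w (n - 1)) (w n)
    \<le> 4 * (\<Sum>i=m..<n. D (w i) (w (Suc i)))"
  using \<open>m + 2 \<le> n\<close>
proof (induction "n - m" arbitrary: m n rule: less_induct)
  case less
  let ?S = "\<lambda>a b. \<Sum>i=a..<b. D (w i) (w (Suc i))"
  define a where "a = D (w m) (w n)"
  have S_nonneg: "0 \<le> ?S i j" for i j
    by (intro sum_nonneg nonneg w)
  have a_nonneg: "0 \<le> a" unfolding a_def by (intro nonneg w)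
  have split_first: "?S m n = D (w m) (w (Suc m)) + ?S (Suc m) n"
    using less.prems by (subst sum.atLeast_Suc_lessThan) auto
  have split_last: "?S i n = ?S i (n - 1) + D (w (n - 1)) (w n)" if "i < n" for i
    using that by (cases n) auto
  have ends: "D (w m) (w (Suc m)) + D (w (n - 1)) (w n) \<le> ?S m n"
    using split_first split_last[of "Suc m"] S_nonneg[of "Suc m" "n - 1"] less.prems by simp
  show ?case
  proof (cases "a = 0")
    case True
    then show ?thesis using ends S_nonneg[of m n] unfolding a_def
      by simp
  next
    case False
    define P where "P r \<longleftrightarrow> m \<le> r \<and> r < n \<and> a \<le> 2 * D (w r) (w n)" for r
    define r where "r = Greatest P"
    have "P m" using less.prems a_nonneg by (simp add: P_def a_def)
    then have r: "P r" and r_max: "\<And>k. P k \<Longrightarrow> k \<le> r"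
      unfolding r_def using GreatestI_nat[of P m n] Greatest_le_nat[of P _ n]
      by (auto simp: P_def)
    show ?thesis
    proof (cases "Suc r = n")
      case True
      then have "a \<le> 2 * D (w (n - 1)) (w n)" using r by (auto simp: P_def)
      then show ?thesis using ends nonneg[OF w w, of m "Suc m"] unfolding a_def by simp
    next
      case False
      then have r': "m \<le> r" "Suc r < n" using r by (auto simp: P_def)
      have "\<not> P (Suc r)" using r_max[of "Suc r"] by auto
      then have "2 * D (w (Suc r)) (w n) < a" using r' by (auto simp: P_def)
      then have left: "a \<le> 2 * D (w m) (w (Suc r))"
        using relaxed[OF w w w, of m n "Suc r"] unfolding a_def by (auto simp: max_def split: if_splits)
      have right: "a \<le> 2 * D (w r) (w n)" using r by (simp add: P_def)
      show ?thesis
      proof (cases "r = m")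
        case True
        then have "a \<le> 2 * D (w m) (w (Suc m))" using left by simp
        then show ?thesis using ends nonneg[OF w w, of "n - 1" n] less.prems unfolding a_def by simp
      next
        case False
        have "D (w m) (w (Suc r)) + 2 * D (w m) (w (Suc m)) + 2 * D (w r) (w (Suc r)) \<le> 4 * ?S m (Suc r)"
          using less.hyps[of "Suc r" m] False r' by fastforce
        moreover have "D (w r) (w n) + 2 * D (w r) (w (Suc r)) + 2 * D (w (n - 1)) (w n) \<le> 4 * ?S r n"
          using less.hyps[of n r] False r' by fastforce
        moreover have "?S m (Suc r) = ?S m r + D (w r) (w (Suc r))" "?S m n = ?S m r + ?S r n"
          using r' by (auto simp: sum.atLeastLessThan_concat)
        ultimately show ?thesis using left right unfolding a_def by linarith
      qed
    qed
  qed
qed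

definition chain_pseudodistance :: "'a set \<Rightarrow> ('a \<Rightarrow> 'a \<Rightarrow> real) \<Rightarrow> 'a \<Rightarrow> 'a \<Rightarrow> real" where
  "chain_pseudodistance X D x y =
     Inf {\<Sum>i<n. D (w i) (w (Suc i)) | n w. w 0 = x \<and> w n = y \<and> (\<forall>i. w i \<in> X)}"

text \<open>
  Unlike \<open>D\<close>, the infimum over chains is 1-Lipschitz in its endpoint with respect to \<open>D\<close>: append one
  link.  By Frink's inequality it is still comparable to \<open>D\<close>.
\<close>

lemma chain_pseudodistance_properties:
  fixes D :: "'a \<Rightarrow> 'a \<Rightarrow> real"
  assumes nonneg: "\<And>x y. x \<in> X \<Longrightarrow> y \<in> X \<Longrightarrow> 0 \<le> D x y"
    and refl: "\<And>x. x \<in> X \<Longrightarrow> D x x = 0"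
    and relaxed: "\<And>x y z. x \<in> X \<Longrightarrow> y \<in> X \<Longrightarrow> z \<in> X \<Longrightarrow> D x y \<le> 2 * max (D x z) (D z y)"
    and "x \<in> X" "y \<in> X"
  shows chain_pseudodistance_le: "chain_pseudodistance X D x y \<le> D x y"
    and le_chain_pseudodistance: "D x y \<le> 4 * chain_pseudodistance X D x y"
    and chain_pseudodistance_append:
      "z \<in> X \<Longrightarrow> chain_pseudodistance X D x z \<le> chain_pseudodistance X D x y + D y z"
proof -
  define S where "S y = {\<Sum>i<n. D (w i) (w (Suc i)) | n w. w 0 = x \<and> w n = y \<and> (\<forall>i. w i \<in> X)}" for y
  have Inf_S: "chain_pseudodistance X D x y = Inf (S y)" for y
    by (simp add: chain_pseudodistance_def S_def)
  have bdd: "bdd_below (S y)" for y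
    by (rule bdd_belowI[of _ 0]) (auto simp: S_def intro!: sum_nonneg nonneg)
  have D_in_S: "D x y \<in> S y" if "y \<in> X" for y
    unfolding S_def using \<open>x \<in> X\<close> that
    by (intro CollectI exI[of _ "1::nat"] exI[of _ "\<lambda>i. if i = 0 then x else y"]) auto
  show "chain_pseudodistance X D x y \<le> D x y"
    unfolding Inf_S using D_in_S[OF \<open>y \<in> X\<close>] bdd by (rule cInf_lower)
  have "D x y / 4 \<le> Inf (S y)"
  proof (rule cInf_greatest)
    show "S y \<noteq> {}" using D_in_S \<open>y \<in> X\<close> by blast
    fix t assume "t \<in> S y"
    then obtain n w where w: "t = (\<Sum>i<n. D (w i) (w (Suc i)))" "w 0 = x" "w n = y" "\<And>i. w i \<in> X"
      by (auto simp: S_def)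
    consider "n = 0" | "n = 1" | "2 \<le> n" by linarith
    then show "D x y / 4 \<le> t"
    proof cases
      case 1
      then show ?thesis using w refl \<open>x \<in> X\<close> by auto
    next
      case 2
      then show ?thesis using w nonneg[OF \<open>x \<in> X\<close> \<open>y \<in> X\<close>] by auto
    next
      case 3
      have "D (w 0) (w n) + 2 * D (w 0) (w (Suc 0)) + 2 * D (w (n - 1)) (w n)
          \<le> 4 * (\<Sum>i=0..<n. D (w i) (w (Suc i)))"
        by (rule frink_chain_inequality[of X]) (use 3 w assms in auto)
      moreover have "0 \<le> D (w 0) (w (Suc 0))" "0 \<le> D (w (n - 1)) (w n)"
        using nonneg w(4) by auto
      ultimately show ?thesis using w by (simp add: atLeast0LessThan)
    qed
  qed
  then show "D x y \<le> 4 * chain_pseudodistance X D x y" by (simp add: Inf_S)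
  assume "z \<in> X"
  have "Inf (S z) - D y z \<le> Inf (S y)"
  proof (rule cInf_greatest)
    show "S y \<noteq> {}" using D_in_S \<open>y \<in> X\<close> by blast
    fix t assume "t \<in> S y"
    then obtain n w where w: "t = (\<Sum>i<n. D (w i) (w (Suc i)))" "w 0 = x" "w n = y" "\<And>i. w i \<in> X"
      by (auto simp: S_def)
    have "(\<Sum>i<n. D ((w(Suc n := z)) i) ((w(Suc n := z)) (Suc i))) = t"
      unfolding w(1) by (rule sum.cong) auto
    then have "t + D y z = (\<Sum>i<Suc n. D ((w(Suc n := z)) i) ((w(Suc n := z)) (Suc i)))"
      using w by simp
    then have "t + D y z \<in> S z"
      unfolding S_def using w \<open>z \<in> X\<close>
      by (intro CollectI exI[of _ "Suc n"] exI[of _ "w(Suc n := z)"]) auto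
    then have "Inf (S z) \<le> t + D y z" using bdd by (rule cInf_lower)
    then show "Inf (S z) - D y z \<le> t" by simp
  qed
  then show "chain_pseudodistance X D x z \<le> chain_pseudodistance X D x y + D y z"
    by (simp add: Inf_S)
qed

lemma quasi_metric_onD:
  assumes "quasi_metric_on X d"
  shows "\<exists>C\<ge>1. (\<forall>x\<in>X. \<forall>y\<in>X. d y x \<le> C * d x y) \<and>
    (\<forall>x\<in>X. \<forall>y\<in>X. \<forall>z\<in>X. d x y \<le> C * max (d x z) (d z y))"
proof -
  obtain C0 C1 where C: "\<And>x y. x \<in> X \<Longrightarrow> y \<in> X \<Longrightarrow> d y x \<le> C0 * d x y"
    "\<And>x y z. x \<in> X \<Longrightarrow> y \<in> X \<Longrightarrow> z \<in> X \<Longrightarrow> d x y \<le> C1 * max (d x z) (d z y)"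
    using assms unfolding quasi_metric_on_def by blast
  have nonneg: "0 \<le> d x y" if "x \<in> X" "y \<in> X" for x y
    using assms that unfolding quasi_metric_on_def by blast
  let ?C = "max 1 (max C0 C1)"
  have "d y x \<le> ?C * d x y" if "x \<in> X" "y \<in> X" for x y
    using C(1)[OF that] nonneg[OF that] by (elim order.trans) (rule mult_right_mono, auto)
  moreover have "d x y \<le> ?C * max (d x z) (d z y)" if "x \<in> X" "y \<in> X" "z \<in> X" for x y z
    using C(2)[OF that] nonneg that by (elim order.trans) (rule mult_right_mono, auto simp: le_max_iff_disj)
  ultimately show ?thesis by (intro exI[of _ ?C]) auto
qed

lemma
  assumes "quasi_metric_on X \<rho>"
  shows one_le_qm_const: "1 \<le> qm_const X \<rho>"
    and quasi_triangle_qm_const: "\<And>x y z. x \<in> X \<Longrightarrow> y \<in> X \<Longrightarrow> z \<in> X \<Longrightarrow>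
      \<rho> x y \<le> qm_const X \<rho> * max (\<rho> x z) (\<rho> z y)"
proof -
  define S where "S = {\<rho> x y / max (\<rho> x z) (\<rho> z y) | x y z.
     x \<in> X \<and> y \<in> X \<and> z \<in> X \<and> \<not> (x = y \<and> y = z)}"
  obtain C where "1 \<le> C" and C: "\<And>x y z. x \<in> X \<Longrightarrow> y \<in> X \<Longrightarrow> z \<in> X \<Longrightarrow> \<rho> x y \<le> C * max (\<rho> x z) (\<rho> z y)"
    using quasi_metric_onD[OF assms] by blast
  have nonneg: "0 \<le> \<rho> x y" and zero: "\<rho> x y = 0 \<longleftrightarrow> x = y" if "x \<in> X" "y \<in> X" for x y
    using assms that unfolding quasi_metric_on_def by blast+
  have pos: "0 < max (\<rho> x z) (\<rho> z y)" if "x \<in> X" "y \<in> X" "z \<in> X" "\<not> (x = y \<and> y = z)" for x y z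
    using that nonneg[of x z] nonneg[of z y] zero[of x z] zero[of z y]
    by (auto simp: less_max_iff_disj)
  have bdd: "bdd_above S"
    unfolding S_def by (rule bdd_aboveI[of _ C]) (use pos C in \<open>auto simp: divide_le_eq\<close>)
  have le: "\<rho> x y / max (\<rho> x z) (\<rho> z y) \<le> qm_const X \<rho>"
    if "x \<in> X" "y \<in> X" "z \<in> X" "\<not> (x = y \<and> y = z)" for x y z
    unfolding qm_const_def S_def[symmetric]
    by (rule cSup_upper[OF _ bdd]) (use that in \<open>auto simp: S_def\<close>)
  obtain x y where "x \<in> X" "y \<in> X" "x \<noteq> y"
    using assms unfolding quasi_metric_on_def by blast
  then show one: "1 \<le> qm_const X \<rho>"
    using le[of x y y] zero[of x y] zero[of y y] nonneg[of x y] by (auto simp: max_def)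
  fix x y z assume X: "x \<in> X" "y \<in> X" "z \<in> X"
  show "\<rho> x y \<le> qm_const X \<rho> * max (\<rho> x z) (\<rho> z y)"
  proof (cases "x = y \<and> y = z")
    case True
    then show ?thesis using zero[of x x] X by simp
  next
    case False
    then show ?thesis using le[OF X False] pos[OF X False] by (simp add: divide_le_eq)
  qed
qed

text \<open>
  This is the point of the logarithm in the smoothness index: raising a quasi-metric to a power at
  most \<open>1 / log 2 C\<close> brings its quasi-triangle constant down to two, which Frink's inequality requires.
\<close>

lemma qm_const_powr_le_2:
  assumes "quasi_metric_on X \<rho>" "0 < \<alpha>" "ereal \<alpha> \<le> 1 / ereal (log 2 (qm_const X \<rho>))"
  shows "qm_const X \<rho> powr \<alpha> \<le> 2"
proof -
  let ?C = "qm_const X \<rho>"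
  have C: "1 \<le> ?C" by (rule one_le_qm_const) fact
  show ?thesis
  proof (cases "?C = 1")
    case False
    then have l: "0 < log 2 ?C" using C by simp
    then have "\<alpha> \<le> 1 / log 2 ?C" using assms(3) by (simp add: one_ereal_def)
    then have "\<alpha> * log 2 ?C \<le> 1" using l by (simp add: field_simps)
    then have "log 2 (?C powr \<alpha>) \<le> 1" using C by (simp add: log_powr)
    then show ?thesis using C by (simp add: log_le_one_cancel_iff)
  qed simp
qed

lemma below_smoothness_indexD:
  assumes "below_smoothness_index \<alpha> X d" "0 < \<alpha>"
  obtains \<rho> where "qm_equiv X \<rho> d" "qm_const X \<rho> powr \<alpha> \<le> 2"
proof -
  have "\<exists>\<rho>. qm_equiv X \<rho> d \<and> ereal \<alpha> \<le> 1 / ereal (log 2 (qm_const X \<rho>))"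
  proof (cases "ereal \<alpha> = lower_smoothness_index X d")
    case True
    then show ?thesis using assms unfolding below_smoothness_index_def by fastforce
  next
    case False
    then have "ereal \<alpha> < lower_smoothness_index X d"
      using assms unfolding below_smoothness_index_def by auto
    then show ?thesis unfolding lower_smoothness_index_def
      by (auto simp: less_SUP_iff intro: less_imp_le)
  qed
  then show ?thesis
    using that qm_const_powr_le_2 assms(2) unfolding qm_equiv_def by blast
qed

text \<open>
  The meaning of the smoothness index: for these \<open>\<alpha>\<close> there are distance functions
  comparable to \<open>d powr \<alpha>\<close> that are Hoelder continuous of the full order \<open>\<alpha>\<close>.  They are the chain
  pseudodistances of the symmetrisation of an equivalent quasi-metric with constant at most
  \<open>2 powr (1 / \<alpha>)\<close>, raised to the power \<open>\<alpha>\<close>.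
\<close>

lemma smooth_distance_functions:
  assumes "quasi_metric_on X d" "below_smoothness_index \<alpha> X d" "0 < \<alpha>"
  obtains L \<Phi> where "1 \<le> L"
    "\<And>x y. x \<in> X \<Longrightarrow> y \<in> X \<Longrightarrow> \<Phi> x y \<le> L * d x y powr \<alpha>"
    "\<And>x y. x \<in> X \<Longrightarrow> y \<in> X \<Longrightarrow> d x y powr \<alpha> \<le> L * \<Phi> x y"
    "\<And>x y z. x \<in> X \<Longrightarrow> y \<in> X \<Longrightarrow> z \<in> X \<Longrightarrow> \<bar>\<Phi> x y - \<Phi> x z\<bar> \<le> L * d y z powr \<alpha>"
proof -
  obtain \<rho> where eq: "qm_equiv X \<rho> d" and rho2: "qm_const X \<rho> powr \<alpha> \<le> 2"
    using below_smoothness_indexD assms(2,3) by blast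
  then have rho: "quasi_metric_on X \<rho>" unfolding qm_equiv_def by blast
  obtain \<kappa> where \<kappa>: "0 < \<kappa>" "\<And>x y. x \<in> X \<Longrightarrow> y \<in> X \<Longrightarrow> inverse \<kappa> * \<rho> x y \<le> d x y"
    "\<And>x y. x \<in> X \<Longrightarrow> y \<in> X \<Longrightarrow> d x y \<le> \<kappa> * \<rho> x y"
    using eq unfolding qm_equiv_def by blast
  obtain C where C: "1 \<le> C" "\<And>x y. x \<in> X \<Longrightarrow> y \<in> X \<Longrightarrow> \<rho> y x \<le> C * \<rho> x y"
    using quasi_metric_onD[OF rho] by blast
  have d_nonneg: "0 \<le> d x y" and nonneg: "0 \<le> \<rho> x y" and zero: "\<rho> x y = 0 \<longleftrightarrow> x = y"
    if "x \<in> X" "y \<in> X" for x y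
    using rho assms(1) that unfolding quasi_metric_on_def by blast+
  define D where "D x y = (max (\<rho> x y) (\<rho> y x)) powr \<alpha>" for x y
  have sym: "D x y = D y x" for x y by (simp add: D_def max.commute)
  have D_nonneg: "0 \<le> D x y" for x y by (simp add: D_def)
  have D_refl: "D x x = 0" if "x \<in> X" for x using zero[of x x] that by (simp add: D_def)
  have relaxed: "D x y \<le> 2 * max (D x z) (D z y)" if "x \<in> X" "y \<in> X" "z \<in> X" for x y z
  proof -
    let ?K = "qm_const X \<rho>"
    let ?m = "\<lambda>x y. max (\<rho> x y) (\<rho> y x)"
    have K: "1 \<le> ?K" by (rule one_le_qm_const) fact
    have "\<rho> x y \<le> ?K * max (\<rho> x z) (\<rho> z y)" "\<rho> y x \<le> ?K * max (\<rho> y z) (\<rho> z x)"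
      using that by (auto intro: quasi_triangle_qm_const[OF rho])
    moreover have "?K * max (\<rho> x z) (\<rho> z y) \<le> ?K * max (?m x z) (?m z y)"
      "?K * max (\<rho> y z) (\<rho> z x) \<le> ?K * max (?m x z) (?m z y)"
      using K by (auto intro!: mult_left_mono)
    ultimately have "?m x y \<le> ?K * max (?m x z) (?m z y)" by linarith
    then have "D x y \<le> (?K * max (?m x z) (?m z y)) powr \<alpha>"
      unfolding D_def using nonneg that assms(3) by (intro powr_mono2) (auto simp: le_max_iff_disj)
    also have "\<dots> = ?K powr \<alpha> * max (?m x z) (?m z y) powr \<alpha>"
      using nonneg that K by (simp add: powr_mult)
    also have "max (?m x z) (?m z y) powr \<alpha> = max (D x z) (D z y)"
      unfolding D_def using nonneg that assms(3) by (intro max_powr) (auto simp: le_max_iff_disj)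
    also have "?K powr \<alpha> * max (D x z) (D z y) \<le> 2 * max (D x z) (D z y)"
      using rho2 D_nonneg by (intro mult_right_mono) (auto simp: le_max_iff_disj)
    finally show ?thesis .
  qed
  \<comment> \<open>The factor 4 is the distortion of the chain construction; the rest compares D with the power of d.\<close>
  define L where "L = 4 * max 1 (max ((C * \<kappa>) powr \<alpha>) (\<kappa> powr \<alpha>))"
  have L: "4 \<le> L" "(C * \<kappa>) powr \<alpha> \<le> L" "4 * \<kappa> powr \<alpha> \<le> L"
    unfolding L_def by (auto simp: max_def)
  have upper: "D x y \<le> L * d x y powr \<alpha>" if "x \<in> X" "y \<in> X" for x y
  proof -
    have "\<rho> x y \<le> \<kappa> * d x y" using \<kappa>(1) \<kappa>(2)[OF that] by (simp add: field_simps)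
    moreover have "\<kappa> * d x y \<le> C * (\<kappa> * d x y)" 
      using C(1) \<kappa>(1) d_nonneg[OF that] mult_right_mono[of 1 C "\<kappa> * d x y"] by simp
    moreover have "\<rho> y x \<le> C * (\<kappa> * d x y)"
      using C(2)[OF that] mult_left_mono[OF calculation(1), of C] C(1) by linarith
    ultimately have "max (\<rho> x y) (\<rho> y x) \<le> C * \<kappa> * d x y" by (simp add: mult.assoc)
    then have "D x y \<le> (C * \<kappa> * d x y) powr \<alpha>"
      unfolding D_def using nonneg that assms(3) by (intro powr_mono2) (auto simp: le_max_iff_disj)
    also have "\<dots> = (C * \<kappa>) powr \<alpha> * d x y powr \<alpha>"
      using C(1) \<kappa>(1) d_nonneg[OF that] by (simp add: powr_mult)
    also have "\<dots> \<le> L * d x y powr \<alpha>" using L by (intro mult_right_mono) auto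
    finally show ?thesis .
  qed
  have lower: "d x y powr \<alpha> \<le> \<kappa> powr \<alpha> * D x y" if "x \<in> X" "y \<in> X" for x y
  proof -
    have "d x y \<le> \<kappa> * max (\<rho> x y) (\<rho> y x)"
      using \<kappa>(3)[OF that] \<kappa>(1) by (elim order.trans) simp
    then have "d x y powr \<alpha> \<le> (\<kappa> * max (\<rho> x y) (\<rho> y x)) powr \<alpha>"
      using d_nonneg[OF that] assms(3) by (intro powr_mono2) auto
    then show ?thesis
      unfolding D_def using \<kappa>(1) nonneg[OF that] by (simp add: powr_mult le_max_iff_disj)
  qed
  let ?\<Phi> = "chain_pseudodistance X D"
  note chain = chain_pseudodistance_le[of X D] le_chain_pseudodistance[of X D]
    chain_pseudodistance_append[of X D]
  show ?thesis
  proof (rule that[of L ?\<Phi>])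
    show "1 \<le> L" using L by simp
    show "?\<Phi> x y \<le> L * d x y powr \<alpha>" if "x \<in> X" "y \<in> X" for x y
      using chain(1)[OF D_nonneg D_refl relaxed that] upper[OF that] by simp
    show "d x y powr \<alpha> \<le> L * ?\<Phi> x y" if "x \<in> X" "y \<in> X" for x y
    proof -
      have *: "D x y \<le> 4 * ?\<Phi> x y" using chain(2)[OF D_nonneg D_refl relaxed that] .
      have "d x y powr \<alpha> \<le> \<kappa> powr \<alpha> * (4 * ?\<Phi> x y)"
        using lower[OF that] mult_left_mono[OF *, of "\<kappa> powr \<alpha>"] by simp
      also have "\<dots> = 4 * \<kappa> powr \<alpha> * ?\<Phi> x y" by simp
      also have "\<dots> \<le> L * ?\<Phi> x y" using L * D_nonneg[of x y] by (intro mult_right_mono) auto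
      finally show ?thesis .
    qed
    show "\<bar>?\<Phi> x y - ?\<Phi> x z\<bar> \<le> L * d y z powr \<alpha>" if "x \<in> X" "y \<in> X" "z \<in> X" for x y z
      using chain(3)[OF D_nonneg D_refl relaxed that(1,2,3)] chain(3)[OF D_nonneg D_refl relaxed that(1,3,2)]
        upper[OF that(2,3)] sym[of y z] by simp
  qed
qed

section \<open>Compactness forces boundedness\<close>

lemma quasi_metric_measure_spaceD:
  assumes "quasi_metric_measure_space M d"
  shows "quasi_metric_on (space M) d"
    and "U \<in> qm_opens (space M) d \<Longrightarrow> U \<in> sets M"
    and "x \<in> space M \<Longrightarrow> 0 < r \<Longrightarrow> qm_ball (space M) d x r \<in> sets M"
    and "x \<in> space M \<Longrightarrow> 0 < r \<Longrightarrow> 0 < emeasure M (qm_ball (space M) d x r)"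
    and "x \<in> space M \<Longrightarrow> 0 < r \<Longrightarrow> emeasure M (qm_ball (space M) d x r) < \<infinity>"
    and "x \<in> space M \<Longrightarrow> 0 < r \<Longrightarrow>
      emeasure M (qm_ball (space M) d x r) = ennreal (measure M (qm_ball (space M) d x r))"
    and "x \<in> space M \<Longrightarrow> 0 < r \<Longrightarrow> 0 < measure M (qm_ball (space M) d x r)"
proof -
  show "quasi_metric_on (space M) d" "U \<in> qm_opens (space M) d \<Longrightarrow> U \<in> sets M"
    using assms sigma_sets.Basic unfolding quasi_metric_measure_space_def by blast+
  assume x: "x \<in> space M" "0 < r"
  show "qm_ball (space M) d x r \<in> sets M" "0 < emeasure M (qm_ball (space M) d x r)"
    and fin: "emeasure M (qm_ball (space M) d x r) < \<infinity>"
    using assms x unfolding quasi_metric_measure_space_def by blast+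
  then show "emeasure M (qm_ball (space M) d x r) = ennreal (measure M (qm_ball (space M) d x r))"
    by (simp add: emeasure_eq_ennreal_measure)
  then show "0 < measure M (qm_ball (space M) d x r)"
    using \<open>0 < emeasure M (qm_ball (space M) d x r)\<close> by simp
qed

text \<open>
  Sublevel sets of a Hoelder continuous function are open in the topology of the quasi-metric,
  although balls need not be.
\<close>

lemma measurable_if_hoelder:
  assumes M: "quasi_metric_measure_space M d" and "0 < \<alpha>" "0 \<le> L"
    and hoelder: "\<And>y z. y \<in> space M \<Longrightarrow> z \<in> space M \<Longrightarrow> \<bar>f y - f z\<bar> \<le> L * d y z powr \<alpha>"
  shows "f \<in> borel_measurable M"
proof (rule borel_measurable_iff_less[THEN iffD2], intro allI)
  fix a
  have "{w \<in> space M. f w < a} \<in> qm_opens (space M) d"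
    unfolding qm_opens_def
  proof (intro CollectI conjI ballI)
    fix y assume y: "y \<in> {w \<in> space M. f w < a}"
    define r where "r = ((a - f y) / (L + 1)) powr (1 / \<alpha>)"
    have "0 < r" using y assms(2,3) by (simp add: r_def)
    moreover have "qm_ball (space M) d y r \<subseteq> {w \<in> space M. f w < a}"
    proof
      fix z assume "z \<in> qm_ball (space M) d y r"
      then have z: "z \<in> space M" "d y z < r" by (auto simp: qm_ball_def)
      have "0 \<le> d y z"
        using quasi_metric_measure_spaceD(1)[OF M] y z unfolding quasi_metric_on_def by blast
      then have "d y z powr \<alpha> < r powr \<alpha>" using z assms(2) by (intro powr_less_mono2) auto
      also have "r powr \<alpha> = (a - f y) / (L + 1)"
        using assms(2,3) y by (simp add: r_def powr_powr)
      finally have "(L + 1) * d y z powr \<alpha> < a - f y" using assms(3) by (simp add: field_simps)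
      moreover have "L * d y z powr \<alpha> \<le> (L + 1) * d y z powr \<alpha>"
        by (intro mult_right_mono) auto
      ultimately show "z \<in> {w \<in> space M. f w < a}" using hoelder[of y z] y z by auto
    qed
    ultimately show "\<exists>r>0. qm_ball (space M) d y r \<subseteq> {w \<in> space M. f w < a}" by blast
  qed auto
  then show "{w \<in> space M. f w < a} \<in> sets M" by (rule quasi_metric_measure_spaceD[OF M])
qed

definition hoelder_bump ::
  "'a measure \<Rightarrow> ('a \<Rightarrow> 'a \<Rightarrow> real) \<Rightarrow> real \<Rightarrow> real \<Rightarrow> real \<Rightarrow> 'a \<Rightarrow> real \<Rightarrow> ('a \<Rightarrow> real) \<Rightarrow> bool" where
  "hoelder_bump M d \<alpha> L \<tau> x r \<psi> \<longleftrightarrow>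
     \<psi> \<in> borel_measurable M \<and> (\<forall>y. 0 \<le> \<psi> y \<and> \<psi> y \<le> 1) \<and>
     (\<forall>y\<in>space M. r \<le> d x y \<longrightarrow> \<psi> y = 0) \<and> (\<forall>y\<in>space M. d x y < \<tau> * r \<longrightarrow> 1 / 2 \<le> \<psi> y) \<and>
     (\<forall>y\<in>space M. \<forall>z\<in>space M. \<bar>\<psi> y - \<psi> z\<bar> \<le> L / r powr \<alpha> * d y z powr \<alpha>)"

text \<open>
  The truncated distance function \<open>1 - L \<Phi>(x, \<cdot>) / r powr \<alpha>\<close>, with constants \<open>L\<close> and \<open>\<tau>\<close>
  independent of the centre and of the radius.
\<close>

lemma hoelder_bump_functions:
  assumes M: "quasi_metric_measure_space M d" and "below_smoothness_index \<alpha> (space M) d" "0 < \<alpha>"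
  shows "\<exists>L \<tau>. 0 < L \<and> 0 < \<tau> \<and> \<tau> \<le> 1 \<and>
    (\<forall>x\<in>space M. \<forall>r>0. \<exists>\<psi>. hoelder_bump M d \<alpha> L \<tau> x r \<psi>)"
proof -
  let ?X = "space M"
  have qm: "quasi_metric_on ?X d" by (rule quasi_metric_measure_spaceD) fact
  have nonneg: "0 \<le> d x y" if "x \<in> ?X" "y \<in> ?X" for x y
    using qm that unfolding quasi_metric_on_def by blast
  obtain L \<Phi> where L: "1 \<le> L" and \<Phi>: "\<And>x y. x \<in> ?X \<Longrightarrow> y \<in> ?X \<Longrightarrow> \<Phi> x y \<le> L * d x y powr \<alpha>"
    "\<And>x y. x \<in> ?X \<Longrightarrow> y \<in> ?X \<Longrightarrow> d x y powr \<alpha> \<le> L * \<Phi> x y"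
    "\<And>x y z. x \<in> ?X \<Longrightarrow> y \<in> ?X \<Longrightarrow> z \<in> ?X \<Longrightarrow> \<bar>\<Phi> x y - \<Phi> x z\<bar> \<le> L * d y z powr \<alpha>"
    using smooth_distance_functions[OF qm assms(2,3)] by blast
  \<comment> \<open>One factor L comes from the definition of the bump, the other from the upper bound on \<Phi>.\<close>
  define \<tau> where "\<tau> = (1 / (2 * L\<^sup>2)) powr (1 / \<alpha>)"
  have tau: "0 < \<tau>" "\<tau> powr \<alpha> = 1 / (2 * L\<^sup>2)"
    using L assms(3) by (auto simp: \<tau>_def powr_powr)
  show ?thesis
  proof (rule exI[of _ "L\<^sup>2"], rule exI[of _ \<tau>], intro conjI ballI allI impI)
    show "0 < L\<^sup>2" "0 < \<tau>" using L tau by auto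
    have "1 \<le> L\<^sup>2" using L by simp
    then have "1 \<le> 2 * L\<^sup>2" by linarith
    then have "1 / (2 * L\<^sup>2) \<le> 1" by (simp only: divide_le_eq_1) simp
    then show "\<tau> \<le> 1" unfolding \<tau>_def using assms(3) by (intro powr_le1) auto
    fix x and r :: real assume x: "x \<in> ?X" and r: "0 < r"
    define R where "R = r powr \<alpha>"
    have R: "0 < R" using r by (simp add: R_def)
    define \<psi> where "\<psi> y = max 0 (min 1 (1 - L * \<Phi> x y / R))" for y
    have lip: "\<bar>\<psi> y - \<psi> z\<bar> \<le> L\<^sup>2 / R * d y z powr \<alpha>" if "y \<in> ?X" "z \<in> ?X" for y z
    proof -
      have "\<bar>\<psi> y - \<psi> z\<bar> \<le> \<bar>L * \<Phi> x y / R - L * \<Phi> x z / R\<bar>" unfolding \<psi>_def by linarith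
      also have "\<dots> = L / R * \<bar>\<Phi> x y - \<Phi> x z\<bar>"
        using L R by (simp flip: right_diff_distrib diff_divide_distrib add: abs_mult)
      also have "\<dots> \<le> L / R * (L * d y z powr \<alpha>)"
        using L R \<Phi>(3)[OF x that] by (intro mult_left_mono) auto
      finally show ?thesis by (simp add: power2_eq_square)
    qed
    moreover have "\<psi> \<in> borel_measurable M"
      by (rule measurable_if_hoelder[OF M assms(3) _ lip]) (use R in auto)
    moreover have "\<psi> y = 0" if y: "y \<in> ?X" "r \<le> d x y" for y
    proof -
      have "R \<le> d x y powr \<alpha>" unfolding R_def using y r assms(3) by (intro powr_mono2) auto
      then have "R \<le> L * \<Phi> x y" using \<Phi>(2)[OF x y(1)] by simp
      then have "1 \<le> L * \<Phi> x y / R" using R by simp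
      then show ?thesis by (simp add: \<psi>_def)
    qed
    moreover have "1 / 2 \<le> \<psi> y" if y: "y \<in> ?X" "d x y < \<tau> * r" for y
    proof -
      have "d x y powr \<alpha> \<le> (\<tau> * r) powr \<alpha>"
        using y nonneg[OF x y(1)] assms(3) by (intro powr_mono2) auto
      also have "\<dots> = R / (2 * L\<^sup>2)" using tau r by (simp add: powr_mult R_def)
      finally have "L * d x y powr \<alpha> \<le> L * (R / (2 * L\<^sup>2))" using L by (intro mult_left_mono) auto
      with \<Phi>(1)[OF x y(1)] have "\<Phi> x y \<le> L * (R / (2 * L\<^sup>2))" by (rule order.trans)
      then have "L * \<Phi> x y \<le> L * (L * (R / (2 * L\<^sup>2)))" using L by (intro mult_left_mono) auto
      also have "\<dots> = R / 2" using L by (simp add: power2_eq_square)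
      finally have "L * \<Phi> x y / R \<le> 1 / 2" using R by (simp add: field_simps)
      then show ?thesis unfolding \<psi>_def by linarith
    qed
    moreover have "0 \<le> \<psi> y \<and> \<psi> y \<le> 1" for y by (simp add: \<psi>_def)
    ultimately show "\<exists>\<psi>. hoelder_bump M d \<alpha> (L\<^sup>2) \<tau> x r \<psi>"
      unfolding R_def hoelder_bump_def by (intro exI[of _ \<psi>]) auto
  qed
qed

text \<open>
  A multiple of the indicator of the supporting ball is a gradient, because the difference
  quotient vanishes when both points lie outside the ball.
\<close>

lemma normalised_bump:
  assumes M: "quasi_metric_measure_space M d" and p: "0 < p"
    and x: "x \<in> space M" and r: "0 < r" and H: "0 < H"
    and [measurable]: "\<psi> \<in> borel_measurable M"
    and range: "\<And>y. 0 \<le> \<psi> y" "\<And>y. \<psi> y \<le> 1"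
    and supp: "\<And>y. y \<in> space M \<Longrightarrow> r \<le> d x y \<Longrightarrow> \<psi> y = 0"
    and lip: "\<And>y z. y \<in> space M \<Longrightarrow> z \<in> space M \<Longrightarrow> \<bar>\<psi> y - \<psi> z\<bar> \<le> H * d y z powr \<alpha>"
  defines "m \<equiv> measure M (qm_ball (space M) d x r)"
  defines "f \<equiv> \<lambda>y. m powr (- (1 / p)) * \<psi> y"
  shows "f \<in> fs_carrier (hajlasz_sobolev_space M d \<alpha> p)"
    and "fs_norm (hajlasz_sobolev_space M d \<alpha> p) f \<le> ennreal (1 + H)"
proof -
  let ?B = "qm_ball (space M) d x r"
  let ?a = "m powr (- (1 / p))"
  note [measurable] = quasi_metric_measure_spaceD(3)[OF M x r]
  have m: "0 < m" "emeasure M ?B = ennreal m"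
    unfolding m_def using quasi_metric_measure_spaceD(6,7)[OF M x r] by auto
  have "?a powr p = m powr (- 1)" using p by (simp add: powr_powr)
  then have a: "0 < ?a" "?a powr p * m = 1" using m by (simp_all add: powr_minus)
  define g where "g y = H * ?a * indicator ?B y" for y
  have f_meas: "f \<in> borel_measurable M" unfolding f_def by measurable
  have f: "Lp_norm M p f \<le> ennreal 1"
  proof (rule Lp_norm_le[OF p])
    have "(\<integral>\<^sup>+y. ennreal (\<bar>f y\<bar> powr p) \<partial>M) \<le> (\<integral>\<^sup>+y. ennreal (\<bar>?a * indicator ?B y\<bar> powr p) \<partial>M)"
    proof (intro nn_integral_mono ennreal_leI powr_mono2)
      fix y assume y: "y \<in> space M"
      have "\<psi> y \<le> indicator ?B y"
        using range(2)[of y] supp[OF y] y by (auto simp: indicator_def qm_ball_def)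
      then show "\<bar>f y\<bar> \<le> \<bar>?a * indicator ?B y\<bar>"
        unfolding f_def abs_mult using range(1)[of y] by (intro mult_left_mono) auto
    qed (use p in auto)
    also have "\<dots> = ennreal (?a powr p * m)" using m a by (intro nn_integral_powr_indicator) auto
    also have "\<dots> = ennreal (1 powr p)" using a by simp
    finally show "(\<integral>\<^sup>+y. ennreal (\<bar>f y\<bar> powr p) \<partial>M) \<le> ennreal (1 powr p)" .
  qed simp
  have g: "Lp_norm M p g \<le> ennreal H"
  proof (rule Lp_norm_le[OF p])
    have "(\<integral>\<^sup>+y. ennreal (\<bar>g y\<bar> powr p) \<partial>M) = ennreal ((H * ?a) powr p * m)"
      unfolding g_def using m a H by (intro nn_integral_powr_indicator) auto
    also have "(H * ?a) powr p * m = H powr p * (?a powr p * m)"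
      using H a m by (simp add: powr_mult)
    finally show "(\<integral>\<^sup>+y. ennreal (\<bar>g y\<bar> powr p) \<partial>M) \<le> ennreal (H powr p)" using a by simp
  qed (use H in simp)
  have grad: "\<bar>f y - f z\<bar> \<le> d y z powr \<alpha> * (g y + g z)" if yz: "y \<in> space M" "z \<in> space M" for y z
  proof (cases "y \<in> ?B \<or> z \<in> ?B")
    case True
    have "\<bar>f y - f z\<bar> = ?a * \<bar>\<psi> y - \<psi> z\<bar>"
      using a unfolding f_def by (simp flip: right_diff_distrib add: abs_mult)
    also have "\<dots> \<le> ?a * (H * d y z powr \<alpha>)" using lip[OF yz] a by (intro mult_left_mono) auto
    also have "\<dots> = d y z powr \<alpha> * (H * ?a)" by simp
    also have "\<dots> \<le> d y z powr \<alpha> * (g y + g z)"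
      using True a(1) H by (intro mult_left_mono) (auto simp: g_def indicator_def)
    finally show ?thesis .
  next
    case False
    then have "\<psi> y = 0" "\<psi> z = 0" using supp yz by (auto simp: qm_ball_def not_less)
    then show ?thesis using H by (simp add: f_def g_def)
  qed
  have "g \<in> hajlasz_gradients M d \<alpha> f"
    unfolding hajlasz_gradients_def
  proof (intro CollectI conjI)
    show "g \<in> borel_measurable M" unfolding g_def by measurable
    show "\<forall>y\<in>space M. 0 \<le> g y" using H by (simp add: g_def)
    show "\<exists>E\<in>null_sets M. \<forall>x\<in>space M - E. \<forall>y\<in>space M - E. \<bar>f x - f y\<bar> \<le> d x y powr \<alpha> * (g x + g y)"
      using grad by (intro bexI[of _ "{}"]) auto
  qed
  then have "(INF g\<in>hajlasz_gradients M d \<alpha> f. Lp_norm M p g) \<le> ennreal H"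
    using INF_lower[of g "hajlasz_gradients M d \<alpha> f" "Lp_norm M p"] g by (simp add: order.trans)
  then have n: "hajlasz_norm M d \<alpha> p f \<le> ennreal (1 + H)"
    unfolding hajlasz_norm_def using add_mono[OF f] H by (simp add: ennreal_plus)
  then show "fs_norm (hajlasz_sobolev_space M d \<alpha> p) f \<le> ennreal (1 + H)"
    by (simp add: hajlasz_sobolev_space_def)
  have "Lp_norm M p f < \<infinity>" "hajlasz_norm M d \<alpha> p f < \<infinity>"
    using le_less_trans[OF f ennreal_less_top] le_less_trans[OF n ennreal_less_top] by auto
  then show "f \<in> fs_carrier (hajlasz_sobolev_space M d \<alpha> p)"
    using f_meas by (simp add: hajlasz_sobolev_space_def Lp_space_def)
qed

lemma sequence_in_distinct_annuli:
  fixes \<rho> :: "'a \<Rightarrow> real"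
  assumes unbounded: "\<And>B. \<exists>y\<in>X. B < \<rho> y" and "1 \<le> K"
  shows "\<exists>x::nat \<Rightarrow> 'a. (\<forall>k. x k \<in> X \<and> 1 \<le> \<rho> (x k)) \<and>
    (\<forall>j k. j < k \<longrightarrow> K * \<rho> (x j) < \<rho> (x k))"
proof -
  have "\<exists>x. \<forall>n. (x n \<in> X \<and> 1 \<le> \<rho> (x n)) \<and> K * \<rho> (x n) < \<rho> (x (Suc n))"
  proof (rule dependent_nat_choice)
    show "\<exists>x. x \<in> X \<and> 1 \<le> \<rho> x" using unbounded[of 1] by (auto intro: less_imp_le)
    fix y and n :: nat
    obtain z where "z \<in> X" "max 1 (K * \<rho> y) < \<rho> z" using unbounded by blast
    then show "\<exists>z. (z \<in> X \<and> 1 \<le> \<rho> z) \<and> K * \<rho> y < \<rho> z" by (intro exI[of _ z]) auto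
  qed
  then obtain x where x: "\<And>n. x n \<in> X" "\<And>n. 1 \<le> \<rho> (x n)" "\<And>n. K * \<rho> (x n) < \<rho> (x (Suc n))"
    by blast
  have step: "\<rho> (x n) \<le> \<rho> (x (Suc n))" for n
    using x(3)[of n] x(2)[of n] mult_right_mono[of 1 K "\<rho> (x n)"] assms(2) by linarith
  have "K * \<rho> (x j) < \<rho> (x k)" if "j < k" for j k
    using x(3)[of j] lift_Suc_mono_le[of "\<lambda>n. \<rho> (x n)" "Suc j" k] step that by simp
  then show ?thesis using x by blast
qed

lemma not_totally_bounded_if_separated:
  fixes f :: "nat \<Rightarrow> 'a \<Rightarrow> real"
  assumes "0 < q" "0 < e" and G: "\<And>k. f k \<in> G"
    and sep: "\<And>j k. j \<noteq> k \<Longrightarrow> ennreal e \<le> (\<integral>\<^sup>+x. ennreal (\<bar>f k x - f j x\<bar> powr q) \<partial>M)"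
  shows "\<not> fs_totally_bounded (Lp_space M q) G"
proof
  assume tb: "fs_totally_bounded (Lp_space M q) G"
  define \<epsilon> where "\<epsilon> = (e / (4 * 2 powr q)) powr (1 / q)"
  have \<epsilon>: "0 < \<epsilon>" "2 powr q * (\<epsilon> powr q + \<epsilon> powr q) < e"
    using assms(1,2) by (auto simp: \<epsilon>_def powr_powr field_simps)
  obtain K where K: "finite K" "K \<subseteq> G" and
    net: "\<And>g. g \<in> G \<Longrightarrow> \<exists>h\<in>K. Lp_norm M q (\<lambda>x. g x - h x) < ennreal \<epsilon>"
    using tb \<epsilon>(1) unfolding fs_totally_bounded_def Lp_space_def by (simp, metis)
  have meas: "g \<in> borel_measurable M" if "g \<in> G" for g
    using tb that unfolding fs_totally_bounded_def Lp_space_def by auto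
  obtain h where h: "\<And>k. h k \<in> K" "\<And>k. Lp_norm M q (\<lambda>x. f k x - h k x) < ennreal \<epsilon>"
    using net[OF G] by metis
  have "\<not> inj h"
    using K(1) h(1) finite_subset[of "range h" K] finite_imageD[of h UNIV] by auto
  then obtain j k where jk: "h j = h k" "j \<noteq> k" unfolding inj_def by blast
  have close: "(\<integral>\<^sup>+x. ennreal (\<bar>f k x - h k x\<bar> powr q) \<partial>M) \<le> ennreal (\<epsilon> powr q)" for k
    using less_imp_le[OF h(2)] \<epsilon>(1) assms(1) by (simp add: Lp_norm_le_iff)
  have "(\<integral>\<^sup>+x. ennreal (\<bar>f k x - f j x\<bar> powr q) \<partial>M) \<le> ennreal (2 powr q * (\<epsilon> powr q + \<epsilon> powr q))"
    using close[of k] close[of j] meas G K h(1) jk(1) assms(1)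
    by (intro nn_integral_powr_diff_le[where h = "h k"]) auto
  also have "\<dots> < ennreal e" using \<epsilon>(2) assms(2) by (simp add: ennreal_lessI)
  finally show False using sep[OF jk(2)] by simp
qed

text \<open>
  If \<open>X\<close> is unbounded, choose points \<open>x k\<close> whose distances \<open>R k\<close> from a base point grow
  geometrically, and put at \<open>x k\<close> a bump of radius proportional to \<open>R k\<close>, normalised in \<open>L\<^sup>p\<close>.  These
  bumps are bounded in the Sobolev space and have disjoint supports.  Enlarged by a fixed factor,
  each ball contains the unit ball about the base point, so by the dimensional exponent the masses
  of the balls are bounded below; since \<open>q \<le> p\<close>, the bumps have \<open>L\<^sup>q\<close> norm bounded below.  They are therefore
  uniformly separated in \<open>L\<^sup>q\<close>.
\<close>

lemma bounded_if_compact_embedding: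
  assumes M: "quasi_metric_measure_space M d" and dim: "dimensional_exponent M d s"
    and "0 < \<alpha>" "0 < p" "0 < q" "q \<le> p" and below: "below_smoothness_index \<alpha> (space M) d"
    and compact: "compact_embedding M (hajlasz_sobolev_space M d \<alpha> p) (Lp_space M q)"
  shows "\<exists>R>0. \<forall>x\<in>space M. \<forall>y\<in>space M. d x y < R"
proof -
  let ?X = "space M" and ?ball = "qm_ball (space M) d" and ?H = "hajlasz_sobolev_space M d \<alpha> p"
  let ?m = "\<lambda>x r. measure M (?ball x r)"
  have qm: "quasi_metric_on ?X d" by (rule quasi_metric_measure_spaceD) fact
  then obtain C where C: "1 \<le> C" and sym: "\<And>x y. x \<in> ?X \<Longrightarrow> y \<in> ?X \<Longrightarrow> d y x \<le> C * d x y"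
    and tri: "\<And>x y z. x \<in> ?X \<Longrightarrow> y \<in> ?X \<Longrightarrow> z \<in> ?X \<Longrightarrow> d x y \<le> C * max (d x z) (d z y)"
    using quasi_metric_onD[OF qm] by blast
  have nonneg: "0 \<le> d x y" if "x \<in> ?X" "y \<in> ?X" for x y
    using qm that unfolding quasi_metric_on_def by blast
  obtain x0 where x0: "x0 \<in> ?X" using qm unfolding quasi_metric_on_def by blast
  have scale: "?m x (l * r) \<le> (4 powr s * l powr s) * ?m x r" if "x \<in> ?X" "0 < r" "1 \<le> l" for x l r
  proof -
    have "emeasure M (?ball x (l * r)) \<le> ennreal (4 powr s * l powr s) * emeasure M (?ball x r)"
      using dim that unfolding dimensional_exponent_def by blast
    then show ?thesis
      using quasi_metric_measure_spaceD(6)[OF M that(1)] that by (simp flip: ennreal_mult)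
  qed
  have mono: "?m x r \<le> ?m y t" if "x \<in> ?X" "y \<in> ?X" "0 < r" "0 < t" "?ball x r \<subseteq> ?ball y t" for x y r t
    using quasi_metric_measure_spaceD[OF M] that
    by (intro measure_mono_fmeasurable fmeasurableI) auto
  have False if unbounded: "\<And>B. \<exists>y\<in>?X. B < d x0 y"
  proof -
    have C2: "1 \<le> C\<^sup>2" using C by simp
    obtain x :: "nat \<Rightarrow> 'a" where seq: "\<forall>k. x k \<in> ?X \<and> 1 \<le> d x0 (x k)"
      "\<forall>j k. j < k \<longrightarrow> C\<^sup>2 * d x0 (x j) < d x0 (x k)"
      using sequence_in_distinct_annuli[OF unbounded C2] by blast
    then have x: "\<And>k. x k \<in> ?X" "\<And>k. 1 \<le> d x0 (x k)"
      "\<And>j k. j < k \<Longrightarrow> C\<^sup>2 * d x0 (x j) < d x0 (x k)"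
      by auto
    obtain L \<tau> where L: "0 < L" and \<tau>: "0 < \<tau>" "\<tau> \<le> 1" and bumps:
      "\<And>x r. x \<in> ?X \<Longrightarrow> 0 < r \<Longrightarrow> \<exists>\<psi>. hoelder_bump M d \<alpha> L \<tau> x r \<psi>"
      using hoelder_bump_functions[OF M below \<open>0 < \<alpha>\<close>] by blast
    \<comment> \<open>So small that two uses of the quasi-triangle inequality keep the k-th ball in the annulus
        of points at distance between R k / C and C * R k from the base point.\<close>
    define \<epsilon> where "\<epsilon> = 1 / (2 * C\<^sup>2)"
    define r where "r k = \<epsilon> * d x0 (x k)" for k
    have "1 \<le> 2 * C\<^sup>2" using C2 by linarith
    then have \<epsilon>: "0 < \<epsilon>" "\<epsilon> \<le> 1" unfolding \<epsilon>_def by (simp_all only: divide_le_eq_1) auto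
    have r: "\<epsilon> \<le> r k" "0 < r k" for k
      using x(2)[of k] \<epsilon> mult_left_mono[of 1 "d x0 (x k)" \<epsilon>] by (auto simp: r_def intro: less_le_trans)
    have "\<forall>k. \<exists>\<psi>. hoelder_bump M d \<alpha> L \<tau> (x k) (r k) \<psi>" using bumps[OF x(1) r(2)] by blast
    then obtain \<psi> where \<psi>: "\<And>k. hoelder_bump M d \<alpha> L \<tau> (x k) (r k) (\<psi> k)"
      using choice by metis
    then have \<psi>_meas: "\<And>k. \<psi> k \<in> borel_measurable M"
      and \<psi>_range: "\<And>k y. 0 \<le> \<psi> k y" "\<And>k y. \<psi> k y \<le> 1"
      and \<psi>_supp: "\<And>k y. y \<in> ?X \<Longrightarrow> r k \<le> d (x k) y \<Longrightarrow> \<psi> k y = 0"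
      and \<psi>_core: "\<And>k y. y \<in> ?X \<Longrightarrow> d (x k) y < \<tau> * r k \<Longrightarrow> 1 / 2 \<le> \<psi> k y"
      and \<psi>_lip: "\<And>k y z. y \<in> ?X \<Longrightarrow> z \<in> ?X \<Longrightarrow> \<bar>\<psi> k y - \<psi> k z\<bar> \<le> L / r k powr \<alpha> * d y z powr \<alpha>"
      unfolding hoelder_bump_def by blast+
    have disjoint: "\<psi> k y = 0 \<or> \<psi> j y = 0" if "j < k" "y \<in> ?X" for j k y
    proof (rule ccontr)
      assume "\<not> (\<psi> k y = 0 \<or> \<psi> j y = 0)"
      then have close: "d (x k) y < r k" "d (x j) y < r j"
        using \<psi>_supp[OF that(2)] by (meson not_less)+
      have "C * d y (x k) \<le> C * (C * d (x k) y)"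
        using sym[OF x(1) that(2)] C by (intro mult_left_mono) auto
      also have "\<dots> \<le> C\<^sup>2 * r k"
        using close(1) C by (simp add: power2_eq_square mult_left_mono)
      also have "\<dots> = d x0 (x k) / 2" using C by (simp add: r_def \<epsilon>_def)
      also have "\<dots> < d x0 (x k)" using x(2)[of k] by simp
      finally have "d x0 (x k) \<le> C * d x0 y"
        using tri[OF x0 x(1)[of k] that(2)] by (auto simp: max_def split: if_splits)
      also have "d x0 y \<le> C * d x0 (x j)"
      proof -
        have "d (x j) y \<le> d x0 (x j)"
          using close(2) \<epsilon>(2) x(2)[of j] mult_right_mono[of \<epsilon> 1 "d x0 (x j)"]
          unfolding r_def by linarith
        then show ?thesis using tri[OF x0 that(2) x(1)[of j]] by (simp add: max_def split: if_splits)
      qed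
      then have "C * d x0 y \<le> C\<^sup>2 * d x0 (x j)" using C by (simp add: power2_eq_square mult_left_mono)
      finally show False using x(3)[OF that(1)] by simp
    qed
    \<comment> \<open>The dilation by l takes the core of the k-th ball to a ball that contains the unit ball about x0.\<close>
    define l where "l = max 1 (2 * C\<^sup>2 / (\<tau> * \<epsilon>))"
    define K where "K = 4 powr s * l powr s"
    have l: "1 \<le> l" "2 * C\<^sup>2 * d x0 (x k) \<le> l * (\<tau> * r k)" for k
    proof -
      have "2 * C\<^sup>2 * d x0 (x k) = 2 * C\<^sup>2 / (\<tau> * \<epsilon>) * (\<tau> * r k)"
        using \<tau> \<epsilon> by (simp add: r_def)
      also have "\<dots> \<le> l * (\<tau> * r k)" unfolding l_def using \<tau> r[of k] by (intro mult_right_mono) auto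
      finally show "2 * C\<^sup>2 * d x0 (x k) \<le> l * (\<tau> * r k)" .
    qed (simp add: l_def)
    have K: "0 < K" using l(1) by (simp add: K_def)
    have core: "0 < \<tau> * r k" for k using \<tau> r by simp
    have pos: "0 < ?m (x k) (\<tau> * r k)" "0 < ?m (x k) (r k)" for k
      using quasi_metric_measure_spaceD(7)[OF M x(1)] core r by auto
    have m0: "?m x0 1 \<le> K * ?m (x k) (\<tau> * r k)" for k
    proof -
      have "?ball x0 1 \<subseteq> ?ball (x k) (l * (\<tau> * r k))"
      proof
        fix y assume "y \<in> ?ball x0 1"
        then have y: "y \<in> ?X" "d x0 y < 1" by (auto simp: qm_ball_def)
        have "d (x k) x0 \<le> C * d x0 (x k)" using sym[OF x0 x(1)] .
        moreover have "d x0 y \<le> C * d x0 (x k)"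
          using y(2) x(2)[of k] C mult_mono[of 1 C 1 "d x0 (x k)"] by linarith
        ultimately have "C * max (d (x k) x0) (d x0 y) \<le> C * (C * d x0 (x k))"
          using C by (intro mult_left_mono) auto
        also have "\<dots> < 2 * C\<^sup>2 * d x0 (x k)" using C x(2)[of k] by (simp add: power2_eq_square)
        finally have "d (x k) y < l * (\<tau> * r k)" using tri[OF x(1) y(1) x0, of k] l(2)[of k] by simp
        then show "y \<in> ?ball (x k) (l * (\<tau> * r k))" using y by (simp add: qm_ball_def)
      qed
      then have "?m x0 1 \<le> ?m (x k) (l * (\<tau> * r k))"
        using l(1) core[of k] x0 x(1) by (intro mono) auto
      also have "\<dots> \<le> K * ?m (x k) (\<tau> * r k)"
        unfolding K_def using l(1) core x(1) by (intro scale) auto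
      finally show ?thesis .
    qed
    have m_upper: "?m (x k) (r k) \<le> K * ?m (x k) (\<tau> * r k)" for k
    proof -
      have "r k \<le> 2 * C\<^sup>2 * d x0 (x k)"
        unfolding r_def using C2 \<epsilon> x(2)[of k] by (intro mult_right_mono) auto
      also note l(2)[of k]
      finally have le: "r k \<le> l * (\<tau> * r k)" .
      then have "?ball (x k) (r k) \<subseteq> ?ball (x k) (l * (\<tau> * r k))" by (auto simp: qm_ball_def)
      then have "?m (x k) (r k) \<le> ?m (x k) (l * (\<tau> * r k))"
        using less_le_trans[OF r(2) le] r(2) x(1) by (intro mono)
      also have "\<dots> \<le> K * ?m (x k) (\<tau> * r k)"
        unfolding K_def using l(1) core x(1) by (intro scale) auto
      finally show ?thesis .
    qed
    have m_lower: "?m (x k) (\<tau> * r k) \<le> ?m (x k) (r k)" for k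
    proof (intro mono)
      have "\<tau> * r k \<le> r k" using \<tau>(2) r(2)[of k] mult_right_mono[of \<tau> 1 "r k"] by linarith
      then show "?ball (x k) (\<tau> * r k) \<subseteq> ?ball (x k) (r k)" by (auto simp: qm_ball_def)
    qed (use x(1) core r in auto)
    define a where "a k = ?m (x k) (r k) powr (- (1 / p))" for k
    define f where "f k = (\<lambda>y. a k * \<psi> k y)" for k
    define H where "H = L / \<epsilon> powr \<alpha>"
    have H: "0 < H" using L \<epsilon> by (simp add: H_def)
    have lip: "\<bar>\<psi> k y - \<psi> k z\<bar> \<le> H * d y z powr \<alpha>" if "y \<in> ?X" "z \<in> ?X" for k y z
    proof -
      have "L / r k powr \<alpha> \<le> H" unfolding H_def
        using L \<epsilon> r[of k] \<open>0 < \<alpha>\<close> by (intro divide_left_mono powr_mono2 mult_pos_pos) auto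
      then show ?thesis using \<psi>_lip[OF that, of k] by (elim order.trans) (intro mult_right_mono, auto)
    qed
    note bump' = normalised_bump[OF M \<open>0 < p\<close> x(1) r(2) H \<psi>_meas \<psi>_range]
    have bump: "f k \<in> fs_carrier ?H" "fs_norm ?H (f k) \<le> ennreal (1 + H)" for k
      unfolding f_def a_def
      by (rule bump'(1); (rule \<psi>_supp lip; assumption)) (rule bump'(2); (rule \<psi>_supp lip; assumption))
    have "fs_bounded ?H (range f)"
      unfolding fs_bounded_def using bump by blast
    then have tb: "fs_totally_bounded (Lp_space M q) (ae_image M (Lp_space M q) (range f))"
      using compact unfolding compact_embedding_def by blast
    have f_meas: "f k \<in> borel_measurable M" for k
      unfolding f_def using \<psi>_meas[of k] by measurable
    have f_image: "f k \<in> ae_image M (Lp_space M q) (range f)" for k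
    proof -
      obtain g where g: "g \<in> ae_image M (Lp_space M q) {f k}"
        using compact bump(1)[of k] unfolding compact_embedding_def continuous_embedding_def by blast
      then have "AE x in M. f k x = g x" "Lp_norm M q g < \<infinity>"
        by (auto simp: ae_image_def Lp_space_def)
      then have "Lp_norm M q (f k) < \<infinity>" using Lp_norm_cong_AE[of "f k" g M q] by simp
      then show ?thesis using f_meas by (auto simp: ae_image_def Lp_space_def)
    qed
    define e where "e = (1 / 2) powr q * (?m x0 1 / K) powr (1 - q / p) / K"
    have m0_pos: "0 < ?m x0 1" using quasi_metric_measure_spaceD(7)[OF M x0] by simp
    have e: "0 < e" using m0_pos K by (simp add: e_def)
    have "ennreal e \<le> (\<integral>\<^sup>+y. ennreal (\<bar>f k y - f j y\<bar> powr q) \<partial>M)" if "j \<noteq> k" for j k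
    proof -
      let ?B = "?ball (x k) (\<tau> * r k)" and ?mk = "?m (x k) (r k)"
      have ak: "0 < a k" using pos(2)[of k] by (simp add: a_def)
      have "?m x0 1 \<le> K * ?mk"
        using m0[of k] mult_left_mono[OF m_lower[of k], of K] K by linarith
      then have "?m x0 1 / K \<le> ?mk" using K by (simp add: divide_le_eq mult.commute)
      then have "(?m x0 1 / K) powr (1 - q / p) \<le> ?mk powr (1 - q / p)"
        using m0_pos K \<open>q \<le> p\<close> \<open>0 < p\<close> by (intro powr_mono2) auto
      then have "e \<le> (1 / 2) powr q * ?mk powr (1 - q / p) / K"
        unfolding e_def using K by (intro divide_right_mono mult_left_mono) auto
      also have "?mk powr (1 - q / p) = a k powr q * ?mk"
      proof -
        have "a k powr q = ?mk powr (- (q / p))" by (simp add: a_def powr_powr)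
        then show ?thesis using pos(2)[of k] by (simp add: powr_diff powr_minus_divide)
      qed
      also have "(1 / 2) powr q * (a k powr q * ?mk) / K = (a k / 2) powr q * (?mk / K)"
        using ak by (simp add: powr_divide)
      also have "\<dots> \<le> (a k / 2) powr q * ?m (x k) (\<tau> * r k)"
        using m_upper[of k] K by (intro mult_left_mono) (auto simp: field_simps)
      finally have "ennreal e \<le> ennreal ((a k / 2) powr q * ?m (x k) (\<tau> * r k))" by (rule ennreal_leI)
      also have "\<dots> = (\<integral>\<^sup>+y. ennreal (\<bar>a k / 2 * indicator ?B y\<bar> powr q) \<partial>M)"
        using ak quasi_metric_measure_spaceD(3,6)[OF M x(1) core, of k]
        by (intro nn_integral_powr_indicator[symmetric]) auto
      also have "\<dots> \<le> (\<integral>\<^sup>+y. ennreal (\<bar>f k y - f j y\<bar> powr q) \<partial>M)"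
      proof (intro nn_integral_mono ennreal_leI powr_mono2)
        fix y assume y: "y \<in> ?X"
        show "\<bar>a k / 2 * indicator ?B y\<bar> \<le> \<bar>f k y - f j y\<bar>"
        proof (cases "y \<in> ?B")
          case True
          then have c: "1 / 2 \<le> \<psi> k y" using \<psi>_core[OF y] by (simp add: qm_ball_def)
          then have "\<psi> j y = 0"
            using disjoint[of j k y] disjoint[of k j y] that y by (cases "j < k") auto
          then show ?thesis using True ak c mult_left_mono[OF c, of "a k"] by (simp add: f_def)
        qed simp
      qed (use \<open>0 < q\<close> in auto)
      finally show ?thesis .
    qed
    then show False
      using not_totally_bounded_if_separated[OF \<open>0 < q\<close> e f_image] tb by blast
  qed
  then obtain B where B: "\<And>y. y \<in> ?X \<Longrightarrow> d x0 y \<le> B" by (meson not_less)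
  show ?thesis
  proof (intro exI[of _ "C * (C * \<bar>B\<bar>) + 1"] conjI ballI)
    show "0 < C * (C * \<bar>B\<bar>) + 1" using C by (intro add_nonneg_pos mult_nonneg_nonneg) auto
    fix x y assume xy: "x \<in> ?X" "y \<in> ?X"
    have "d x x0 \<le> C * \<bar>B\<bar>"
      using sym[OF x0 xy(1)] B[OF xy(1)] C mult_left_mono[of "d x0 x" "\<bar>B\<bar>" C] by linarith
    moreover have "d x0 y \<le> C * \<bar>B\<bar>"
      using B[OF xy(2)] C mult_right_mono[of 1 C "\<bar>B\<bar>"] by linarith
    ultimately have "C * max (d x x0) (d x0 y) \<le> C * (C * \<bar>B\<bar>)"
      using C by (intro mult_left_mono) auto
    then show "d x y < C * (C * \<bar>B\<bar>) + 1" using tri[OF xy x0] by linarith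
  qed
qed

section \<open>Bounded spaces with a lower volume bound\<close>

text \<open>
  What remains of compactness: a bounded space whose balls satisfy the lower volume bound
  \<open>b * r powr s\<close>.  All embeddings are derived from this, for arbitrary smoothness
  \<open>\<beta>\<close> and integrability \<open>u\<close>.  One constant \<open>C\<close> serves for quasi-symmetry and for the quasi-triangle
  inequality.
\<close>

locale lower_regular_space =
  fixes M :: "'a measure" and d :: "'a \<Rightarrow> 'a \<Rightarrow> real" and C R b s :: real
  assumes M: "quasi_metric_measure_space M d"
    and C: "1 \<le> C"
    and sym: "x \<in> space M \<Longrightarrow> y \<in> space M \<Longrightarrow> d y x \<le> C * d x y"
    and tri: "x \<in> space M \<Longrightarrow> y \<in> space M \<Longrightarrow> z \<in> space M \<Longrightarrow> d x y \<le> C * max (d x z) (d z y)"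
    and R: "0 < R" and diam: "x \<in> space M \<Longrightarrow> y \<in> space M \<Longrightarrow> d x y < R"
    and b: "0 < b" and s: "0 < s"
    and lower: "x \<in> space M \<Longrightarrow> 0 < r \<Longrightarrow> r \<le> R \<Longrightarrow>
      b * r powr s \<le> measure M (qm_ball (space M) d x r)"

text \<open>
  Apply the dimensional exponent to the dilation of a ball of radius \<open>r\<close> to the radius \<open>R\<close>, where
  the ball is the whole space.
\<close>

lemma lower_regular_spaceI:
  assumes M: "quasi_metric_measure_space M d" and dim: "dimensional_exponent M d s"
    and "0 < R" "\<forall>x\<in>space M. \<forall>y\<in>space M. d x y < R"
  shows "\<exists>C b. lower_regular_space M d C R b s"
proof -
  let ?X = "space M" and ?ball = "qm_ball (space M) d"
  have qm: "quasi_metric_on ?X d" by (rule quasi_metric_measure_spaceD) fact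
  obtain C where C: "1 \<le> C" "\<forall>x\<in>?X. \<forall>y\<in>?X. d y x \<le> C * d x y"
    "\<forall>x\<in>?X. \<forall>y\<in>?X. \<forall>z\<in>?X. d x y \<le> C * max (d x z) (d z y)"
    using quasi_metric_onD[OF qm] by blast
  obtain x0 where x0: "x0 \<in> ?X" using qm unfolding quasi_metric_on_def by blast
  have ball_R: "?ball x R = ?X" if "x \<in> ?X" for x using assms(4) that by (auto simp: qm_ball_def)
  define V where "V = measure M ?X"
  have V: "0 < V" unfolding V_def
    using quasi_metric_measure_spaceD(7)[OF M x0 \<open>0 < R\<close>] ball_R[OF x0] by simp
  have s: "0 < s" using dim unfolding dimensional_exponent_def by blast
  define b where "b = V / (4 powr s * R powr s)"
  have "b * r powr s \<le> measure M (?ball x r)" if x: "x \<in> ?X" and r: "0 < r" "r \<le> R" for x r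
  proof -
    have "emeasure M (?ball x (R / r * r)) \<le> ennreal (4 powr s * (R / r) powr s) * emeasure M (?ball x r)"
      using dim x r unfolding dimensional_exponent_def by (auto simp del: times_divide_eq_left)
    then have "ennreal V \<le> ennreal (4 powr s * (R / r) powr s * measure M (?ball x r))"
      using r ball_R[OF x] quasi_metric_measure_spaceD(6)[OF M x, of R]
        quasi_metric_measure_spaceD(6)[OF M x, of r] \<open>0 < R\<close> by (simp add: V_def ennreal_mult)
    then have "V \<le> 4 powr s * (R / r) powr s * measure M (?ball x r)" by simp
    then show ?thesis using \<open>0 < R\<close> r by (simp add: b_def powr_divide field_simps)
  qed
  moreover have "0 < b" using V \<open>0 < R\<close> by (simp add: b_def)
  ultimately show ?thesis using M C s assms by (intro exI[of _ C] exI[of _ b]) (unfold_locales; blast)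
qed

text \<open>
  The two sides of the critical exponent differ in which end of a chain of scales carries the sum:
  the smallest scale if the exponent \<open>e\<close> is negative, the largest if it is positive.
\<close>

lemma sum_geometric_scales_neg:
  fixes l e :: real
  assumes "1 < l" "e < 0" "0 < r"
  shows "(\<Sum>j<n. (r * l ^ Suc j) powr e) \<le> r powr e / (1 - l powr e)"
proof -
  define y where "y = l powr e"
  have y: "0 < y" "y < 1" using assms powr_less_mono[of e 0 l] by (auto simp: y_def)
  have "(\<Sum>j<n. (r * l ^ Suc j) powr e) = (\<Sum>j<n. r powr e * (y * y ^ j))"
    using assms by (intro sum.cong) (auto simp del: power_Suc simp: powr_mult powr_of_power y_def power_Suc[symmetric])
  also have "\<dots> = r powr e * (y * (\<Sum>j<n. y ^ j))" by (simp add: sum_distrib_left)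
  also have "(\<Sum>j<n. y ^ j) = (1 - y ^ n) / (1 - y)" using y by (subst sum_gp_strict) auto
  also have "r powr e * (y * ((1 - y ^ n) / (1 - y))) \<le> r powr e * (1 * (1 / (1 - y)))"
    using y by (intro mult_left_mono mult_mono divide_right_mono divide_nonneg_pos) (auto simp: power_le_one)
  finally show ?thesis using y by (simp add: y_def)
qed

lemma sum_geometric_scales_pos:
  fixes l e :: real
  assumes "1 < l" "0 < e" "0 < r"
  shows "(\<Sum>j<n. (r * l ^ Suc j) powr e) \<le> l powr e / (l powr e - 1) * (r * l ^ n) powr e"
proof -
  define y where "y = l powr e"
  have y: "1 < y" using assms powr_less_mono[of 0 e l] by (auto simp: y_def)
  have "(\<Sum>j<n. (r * l ^ Suc j) powr e) = (\<Sum>j<n. r powr e * (y * y ^ j))"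
    using assms by (intro sum.cong) (auto simp del: power_Suc simp: powr_mult powr_of_power y_def power_Suc[symmetric])
  also have "\<dots> = r powr e * (y * (\<Sum>j<n. y ^ j))" by (simp add: sum_distrib_left)
  also have "(\<Sum>j<n. y ^ j) = (y ^ n - 1) / (y - 1)" using y by (simp add: geometric_sum)
  also have "r powr e * (y * ((y ^ n - 1) / (y - 1))) \<le> r powr e * (y * (y ^ n / (y - 1)))"
    using y by (intro mult_left_mono divide_right_mono) auto
  also have "\<dots> = y / (y - 1) * (r * l ^ n) powr e"
    using assms by (simp add: powr_mult powr_of_power y_def)
  finally show ?thesis by (simp add: y_def)
qed

lemma geometric_scale_below:
  fixes l r \<rho> :: real
  assumes "1 < l" "0 < r" "r \<le> \<rho>"
  shows "\<exists>n. r * l ^ n \<le> \<rho> \<and> \<rho> < r * l ^ n * l"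
proof -
  obtain n where "\<rho> / r < l ^ n" using real_arch_pow[OF assms(1)] by blast
  then have ex: "\<rho> < r * l ^ n" using assms by (simp add: field_simps)
  define m where "m = (LEAST n. \<rho> < r * l ^ n)"
  have m: "\<rho> < r * l ^ m" unfolding m_def by (rule LeastI) (rule ex)
  then have "m \<noteq> 0" using assms(3) by (cases m) auto
  then obtain k where k: "m = Suc k" by (cases m) auto
  then have "\<not> \<rho> < r * l ^ k" using not_less_Least[of k "\<lambda>n. \<rho> < r * l ^ n"] by (simp add: m_def)
  then show ?thesis using m k by (intro exI[of _ k]) (auto simp: mult_ac)
qed

lemma finite_representatives:
  assumes "finite I" "finite V" "\<And>f i. f \<in> G \<Longrightarrow> i \<in> I \<Longrightarrow> v f i \<in> V"
  shows "\<exists>K. finite K \<and> K \<subseteq> G \<and> (\<forall>f\<in>G. \<exists>k\<in>K. \<forall>i\<in>I. v f i = v k i)"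
proof -
  define p where "p f = restrict (v f) I" for f
  have "p ` G \<subseteq> (\<Pi>\<^sub>E i\<in>I. V)" using assms(3) by (auto simp: p_def)
  then have "finite (p ` G)" using finite_PiE[of I "\<lambda>_. V"] assms finite_subset by blast
  then obtain K where K: "K \<subseteq> G" "finite K" "p ` G = p ` K" using finite_subset_image[of "p ` G" p G] by auto
  have "\<exists>k\<in>K. \<forall>i\<in>I. v f i = v k i" if "f \<in> G" for f
  proof -
    have "p f \<in> p ` K" using that K(3) by blast
    then obtain k where k: "k \<in> K" "p f = p k" by auto
    have "v f i = v k i" if "i \<in> I" for i
      using fun_cong[OF k(2), of i] that by (simp add: p_def)
    then show ?thesis using k by blast
  qed
  then show ?thesis using K by blast
qed

lemma hoelder_norm_le:
  assumes "0 \<le> a" "0 \<le> b" and "\<And>x. x \<in> X \<Longrightarrow> \<bar>f x\<bar> \<le> a"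
    and "\<And>x y. x \<in> X \<Longrightarrow> y \<in> X \<Longrightarrow> x \<noteq> y \<Longrightarrow> 0 < d x y \<and> \<bar>f x - f y\<bar> \<le> b * d x y powr \<gamma>"
  shows "hoelder_norm X d \<gamma> f \<le> ennreal (a + b)"
proof -
  have "(SUP x\<in>X. ennreal \<bar>f x\<bar>) \<le> ennreal a"
    using assms(3) by (intro SUP_least ennreal_leI) auto
  moreover have "(SUP x\<in>X. SUP y\<in>X - {x}. ennreal (\<bar>f x - f y\<bar> / d x y powr \<gamma>)) \<le> ennreal b"
  proof (intro SUP_least ennreal_leI)
    fix x y assume "x \<in> X" "y \<in> X - {x}"
    then have "0 < d x y" "\<bar>f x - f y\<bar> \<le> b * d x y powr \<gamma>" using assms(4)[of x y] by auto
    then show "\<bar>f x - f y\<bar> / d x y powr \<gamma> \<le> b" by (simp add: pos_divide_le_eq)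
  qed
  ultimately show ?thesis unfolding hoelder_norm_def using assms(1,2) by (simp add: add_mono ennreal_plus)
qed

lemma hoelder_norm_finiteD:
  assumes "hoelder_norm X d \<gamma> f < \<infinity>" and pos: "\<And>x y. x \<in> X \<Longrightarrow> y \<in> X \<Longrightarrow> x \<noteq> y \<Longrightarrow> 0 < d x y"
  shows "\<exists>H\<ge>0. \<forall>x\<in>X. \<forall>y\<in>X. \<bar>f x - f y\<bar> \<le> H * d x y powr \<gamma>"
proof -
  define S where "S = (SUP x\<in>X. SUP y\<in>X - {x}. ennreal (\<bar>f x - f y\<bar> / d x y powr \<gamma>))"
  have "S < \<infinity>"
    using assms(1) unfolding hoelder_norm_def S_def[symmetric] by (simp add: less_top)
  then obtain H where H: "S = ennreal H" "0 \<le> H" by (cases S) auto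
  have "\<bar>f x - f y\<bar> \<le> H * d x y powr \<gamma>" if "x \<in> X" "y \<in> X" for x y
  proof (cases "x = y")
    case False
    have "ennreal (\<bar>f x - f y\<bar> / d x y powr \<gamma>) \<le> S"
      unfolding S_def using that False by (intro SUP_upper2[of x] SUP_upper) auto
    then have "\<bar>f x - f y\<bar> / d x y powr \<gamma> \<le> H" using H by simp
    then show ?thesis using pos[OF that False] by (simp add: pos_divide_le_eq)
  qed (use H in simp)
  then show ?thesis using H by blast
qed

context lower_regular_space
begin

abbreviation X where "X \<equiv> space M"

lemma d_nonneg: "x \<in> X \<Longrightarrow> y \<in> X \<Longrightarrow> 0 \<le> d x y"
  and d_zero_iff: "x \<in> X \<Longrightarrow> y \<in> X \<Longrightarrow> d x y = 0 \<longleftrightarrow> x = y"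
  using quasi_metric_measure_spaceD(1)[OF M] unfolding quasi_metric_on_def by blast+

lemma nonempty: "X \<noteq> {}"
  using quasi_metric_measure_spaceD(1)[OF M] unfolding quasi_metric_on_def by blast

lemma emeasure_space: "emeasure M X = ennreal (measure M X)" and measure_space_pos: "0 < measure M X"
proof -
  obtain x where x: "x \<in> X" using nonempty by blast
  then have "qm_ball X d x R = X" using diam by (auto simp: qm_ball_def)
  then show "emeasure M X = ennreal (measure M X)" "0 < measure M X"
    using quasi_metric_measure_spaceD(6,7)[OF M x R] by simp_all
qed

section \<open>Chains of points and the Sobolev estimates\<close>

text \<open>
  Markov's inequality: a set on which the function is large has less measure than the ball.
\<close>

lemma small_value_in_ball:
  assumes [measurable]: "h \<in> borel_measurable M"
    and int: "(\<integral>\<^sup>+x. ennreal (\<bar>h x\<bar> powr u) \<partial>M) \<le> ennreal B" and "0 < u" "0 \<le> t" "0 \<le> B"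
    and x: "x \<in> X" and r: "0 < r" "r \<le> R" and N: "N \<in> null_sets M" and B: "B < t powr u * (b * r powr s)"
  shows "\<exists>y\<in>X - N. d x y < r \<and> \<bar>h y\<bar> < t"
proof (rule ccontr)
  assume "\<not> ?thesis"
  then have big: "t \<le> \<bar>h y\<bar>" if "y \<in> X" "y \<notin> N" "d x y < r" for y using that by auto
  let ?B = "qm_ball X d x r"
  note ball = quasi_metric_measure_spaceD[OF M]
  have "ennreal (t powr u * measure M ?B) = (\<integral>\<^sup>+y. ennreal (\<bar>t * indicator ?B y\<bar> powr u) \<partial>M)"
    using ball(3,6)[OF x r(1)] \<open>0 \<le> t\<close> by (intro nn_integral_powr_indicator[symmetric]) auto
  also have "\<dots> \<le> (\<integral>\<^sup>+x. ennreal (\<bar>h x\<bar> powr u) \<partial>M)"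
  proof (rule nn_integral_mono_AE)
    show "AE y in M. ennreal (\<bar>t * indicator ?B y\<bar> powr u) \<le> ennreal (\<bar>h y\<bar> powr u)"
    proof (rule AE_I'[OF N], rule subsetI, rule ccontr)
      fix y assume y: "y \<in> {y \<in> X. \<not> ennreal (\<bar>t * indicator ?B y\<bar> powr u) \<le> ennreal (\<bar>h y\<bar> powr u)}"
        "y \<notin> N"
      then have "\<bar>t * indicator ?B y\<bar> \<le> \<bar>h y\<bar>"
        using big[of y] \<open>0 \<le> t\<close> by (auto simp: indicator_def qm_ball_def)
      then have "\<bar>t * indicator ?B y\<bar> powr u \<le> \<bar>h y\<bar> powr u"
        using \<open>0 < u\<close> by (intro powr_mono2) auto
      then show False using y by (auto intro: ennreal_leI)
    qed
  qed
  also note int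
  finally have "t powr u * measure M ?B \<le> B" using \<open>0 \<le> B\<close> by simp
  moreover have "t powr u * (b * r powr s) \<le> t powr u * measure M ?B"
    using lower[OF x r] by (intro mult_left_mono) auto
  ultimately show False using B by simp
qed

text \<open>
  Chosen such that, for \<open>t = level_const u * A * r powr (- (s / u))\<close>, the number \<open>t powr u\<close> times the
  lower volume bound of a ball of radius \<open>r\<close> is \<open>3 * A powr u\<close>.  This strictly exceeds
  the sum \<open>2 * A powr u\<close> of the bounds for the function and its gradient.
\<close>

definition level_const :: "real \<Rightarrow> real" where
  "level_const u = (3 / b) powr (1 / u)"

lemma level_const_pos: "0 < level_const u" using b by (simp add: level_const_def)

lemma good_point:
  assumes pair: "hajlasz_pair M d \<beta> u A f g E" and "0 < A" "0 < u" and x: "x \<in> X" and r: "0 < r" "r \<le> R"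
  shows "\<exists>y\<in>X - E. d x y < r \<and> g y \<le> level_const u * A * r powr (- (s / u)) \<and> \<bar>f y\<bar> \<le> level_const u * A * r powr (- (s / u))"
proof -
  have [measurable]: "f \<in> borel_measurable M" "g \<in> borel_measurable M" and E: "E \<in> null_sets M"
    and int: "(\<integral>\<^sup>+x. ennreal (\<bar>f x\<bar> powr u) \<partial>M) \<le> ennreal (A powr u)"
      "(\<integral>\<^sup>+x. ennreal (\<bar>g x\<bar> powr u) \<partial>M) \<le> ennreal (A powr u)"
    using pair unfolding hajlasz_pair_def by blast+
  define h where "h x = max \<bar>f x\<bar> \<bar>g x\<bar>" for x
  let ?t = "level_const u * A * r powr (- (s / u))"
  have "(\<integral>\<^sup>+x. ennreal (\<bar>h x\<bar> powr u) \<partial>M) \<le>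
      (\<integral>\<^sup>+x. ennreal (\<bar>f x\<bar> powr u) + ennreal (\<bar>g x\<bar> powr u) \<partial>M)"
    by (intro nn_integral_mono) (auto simp: h_def max_def simp flip: ennreal_plus)
  also have "\<dots> = (\<integral>\<^sup>+x. ennreal (\<bar>f x\<bar> powr u) \<partial>M) + (\<integral>\<^sup>+x. ennreal (\<bar>g x\<bar> powr u) \<partial>M)"
    by (rule nn_integral_add) auto
  also have "\<dots> \<le> ennreal (A powr u) + ennreal (A powr u)" using int by (rule add_mono)
  also have "\<dots> = ennreal (2 * A powr u)" by (simp flip: ennreal_plus)
  finally have int_h: "(\<integral>\<^sup>+x. ennreal (\<bar>h x\<bar> powr u) \<partial>M) \<le> ennreal (2 * A powr u)" .
  have "?t powr u = 3 / b * A powr u * r powr (- s)"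
    using b r \<open>0 < A\<close> \<open>0 < u\<close> by (simp add: level_const_def powr_mult powr_powr)
  then have "?t powr u * (b * r powr s) = 3 * A powr u"
    using b r by (simp add: powr_minus field_simps)
  then have "2 * A powr u < ?t powr u * (b * r powr s)" using \<open>0 < A\<close> by simp
  moreover have "h \<in> borel_measurable M" unfolding h_def by measurable
  moreover have "0 \<le> ?t" using level_const_pos[of u] \<open>0 < A\<close> by simp
  ultimately obtain y where "y \<in> X - E" "d x y < r" "\<bar>h y\<bar> < ?t"
    using small_value_in_ball[OF _ int_h \<open>0 < u\<close> _ _ x r E] by auto
  then show ?thesis by (intro bexI[of _ y]) (auto simp: h_def)
qed

text \<open>
  Start at a point where the gradient is at most the level belonging to the radius \<open>r\<close>, and move
  outwards: within the next larger radius there is a point where the gradient is at most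
  the correspondingly lower level.  The radii grow by the factor \<open>2 * C\<close>; as this is at
  least \<open>C\<close>, the quasi-triangle inequality does not accumulate constants along the chain and the
  total displacement is at most a fixed multiple of the last radius.
\<close>

lemma chain:
  assumes pair: "hajlasz_pair M d \<beta> u A f g E" and A: "0 < A" and u: "0 < u" and \<beta>: "0 < \<beta>"
    and x: "x \<in> X - E" and r: "0 < r" and gx: "g x \<le> level_const u * A * r powr (- (s / u))"
    and "r * (2 * C) ^ n \<le> R"
  shows "\<exists>y\<in>X - E. g y \<le> level_const u * A * (r * (2 * C) ^ n) powr (- (s / u)) \<and>
    d x y \<le> C * (r * (2 * C) ^ n) \<and>
    \<bar>f x - f y\<bar> \<le> 2 * level_const u * (2 * C) powr (s / u) * A * (\<Sum>j<n. (r * (2 * C) ^ Suc j) powr (\<beta> - s / u))"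
  using \<open>r * (2 * C) ^ n \<le> R\<close>
proof (induction n)
  case 0
  have "d x x = 0" using x d_zero_iff by auto
  then show ?case using x gx r C by (intro bexI[of _ x]) auto
next
  case (Suc n)
  let ?\<rho> = "r * (2 * C) ^ n" and ?\<sigma> = "r * (2 * C) ^ Suc n"
  let ?T = "\<lambda>r. level_const u * A * r powr (- (s / u))"
  let ?K = "2 * level_const u * (2 * C) powr (s / u) * A"
  have pos: "0 < ?\<rho>" "0 < ?\<sigma>" and eq: "?\<sigma> = 2 * C * ?\<rho>" and le: "?\<rho> \<le> ?\<sigma>"
    using r C by auto
  then obtain y where y: "y \<in> X - E" "g y \<le> ?T ?\<rho>" "d x y \<le> C * ?\<rho>"
    "\<bar>f x - f y\<bar> \<le> ?K * (\<Sum>j<n. (r * (2 * C) ^ Suc j) powr (\<beta> - s / u))"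
    using Suc by fastforce
  obtain z where z: "z \<in> X - E" "d y z < ?\<sigma>" "g z \<le> ?T ?\<sigma>"
    using good_point[OF pair A u _ pos(2) Suc.prems, of y] y(1) by blast
  have "d x z \<le> C * max (d x y) (d y z)" using tri[of x z y] x y z by auto
  also have "d x y \<le> ?\<sigma>" using y(3) eq mult_pos_pos[of C ?\<rho>] C pos(1) by linarith
  then have "C * max (d x y) (d y z) \<le> C * ?\<sigma>" using z(2) C by (intro mult_left_mono) auto
  finally have dist: "d x z \<le> C * ?\<sigma>" .
  have T\<rho>: "?T ?\<rho> = level_const u * (2 * C) powr (s / u) * A * ?\<sigma> powr (- (s / u))"
  proof -
    have "?\<sigma> powr (- (s / u)) = (2 * C) powr (- (s / u)) * ?\<rho> powr (- (s / u))"
      unfolding eq using C pos by (subst powr_mult) auto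
    then show ?thesis using C by (simp add: powr_minus field_simps)
  qed
  have "?\<sigma> powr (- (s / u)) \<le> ?\<rho> powr (- (s / u))"
    by (rule powr_mono2'[OF _ pos(1) le]) (use s u in simp)
  then have T\<sigma>: "?T ?\<sigma> \<le> ?T ?\<rho>"
    using level_const_pos[of u] A by (intro mult_left_mono) auto
  have g_nonneg: "0 \<le> g y" "0 \<le> g z" using pair y z unfolding hajlasz_pair_def by auto
  have "\<bar>f y - f z\<bar> \<le> d y z powr \<beta> * (g y + g z)"
    using pair y(1) z(1) unfolding hajlasz_pair_def by blast
  also have "\<dots> \<le> ?\<sigma> powr \<beta> * (2 * ?T ?\<rho>)"
    using y z T\<sigma> g_nonneg d_nonneg[of y z] \<beta> by (intro mult_mono powr_mono2) auto
  also have "\<dots> = ?K * (?\<sigma> powr \<beta> * ?\<sigma> powr (- (s / u)))" unfolding T\<rho> by (simp add: algebra_simps)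
  also have "?\<sigma> powr \<beta> * ?\<sigma> powr (- (s / u)) = ?\<sigma> powr (\<beta> - s / u)" by (simp flip: powr_add)
  finally have "\<bar>f y - f z\<bar> \<le> ?K * ?\<sigma> powr (\<beta> - s / u)" .
  then have "\<bar>f x - f z\<bar> \<le> ?K * (\<Sum>j<Suc n. (r * (2 * C) ^ Suc j) powr (\<beta> - s / u))"
    using y(4) by (simp only: sum.lessThan_Suc distrib_left)
  then show ?case using z dist by (intro bexI[of _ z]) auto
qed

text \<open>
  The starting radius is the one for which the gradient at \<open>x\<close> is exactly at its level.  If the
  gradient is at most the level belonging to \<open>\<rho>\<close>, the chain consists of \<open>x\<close> alone.
\<close>

lemma chain_to_scale:
  assumes pair: "hajlasz_pair M d \<beta> u A f g E" and A: "0 < A" and u: "0 < u" and \<beta>: "0 < \<beta>"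
    and x: "x \<in> X - E" and \<rho>: "0 < \<rho>" "\<rho> \<le> R"
  shows "\<exists>y\<in>X - E. g y \<le> level_const u * (2 * C) powr (s / u) * A * \<rho> powr (- (s / u)) \<and> d x y \<le> C * \<rho> \<and>
    (f x = f y \<or> (\<exists>r n. 0 < r \<and> r * (2 * C) ^ n \<le> \<rho> \<and> g x = level_const u * A * r powr (- (s / u)) \<and>
      \<bar>f x - f y\<bar> \<le> 2 * level_const u * (2 * C) powr (s / u) * A * (\<Sum>j<n. (r * (2 * C) ^ Suc j) powr (\<beta> - s / u))))"
proof (cases "g x \<le> level_const u * A * \<rho> powr (- (s / u))")
  case True
  have "1 \<le> (2 * C) powr (s / u)" using C s u by (intro ge_one_powr_ge_zero) auto
  then have "level_const u * A * \<rho> powr (- (s / u)) \<le> (2 * C) powr (s / u) * (level_const u * A * \<rho> powr (- (s / u)))"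
    using level_const_pos[of u] A mult_right_mono[of 1 "(2 * C) powr (s / u)" "level_const u * A * \<rho> powr (- (s / u))"] by simp
  with True have "g x \<le> level_const u * (2 * C) powr (s / u) * A * \<rho> powr (- (s / u))" by (simp add: mult_ac)
  moreover have "d x x = 0" using x d_zero_iff by auto
  ultimately show ?thesis using x C \<rho> by (intro bexI[of _ x]) auto
next
  case False
  have "0 < level_const u * A * \<rho> powr (- (s / u))" using level_const_pos[of u] A \<rho> by simp
  with False have gx: "0 < g x" by linarith
  define r where "r = (level_const u * A / g x) powr (u / s)"
  have r: "0 < r" using gx level_const_pos[of u] A by (simp add: r_def)
  have "r powr (- (s / u)) = g x / (level_const u * A)"
    using gx level_const_pos[of u] A s u by (simp add: r_def powr_powr powr_minus)
  then have gr: "g x = level_const u * A * r powr (- (s / u))" using level_const_pos[of u] A by simp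
  have "r \<le> \<rho>"
  proof (rule ccontr)
    assume "\<not> r \<le> \<rho>"
    then have "r powr (- (s / u)) \<le> \<rho> powr (- (s / u))" using \<rho> s u by (intro powr_mono2') auto
    then have "g x \<le> level_const u * A * \<rho> powr (- (s / u))"
      unfolding gr using level_const_pos[of u] A by (intro mult_left_mono) auto
    with False show False by simp
  qed
  then obtain n where n: "r * (2 * C) ^ n \<le> \<rho>" "\<rho> < r * (2 * C) ^ n * (2 * C)"
    using geometric_scale_below[of "2 * C" r \<rho>] r C by auto
  obtain y where y: "y \<in> X - E" "g y \<le> level_const u * A * (r * (2 * C) ^ n) powr (- (s / u))"
    "d x y \<le> C * (r * (2 * C) ^ n)"
    "\<bar>f x - f y\<bar> \<le> 2 * level_const u * (2 * C) powr (s / u) * A * (\<Sum>j<n. (r * (2 * C) ^ Suc j) powr (\<beta> - s / u))"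
    using chain[OF pair A u \<beta> x r, of n] gr n(1) \<rho>(2) by auto
  have "d x y \<le> C * \<rho>" using y(3) n(1) C mult_left_mono[OF n(1), of C] by linarith
  moreover have "level_const u * A * (r * (2 * C) ^ n) powr (- (s / u)) \<le> level_const u * A * (\<rho> / (2 * C)) powr (- (s / u))"
    using n \<rho> C level_const_pos[of u] A s u by (intro mult_left_mono powr_mono2') (auto simp: field_simps)
  moreover have "(\<rho> / (2 * C)) powr (- (s / u)) = (2 * C) powr (s / u) * \<rho> powr (- (s / u))"
    using \<rho> C by (simp add: powr_divide powr_minus field_simps)
  ultimately have "g y \<le> level_const u * A * ((2 * C) powr (s / u) * \<rho> powr (- (s / u)))" "d x y \<le> C * \<rho>"
    using y(2) by auto
  then show ?thesis using y(1,4) gr r n(1)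
    by (intro bexI[of _ y] conjI disjI2 exI[of _ r] exI[of _ n]) (simp_all only: mult_ac)
qed

text \<open>
  Here \<open>e = \<beta> - s / u\<close> is negative and the chain is dominated by its first scale \<open>r\<close>, given by
  \<open>g x = level_const u * A * r powr (- (s / u))\<close>.  This yields the pointwise bound of
  \<open>f\<close> by a constant plus a multiple of \<open>g powr (u / w)\<close>, where \<open>w = s * u / (s - \<beta> * u)\<close>, and the
  power \<open>w\<close> of the right-hand side is integrable.
\<close>

lemma subcritical_bound:
  assumes u: "0 < u" and \<beta>: "0 < \<beta>" and crit: "\<beta> * u < s"
  shows "\<exists>K>0. \<forall>A>0. \<forall>f g E. hajlasz_pair M d \<beta> u A f g E \<longrightarrow>
    (\<integral>\<^sup>+x. ennreal (\<bar>f x\<bar> powr (s * u / (s - \<beta> * u))) \<partial>M)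
      \<le> ennreal ((K * A) powr (s * u / (s - \<beta> * u)))"
proof -
  define w where "w = s * u / (s - \<beta> * u)"
  define e where "e = \<beta> - s / u"
  have w: "0 < w" using u s crit by (simp add: w_def)
  have e: "e < 0" using u crit by (simp add: e_def field_simps)
  define G where "G = 1 / (1 - (2 * C) powr e)"
  have G: "0 < G" using C e powr_less_mono[of e 0 "2 * C"] by (simp add: G_def)
  define K1 where "K1 = 2 * level_const u * (2 * C) powr (s / u) * G * level_const u powr (- (u / w))"
  define T where "T = level_const u * (2 * C) powr (s / u) * R powr (- (s / u)) + level_const u * R powr (- (s / u))"
  define K2 where "K2 = R powr \<beta> * T + T"
  have K: "0 < K1" "0 < K2" "0 < T" using C level_const_pos[of u] G R by (auto simp: K1_def K2_def T_def intro!: add_pos_pos mult_pos_pos)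
  define H where "H = K1 + K2"
  have H: "0 < H" using K by (simp add: H_def)
  have "s / w = s / u - \<beta>" using u s crit by (simp add: w_def field_simps)
  then have we: "- (s / u) * (u / w) = e" using u by (simp add: e_def)
  have pointwise: "\<bar>f x\<bar> \<le> H * (A + A * (g x / A) powr (u / w))"
    if A: "0 < A" and pair: "hajlasz_pair M d \<beta> u A f g E" and x: "x \<in> X - E" for A f g E x
  proof -
    obtain y where y: "y \<in> X - E" "g y \<le> level_const u * (2 * C) powr (s / u) * A * R powr (- (s / u))"
      "f x = f y \<or> (\<exists>r n. 0 < r \<and> r * (2 * C) ^ n \<le> R \<and> g x = level_const u * A * r powr (- (s / u)) \<and>
      \<bar>f x - f y\<bar> \<le> 2 * level_const u * (2 * C) powr (s / u) * A * (\<Sum>j<n. (r * (2 * C) ^ Suc j) powr (\<beta> - s / u)))"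
      using chain_to_scale[OF pair A u \<beta> x R order.refl] by blast
    have first: "\<bar>f x - f y\<bar> \<le> K1 * (A * (g x / A) powr (u / w))"
      using y(3)
    proof
      assume "f x = f y"
      then show ?thesis using K A by simp
    next
      assume "\<exists>r n. 0 < r \<and> r * (2 * C) ^ n \<le> R \<and> g x = level_const u * A * r powr (- (s / u)) \<and>
      \<bar>f x - f y\<bar> \<le> 2 * level_const u * (2 * C) powr (s / u) * A * (\<Sum>j<n. (r * (2 * C) ^ Suc j) powr (\<beta> - s / u))"
      then obtain r n where r: "0 < r" "g x = level_const u * A * r powr (- (s / u))"
        "\<bar>f x - f y\<bar> \<le> 2 * level_const u * (2 * C) powr (s / u) * A * (\<Sum>j<n. (r * (2 * C) ^ Suc j) powr e)"
        unfolding e_def by blast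
      have "(\<Sum>j<n. (r * (2 * C) ^ Suc j) powr e) \<le> r powr e * G"
        using sum_geometric_scales_neg[of "2 * C" e r n] C e r(1) by (simp add: G_def)
      then have "\<bar>f x - f y\<bar> \<le> 2 * level_const u * (2 * C) powr (s / u) * A * (r powr e * G)"
        using r(3) level_const_pos[of u] A by (elim order.trans) (intro mult_left_mono, auto)
      also have "r powr e = level_const u powr (- (u / w)) * (g x / A) powr (u / w)"
      proof -
        have "g x / A = level_const u * r powr (- (s / u))" using r(2) A by simp
        then have "(g x / A) powr (u / w) = level_const u powr (u / w) * r powr (- (s / u) * (u / w))"
          using level_const_pos[of u] r(1) by (simp add: powr_mult powr_powr)
        also note we
        finally show ?thesis using level_const_pos[of u] by (simp add: powr_minus)
      qed
      finally show ?thesis by (simp add: K1_def mult_ac)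
    qed
    \<comment> \<open>At the largest scale every chain is compared with one point where both f and g are controlled.\<close>
    obtain z where z: "z \<in> X - E" "g z \<le> level_const u * A * R powr (- (s / u))" "\<bar>f z\<bar> \<le> level_const u * A * R powr (- (s / u))"
      using good_point[OF pair A u _ R order.refl, of x] x by blast
    have g_nonneg: "0 \<le> g y" "0 \<le> g z" using pair y z unfolding hajlasz_pair_def by auto
    have gyz: "g y + g z \<le> T * A" using y(2) z(2) by (simp add: T_def algebra_simps)
    have "\<bar>f y - f z\<bar> \<le> d y z powr \<beta> * (g y + g z)"
      using pair y(1) z(1) unfolding hajlasz_pair_def by blast
    also have "\<dots> \<le> R powr \<beta> * (T * A)"
      using y(1) z(1) gyz g_nonneg d_nonneg[of y z] diam[of y z] \<beta> by (intro mult_mono powr_mono2) auto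
    finally have "\<bar>f y - f z\<bar> \<le> R powr \<beta> * (T * A)" .
    moreover have "\<bar>f z\<bar> \<le> T * A"
      using z(3) level_const_pos[of u] A by (simp add: T_def algebra_simps add_increasing2)
    ultimately have "\<bar>f x\<bar> \<le> K1 * (A * (g x / A) powr (u / w)) + K2 * A"
      using first by (simp add: K2_def algebra_simps)
    also have "\<dots> \<le> H * (A + A * (g x / A) powr (u / w))"
      using K A by (simp add: H_def distrib_left distrib_right)
    finally show ?thesis .
  qed
  define V where "V = measure M X"
  have V: "0 < V" using measure_space_pos by (simp add: V_def)
  define K where "K = H * 2 * (V + 1) powr (1 / w)"
  have "(\<integral>\<^sup>+x. ennreal (\<bar>f x\<bar> powr w) \<partial>M) \<le> ennreal ((K * A) powr w)"
    if A: "0 < A" and pair: "hajlasz_pair M d \<beta> u A f g E" for A f g E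
  proof -
    have [measurable]: "f \<in> borel_measurable M" "g \<in> borel_measurable M" and E: "E \<in> null_sets M"
      and g_nonneg: "\<And>x. x \<in> X \<Longrightarrow> 0 \<le> g x"
      and int: "(\<integral>\<^sup>+x. ennreal (\<bar>g x\<bar> powr u) \<partial>M) \<le> ennreal (A powr u)"
      using pair unfolding hajlasz_pair_def by blast+
    define B where "B = (2 * H * A) powr w"
    have B: "0 \<le> B" by (simp add: B_def)
    have "(\<integral>\<^sup>+x. ennreal (\<bar>f x\<bar> powr w) \<partial>M) \<le>
        (\<integral>\<^sup>+x. ennreal B * (1 + ennreal (A powr (- u)) * ennreal (\<bar>g x\<bar> powr u)) \<partial>M)"
    proof (rule nn_integral_mono_AE, rule AE_I'[OF E], rule subsetI, rule ccontr)
      fix x assume x: "x \<in> {x \<in> X. \<not> ennreal (\<bar>f x\<bar> powr w) \<le>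
        ennreal B * (1 + ennreal (A powr (- u)) * ennreal (\<bar>g x\<bar> powr u))}" "x \<notin> E"
      let ?p = "(g x / A) powr (u / w)"
      have "\<bar>f x\<bar> powr w \<le> (H * (A + A * ?p)) powr w"
        using pointwise[OF A pair, of x] x w by (intro powr_mono2) auto
      also have "\<dots> = (H * A) powr w * (1 + ?p) powr w"
      proof -
        have "H * (A + A * ?p) = H * A * (1 + ?p)" by (simp add: algebra_simps)
        then show ?thesis using H A by (simp add: powr_mult)
      qed
      also have "\<dots> \<le> (H * A) powr w * (2 powr w * (1 powr w + ?p powr w))"
        using w by (intro mult_left_mono powr_add_le) auto
      also have "?p powr w = (g x / A) powr u" using w by (simp add: powr_powr)
      also have "(g x / A) powr u = A powr (- u) * \<bar>g x\<bar> powr u"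
        using A g_nonneg[of x] x by (simp add: powr_divide powr_minus field_simps)
      also have "(H * A) powr w * (2 powr w * (1 powr w + A powr (- u) * \<bar>g x\<bar> powr u))
          = B * (1 + A powr (- u) * \<bar>g x\<bar> powr u)"
        using H A by (simp add: B_def powr_mult)
      finally have "ennreal (\<bar>f x\<bar> powr w) \<le> ennreal (B * (1 + A powr (- u) * \<bar>g x\<bar> powr u))"
        by (rule ennreal_leI)
      then show False using x B by (simp add: ennreal_mult)
    qed
    also have "\<dots> = ennreal B * (emeasure M X + ennreal (A powr (- u)) * (\<integral>\<^sup>+x. ennreal (\<bar>g x\<bar> powr u) \<partial>M))"
      by (subst nn_integral_cmult) (auto simp: nn_integral_add nn_integral_cmult)
    also have "\<dots> \<le> ennreal B * (ennreal V + ennreal (A powr (- u)) * ennreal (A powr u))"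
      unfolding emeasure_space V_def using int by (intro mult_left_mono add_left_mono) auto
    also have "\<dots> = ennreal (B * (V + 1))"
    proof -
      have "ennreal (A powr (- u)) * ennreal (A powr u) = 1"
        using A by (simp add: powr_minus flip: ennreal_mult)
      then show ?thesis using B V by (simp add: ennreal_mult ennreal_plus)
    qed
    also have "B * (V + 1) = (K * A) powr w"
      using A V w H by (simp add: B_def K_def powr_mult powr_powr)
    finally show ?thesis .
  qed
  moreover have "0 < K" using H V by (simp add: K_def)
  ultimately show ?thesis unfolding w_def by blast
qed

text \<open>
  Here \<open>e = \<beta> - s / u\<close> is positive and the chain is dominated by its last scale.  Chains from \<open>x\<close>
  and from \<open>y\<close> up to the scale \<open>\<rho> = d x y\<close> end at points at distance at most a multiple of \<open>\<rho>\<close>, where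
  the gradient is at most a multiple of \<open>A * \<rho> powr (- (s / u))\<close>.
\<close>

lemma supercritical_bound:
  assumes u: "0 < u" and \<beta>: "0 < \<beta>" and crit: "s < \<beta> * u"
  shows "\<exists>K>0. \<forall>A>0. \<forall>f g E. hajlasz_pair M d \<beta> u A f g E \<longrightarrow>
    (\<forall>x\<in>X - E. \<bar>f x\<bar> \<le> K * A) \<and>
    (\<forall>x\<in>X - E. \<forall>y\<in>X - E. \<bar>f x - f y\<bar> \<le> K * A * d x y powr (\<beta> - s / u))"
proof -
  define e where "e = \<beta> - s / u"
  have e: "0 < e" using u crit by (simp add: e_def field_simps)
  define G where "G = (2 * C) powr e / ((2 * C) powr e - 1)"
  have G: "0 < G" using C e powr_less_mono[of 0 e "2 * C"] by (simp add: G_def)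
  define K0 where "K0 = level_const u * (2 * C) powr (s / u)"
  have K0: "0 < K0" using C level_const_pos[of u] by (simp add: K0_def)
  define K1 where "K1 = 2 * K0 * G"
  have K1: "0 < K1" using K0 G by (simp add: K1_def)
  define K2 where "K2 = 2 * K1 + (C\<^sup>2 * C) powr \<beta> * (2 * K0)"
  have K2: "0 < K2" using K1 K0 C by (simp add: K2_def add_pos_nonneg)
  have hoelder: "\<bar>f x - f y\<bar> \<le> K2 * A * d x y powr e"
    if A: "0 < A" and pair: "hajlasz_pair M d \<beta> u A f g E" and x: "x \<in> X - E" and y: "y \<in> X - E" for A f g E x y
  proof (cases "x = y")
    case False
    define \<rho> where "\<rho> = d x y"
    have \<rho>: "0 < \<rho>" "\<rho> \<le> R"
      using x y False d_nonneg[of x y] d_zero_iff[of x y] diam[of x y] by (auto simp: \<rho>_def)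
    have reach: "\<exists>x'\<in>X - E. g x' \<le> K0 * A * \<rho> powr (- (s / u)) \<and> d x x' \<le> C * \<rho> \<and> \<bar>f x - f x'\<bar> \<le> K1 * A * \<rho> powr e"
      if x: "x \<in> X - E" for x
    proof -
      obtain x' where x': "x' \<in> X - E" "g x' \<le> K0 * A * \<rho> powr (- (s / u))" "d x x' \<le> C * \<rho>"
        "f x = f x' \<or> (\<exists>r n. 0 < r \<and> r * (2 * C) ^ n \<le> \<rho> \<and> g x = level_const u * A * r powr (- (s / u)) \<and>
        \<bar>f x - f x'\<bar> \<le> 2 * level_const u * (2 * C) powr (s / u) * A * (\<Sum>j<n. (r * (2 * C) ^ Suc j) powr (\<beta> - s / u)))"
        using chain_to_scale[OF pair A u \<beta> x \<rho>] unfolding K0_def by blast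
      have "\<bar>f x - f x'\<bar> \<le> K1 * A * \<rho> powr e"
        using x'(4)
      proof
        assume "f x = f x'"
        then show ?thesis using K1 A by simp
      next
        assume "\<exists>r n. 0 < r \<and> r * (2 * C) ^ n \<le> \<rho> \<and> g x = level_const u * A * r powr (- (s / u)) \<and>
        \<bar>f x - f x'\<bar> \<le> 2 * level_const u * (2 * C) powr (s / u) * A * (\<Sum>j<n. (r * (2 * C) ^ Suc j) powr (\<beta> - s / u))"
        then obtain r n where r: "0 < r" "r * (2 * C) ^ n \<le> \<rho>"
          "\<bar>f x - f x'\<bar> \<le> 2 * K0 * A * (\<Sum>j<n. (r * (2 * C) ^ Suc j) powr e)"
          unfolding e_def K0_def by (auto simp: mult.assoc)
        have "(\<Sum>j<n. (r * (2 * C) ^ Suc j) powr e) \<le> G * (r * (2 * C) ^ n) powr e"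
          using sum_geometric_scales_pos[of "2 * C" e r n] C e r(1) by (simp add: G_def)
        also have "\<dots> \<le> G * \<rho> powr e" using r C e G by (intro mult_left_mono powr_mono2) auto
        finally have "2 * K0 * A * (\<Sum>j<n. (r * (2 * C) ^ Suc j) powr e) \<le> 2 * K0 * A * (G * \<rho> powr e)"
          using K0 A by (intro mult_left_mono) auto
        with r(3) show ?thesis by (simp add: K1_def mult_ac)
      qed
      then show ?thesis using x' by blast
    qed
    obtain x' where x': "x' \<in> X - E" "g x' \<le> K0 * A * \<rho> powr (- (s / u))" "d x x' \<le> C * \<rho>"
      "\<bar>f x - f x'\<bar> \<le> K1 * A * \<rho> powr e" using reach[OF x] by blast
    obtain y' where y': "y' \<in> X - E" "g y' \<le> K0 * A * \<rho> powr (- (s / u))" "d y y' \<le> C * \<rho>"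
      "\<bar>f y - f y'\<bar> \<le> K1 * A * \<rho> powr e" using reach[OF y] by blast
    have "\<rho> \<le> C * \<rho>" using C \<rho> mult_right_mono[of 1 C \<rho>] by linarith
    then have "max (d x y) (d y y') \<le> C * \<rho>" using y'(3) unfolding \<rho>_def by simp
    then have "C * max (d x y) (d y y') \<le> C * (C * \<rho>)" using C by (intro mult_left_mono) auto
    then have "d x y' \<le> C * (C * \<rho>)" using tri[of x y' y] x y y' by auto
    moreover have "d x' x \<le> C * (C * \<rho>)"
    proof -
      have "d x' x \<le> C * d x x'" using sym[of x x'] x x'(1) by auto
      also have "\<dots> \<le> C * (C * \<rho>)" using x'(3) C by (intro mult_left_mono) auto
      finally show ?thesis .
    qed
    ultimately have "C * max (d x' x) (d x y') \<le> C * (C * (C * \<rho>))"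
      using C by (intro mult_left_mono) auto
    then have "d x' y' \<le> C * (C * (C * \<rho>))" using tri[of x' y' x] x x' y' by auto
    then have dist: "d x' y' \<le> C\<^sup>2 * C * \<rho>" by (simp add: power2_eq_square mult_ac)
    have g_nonneg: "0 \<le> g x'" "0 \<le> g y'" using pair x' y' unfolding hajlasz_pair_def by auto
    have "\<bar>f x' - f y'\<bar> \<le> d x' y' powr \<beta> * (g x' + g y')"
      using pair x'(1) y'(1) unfolding hajlasz_pair_def by blast
    also have "\<dots> \<le> (C\<^sup>2 * C * \<rho>) powr \<beta> * (2 * (K0 * A * \<rho> powr (- (s / u))))"
      using x' y' dist g_nonneg d_nonneg[of x' y'] \<beta> by (intro mult_mono powr_mono2) auto
    also have "\<dots> = (C\<^sup>2 * C) powr \<beta> * (2 * K0) * A * (\<rho> powr \<beta> * \<rho> powr (- (s / u)))"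
      using C \<rho> by (simp add: powr_mult)
    also have "\<rho> powr \<beta> * \<rho> powr (- (s / u)) = \<rho> powr e" by (simp add: e_def flip: powr_add)
    finally have "\<bar>f x - f y\<bar> \<le> 2 * (K1 * A * \<rho> powr e) + (C\<^sup>2 * C) powr \<beta> * (2 * K0) * A * \<rho> powr e"
      using x'(4) y'(4) by linarith
    then show ?thesis by (simp add: K2_def \<rho>_def algebra_simps)
  qed (use K2 A in simp)
  define K3 where "K3 = level_const u * R powr (- (s / u)) + K2 * R powr e"
  have sup: "\<bar>f x\<bar> \<le> K3 * A"
    if A: "0 < A" and pair: "hajlasz_pair M d \<beta> u A f g E" and x: "x \<in> X - E" for A f g E x
  proof -
    obtain z where z: "z \<in> X - E" "\<bar>f z\<bar> \<le> level_const u * A * R powr (- (s / u))"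
      using good_point[OF pair A u _ R order.refl, of x] x by blast
    have "\<bar>f x - f z\<bar> \<le> K2 * A * d x z powr e" by (rule hoelder[OF A pair x z(1)])
    also have "\<dots> \<le> K2 * A * R powr e"
      using K2 A e x z diam[of x z] d_nonneg[of x z] by (intro mult_left_mono powr_mono2) auto
    finally show ?thesis using z(2) by (simp add: K3_def algebra_simps)
  qed
  show ?thesis
  proof (intro exI[of _ "max K2 K3"] conjI allI impI ballI)
    show "0 < max K2 K3" using K2 by simp
    fix A f g E x assume A: "0 < A" and pair: "hajlasz_pair M d \<beta> u A f g E" and x: "x \<in> X - E"
    have "K3 * A \<le> max K2 K3 * A" using A by (intro mult_right_mono) auto
    then show "\<bar>f x\<bar> \<le> max K2 K3 * A" using sup[OF A pair x] by linarith
    fix y assume y: "y \<in> X - E"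
    have "K2 * A * d x y powr e \<le> max K2 K3 * A * d x y powr e"
      using A by (intro mult_right_mono) auto
    then show "\<bar>f x - f y\<bar> \<le> max K2 K3 * A * d x y powr (\<beta> - s / u)"
      using hoelder[OF A pair x y] by (simp add: e_def)
  qed
qed

section \<open>Finite nets and compactness in Lebesgue spaces\<close>

text \<open>
  A maximal separated set is a net.  Separated sets have bounded cardinality, because the balls of
  a smaller radius about their points are disjoint and each has a fixed amount of the finite
  total mass.
\<close>

lemma finite_cover:
  assumes "0 < t"
  shows "\<exists>S. finite S \<and> S \<subseteq> X \<and> (\<forall>x\<in>X. \<exists>z\<in>S. d z x < t)"
proof -
  define \<rho> where "\<rho> = t / C"
  have \<rho>: "0 < \<rho>" "C * \<rho> = t" using assms C by (auto simp: \<rho>_def)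
  \<comment> \<open>Separation is required in both orders of the arguments, since d need not be symmetric.\<close>
  define sep where "sep S \<longleftrightarrow> finite S \<and> S \<subseteq> X \<and> (\<forall>x\<in>S. \<forall>y\<in>S. x \<noteq> y \<longrightarrow> \<rho> \<le> d x y)" for S
  define r where "r = min R (\<rho> / (2 * C\<^sup>2))"
  have r: "0 < r" "r \<le> R" "C\<^sup>2 * r < \<rho>"
  proof -
    have C2: "0 < C\<^sup>2" using C by simp
    then show "0 < r" "r \<le> R" using R \<rho> by (auto simp: r_def)
    have "C\<^sup>2 * r \<le> C\<^sup>2 * (\<rho> / (2 * C\<^sup>2))" unfolding r_def using C2 by (intro mult_left_mono) auto
    also have "\<dots> < \<rho>" using C2 C \<rho> by simp
    finally show "C\<^sup>2 * r < \<rho>" .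
  qed
  let ?ball = "\<lambda>x. qm_ball X d x r"
  note ball = quasi_metric_measure_spaceD[OF M]
  define V where "V = measure M X"
  have card: "real (card S) * (b * r powr s) \<le> V" if S: "sep S" for S
  proof -
    have fin: "finite S" and SX: "S \<subseteq> X" using S by (auto simp: sep_def)
    have disj: "disjoint_family_on ?ball S"
      unfolding disjoint_family_on_def
    proof (intro ballI impI, rule ccontr)
      fix x y assume xy: "x \<in> S" "y \<in> S" "x \<noteq> y" "?ball x \<inter> ?ball y \<noteq> {}"
      then obtain z where z: "z \<in> X" "d x z < r" "d y z < r" by (auto simp: qm_ball_def)
      have X: "x \<in> X" "y \<in> X" using xy SX by auto
      have "d z y \<le> C * d y z" using sym X z by auto
      also have "\<dots> \<le> C * r" using z C by (intro mult_left_mono) auto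
      finally have "d z y \<le> C * r" .
      moreover have "r \<le> C * r" using C r mult_right_mono[of 1 C r] by linarith
      ultimately have "C * max (d x z) (d z y) \<le> C * (C * r)" using z C by (intro mult_left_mono) auto
      then have "d x y \<le> C\<^sup>2 * r" using tri[OF X z(1)] by (simp add: power2_eq_square mult.assoc)
      moreover have "\<rho> \<le> d x y" using S xy by (auto simp: sep_def)
      ultimately show False using r by simp
    qed
    have "ennreal (\<Sum>x\<in>S. b * r powr s) \<le> ennreal (\<Sum>x\<in>S. measure M (?ball x))"
      using lower r SX by (intro ennreal_leI sum_mono) auto
    also have "\<dots> = (\<Sum>x\<in>S. ennreal (measure M (?ball x)))" by (rule sum_ennreal[symmetric]) simp
    also have "\<dots> = (\<Sum>x\<in>S. emeasure M (?ball x))"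
      using ball(6) r SX by (intro sum.cong) (auto simp: subset_iff)
    also have "\<dots> = emeasure M (\<Union>x\<in>S. ?ball x)"
      using disj fin ball(3) r SX by (intro sum_emeasure) auto
    also have "\<dots> \<le> emeasure M X" by (intro emeasure_mono) (auto simp: qm_ball_def)
    finally show ?thesis using measure_space_pos by (simp add: emeasure_space V_def)
  qed
  define N where "N = nat \<lceil>V / (b * r powr s)\<rceil>"
  have "card S \<le> N" if "sep S" for S
  proof -
    have "real (card S) \<le> V / (b * r powr s)" using card[OF that] b r by (simp add: pos_le_divide_eq)
    then show ?thesis unfolding N_def by linarith
  qed
  moreover have "sep {}" by (simp add: sep_def)
  ultimately obtain S where S: "sep S" and max: "\<And>T. sep T \<Longrightarrow> card T \<le> card S"
    using ex_has_greatest_nat[of sep "{}" card "Suc N"] by (auto simp: less_Suc_eq_le)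
  have "\<exists>z\<in>S. d z x < t" if x: "x \<in> X" for x
  proof (rule ccontr)
    assume far: "\<not> ?thesis"
    have Cr: "\<rho> \<le> C * \<rho>" "0 < C * \<rho>" using C \<rho> mult_right_mono[of 1 C \<rho>] by linarith+
    have xx: "d x x = 0" using d_zero_iff x by auto
    have "sep (insert x S)"
      unfolding sep_def
    proof (intro conjI ballI impI)
      fix y z assume yz: "y \<in> insert x S" "z \<in> insert x S" "y \<noteq> z"
      have "\<rho> \<le> d x z" if "z \<in> S" for z
      proof -
        have zX: "z \<in> X" using S that by (auto simp: sep_def)
        have "C * \<rho> \<le> C * d x z" using far that sym[OF x zX] \<rho> by force
        then show ?thesis using C by simp
      qed
      moreover have "\<rho> \<le> d z x" if "z \<in> S" for z
      proof -
        have "t \<le> d z x" using far that by (meson not_less)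
        then show ?thesis using Cr \<rho> by linarith
      qed
      ultimately show "\<rho> \<le> d y z" using yz S by (auto simp: sep_def)
    qed (use S x in \<open>auto simp: sep_def\<close>)
    moreover have "x \<notin> S" using far xx assms by auto
    then have "card S < card (insert x S)" using S by (simp add: sep_def)
    ultimately show False using max by fastforce
  qed
  then show ?thesis using S by (intro exI[of _ S]) (auto simp: sep_def)
qed

text \<open>
  The discretisation behind the theorem of Arzela and Ascoli.  Sample each function at one point of
  its own good set \<open>U f\<close> in every ball of a finite cover and round the value; there are only finitely
  many patterns, and functions with the same pattern are close wherever both are good.  The
  good sets may vary with the function: for \<open>L\<^sup>q\<close> they are the sets where the function
  and its gradient are not too large, for Hoelder spaces the whole space.
\<close>

lemma equicontinuous_net:
  assumes L: "0 \<le> L" and H: "0 \<le> H" and e: "0 < e" and \<eta>: "0 < \<eta>"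
    and U: "\<And>f. f \<in> G \<Longrightarrow> U f \<subseteq> X"
    and bound: "\<And>f x. f \<in> G \<Longrightarrow> x \<in> U f \<Longrightarrow> \<bar>f x\<bar> \<le> L"
    and hoelder: "\<And>f x y. f \<in> G \<Longrightarrow> x \<in> U f \<Longrightarrow> y \<in> U f \<Longrightarrow> \<bar>f x - f y\<bar> \<le> H * d x y powr e"
  shows "\<exists>K. finite K \<and> K \<subseteq> G \<and> (\<forall>f\<in>G. \<exists>k\<in>K. \<forall>x\<in>U f \<inter> U k. \<bar>f x - k x\<bar> \<le> \<eta>)"
proof -
  define \<rho> where "\<rho> = (\<eta> / (3 * (H + 1))) powr (1 / e) / C\<^sup>2"
  have \<rho>: "0 < \<rho>" using H \<eta> C by (simp add: \<rho>_def)
  have small: "H * t powr e \<le> \<eta> / 3" if "0 \<le> t" "t \<le> C\<^sup>2 * \<rho>" for t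
  proof -
    have "t powr e \<le> (C\<^sup>2 * \<rho>) powr e" using that e by (intro powr_mono2) auto
    also have "\<dots> = \<eta> / (3 * (H + 1))" using C e \<eta> H by (simp add: \<rho>_def powr_powr)
    finally have "H * t powr e \<le> H * (\<eta> / (3 * (H + 1)))" using H by (intro mult_left_mono) auto
    also have "\<dots> \<le> \<eta> / 3" using H \<eta> by (simp add: field_simps)
    finally show ?thesis .
  qed
  obtain S where S: "finite S" "S \<subseteq> X" "\<And>x. x \<in> X \<Longrightarrow> \<exists>z\<in>S. d z x < \<rho>"
    using finite_cover[OF \<rho>] by blast
  define P where "P f z y \<longleftrightarrow> y \<in> U f \<and> d z y < \<rho>" for f z y
  \<comment> \<open>A ball that misses the good set of f contains no point where f is compared with another
      function, so any value may be recorded for it.\<close>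
  define v where "v f z = (if \<exists>y. P f z y then \<lfloor>3 * f (SOME y. P f z y) / \<eta>\<rfloor> else 0)" for f z
  define B where "B = \<lceil>3 * L / \<eta>\<rceil>"
  have v_in: "v f z \<in> {- B - 1..B + 1}" if "f \<in> G" for f z
  proof (cases "\<exists>y. P f z y")
    case True
    define y where "y = (SOME y. P f z y)"
    have "P f z y" unfolding y_def using True by (rule someI_ex)
    then have "\<bar>f y\<bar> \<le> L" using bound that by (simp add: P_def)
    then have "\<bar>3 * f y / \<eta>\<bar> \<le> 3 * L / \<eta>" using \<eta> by (simp add: abs_mult divide_right_mono)
    then have "\<bar>3 * f y / \<eta>\<bar> \<le> B" unfolding B_def by linarith
    then show ?thesis using True unfolding v_def y_def[symmetric] by (simp, linarith)
  next
    case False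
    have "0 \<le> 3 * L / \<eta>" using L \<eta> by simp
    then have "0 \<le> B" unfolding B_def by linarith
    then show ?thesis using False by (simp add: v_def)
  qed
  obtain K where K: "finite K" "K \<subseteq> G" "\<And>f. f \<in> G \<Longrightarrow> \<exists>k\<in>K. \<forall>z\<in>S. v f z = v k z"
    using finite_representatives[of S "{- B - 1..B + 1}" G v] S(1) v_in by auto
  have close: "\<bar>f x - f (SOME y. P f z y)\<bar> \<le> \<eta> / 3"
    if f: "f \<in> G" and x: "P f z x" and z: "z \<in> S" for f x z
  proof -
    define y where "y = (SOME y. P f z y)"
    have y: "P f z y" unfolding y_def using x by (rule someI)
    have X: "x \<in> X" "y \<in> X" "z \<in> X" using x y z U[OF f] S(2) by (auto simp: P_def)
    have "d x z \<le> C * d z x" using sym X by blast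
    also have "\<dots> \<le> C * \<rho>" using x C by (intro mult_left_mono) (auto simp: P_def)
    finally have "d x z \<le> C * \<rho>" .
    moreover have "\<rho> \<le> C * \<rho>" using C \<rho> mult_right_mono[of 1 C \<rho>] by linarith
    ultimately have "C * max (d x z) (d z y) \<le> C * (C * \<rho>)"
      using y C by (intro mult_left_mono) (auto simp: P_def)
    then have "d x y \<le> C\<^sup>2 * \<rho>" using tri[of x y z] X by (simp add: power2_eq_square mult.assoc)
    then have "H * d x y powr e \<le> \<eta> / 3" using d_nonneg X by (intro small) auto
    then show ?thesis using hoelder[OF f, of x y] x y unfolding y_def[symmetric] by (auto simp: P_def)
  qed
  have "\<bar>f x - k x\<bar> \<le> \<eta>" if f: "f \<in> G" and k: "k \<in> K" and v: "\<forall>z\<in>S. v f z = v k z"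
    and x: "x \<in> U f \<inter> U k" for f k x
  proof -
    obtain z where z: "z \<in> S" "d z x < \<rho>" using S(3)[of x] x U[OF f] by auto
    have Pf: "P f z x" "P k z x" using x z by (auto simp: P_def)
    define y y' where "y = (SOME y. P f z y)" and "y' = (SOME y. P k z y)"
    have "\<lfloor>3 * f y / \<eta>\<rfloor> = \<lfloor>3 * k y' / \<eta>\<rfloor>"
      using v z(1) Pf unfolding v_def y_def y'_def by (auto split: if_splits)
    then have "\<bar>3 * f y / \<eta> - 3 * k y' / \<eta>\<bar> \<le> 1" by linarith
    moreover have "3 * f y / \<eta> - 3 * k y' / \<eta> = 3 * (f y - k y') / \<eta>"
      by (simp add: diff_divide_distrib right_diff_distrib)
    moreover have "\<bar>3 * (f y - k y') / \<eta>\<bar> = 3 * \<bar>f y - k y'\<bar> / \<eta>"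
      using \<eta> by (simp only: abs_divide abs_mult)
    ultimately have "3 * \<bar>f y - k y'\<bar> / \<eta> \<le> 1" by linarith
    then have "\<bar>f y - k y'\<bar> \<le> \<eta> / 3" using \<eta> by (simp add: pos_divide_le_eq)
    moreover have "\<bar>f x - f y\<bar> \<le> \<eta> / 3" "\<bar>k x - k y'\<bar> \<le> \<eta> / 3"
      unfolding y_def y'_def using close f k K(2) Pf z(1) by auto
    ultimately show ?thesis by linarith
  qed
  then show ?thesis using K by (intro exI[of _ K]) blast
qed

text \<open>
  Off the good sets the difference of two functions need not be small, but it contributes little to the
  integral: where it exceeds \<open>N\<close>, by the bound in the higher exponent \<open>w\<close>, and elsewhere, because
  the functions or their gradients exceed \<open>L\<close>.  All three contributions are collected in one
  inequality between integrable functions, with a third of \<open>\<epsilon>\<close> for each.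
\<close>

lemma Lq_net:
  assumes u: "0 < u" and \<beta>: "0 < \<beta>" and A: "0 < A" and q: "0 < q" "q < w" and B: "0 \<le> B"
    and pair: "\<And>f. f \<in> G \<Longrightarrow> \<exists>g E. hajlasz_pair M d \<beta> u A f g E"
    and int_w: "\<And>f. f \<in> G \<Longrightarrow> (\<integral>\<^sup>+x. ennreal (\<bar>f x\<bar> powr w) \<partial>M) \<le> ennreal B"
    and \<epsilon>: "0 < \<epsilon>"
  shows "\<exists>K. finite K \<and> K \<subseteq> G \<and>
    (\<forall>f\<in>G. \<exists>k\<in>K. (\<integral>\<^sup>+x. ennreal (\<bar>f x - k x\<bar> powr q) \<partial>M) \<le> ennreal \<epsilon>)"
proof -
  obtain g E where gE: "\<And>f. f \<in> G \<Longrightarrow> hajlasz_pair M d \<beta> u A f (g f) (E f)"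
    using pair by metis
  define V where "V = measure M X"
  have V: "0 < V" using measure_space_pos by (simp add: V_def)
  define D where "D = 2 powr w * (B + B)"
  have D: "0 \<le> D" using B by (simp add: D_def)
  \<comment> \<open>L depends on N: the product of N powr q with the measure of the bad set has to be small.\<close>
  define N where "N = (\<epsilon> / (3 * (D + 1))) powr (1 / (q - w))"
  define \<eta> where "\<eta> = (\<epsilon> / (3 * (V + 1))) powr (1 / q)"
  define L where "L = (12 * N powr q * A powr u / \<epsilon>) powr (1 / u)"
  have pos: "0 < N" "0 < \<eta>" "0 < L" using \<epsilon> D V A by (auto simp: N_def \<eta>_def L_def)
  have N_D: "N powr (q - w) * D \<le> \<epsilon> / 3"
  proof -
    have "N powr (q - w) = \<epsilon> / (3 * (D + 1))" using \<epsilon> D q by (simp add: N_def powr_powr)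
    moreover have "3 * D + 3 \<noteq> 0" using D by linarith
    ultimately have "N powr (q - w) * (D + 1) = \<epsilon> / 3" by (simp add: field_simps)
    moreover have "N powr (q - w) * D \<le> N powr (q - w) * (D + 1)" by (intro mult_left_mono) auto
    ultimately show ?thesis by linarith
  qed
  have \<eta>_V: "\<eta> powr q * V \<le> \<epsilon> / 3"
  proof -
    have "\<eta> powr q = \<epsilon> / (3 * (V + 1))" using \<epsilon> V q by (simp add: \<eta>_def powr_powr)
    moreover have "3 * V + 3 \<noteq> 0" using V by linarith
    ultimately have "\<eta> powr q * (V + 1) = \<epsilon> / 3" by (simp add: field_simps)
    moreover have "\<eta> powr q * V \<le> \<eta> powr q * (V + 1)" by (intro mult_left_mono) auto
    ultimately show ?thesis by linarith
  qed
  define Q where "Q = N powr q * L powr (- u)"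
  have Q: "0 \<le> Q" by (simp add: Q_def)
  have Q_A: "Q * (4 * A powr u) = \<epsilon> / 3"
  proof -
    have "L powr u = 12 * N powr q * A powr u / \<epsilon>" using \<epsilon> u pos A by (simp add: L_def powr_powr)
    then have "L powr (- u) = \<epsilon> / (12 * N powr q * A powr u)" by (simp add: powr_minus)
    then show ?thesis using pos A by (simp add: Q_def)
  qed
  define U where "U f = {x \<in> X - E f. g f x \<le> L \<and> \<bar>f x\<bar> \<le> L}" for f
  have "\<exists>K. finite K \<and> K \<subseteq> G \<and> (\<forall>f\<in>G. \<exists>k\<in>K. \<forall>x\<in>U f \<inter> U k. \<bar>f x - k x\<bar> \<le> \<eta>)"
  proof (rule equicontinuous_net[of L "2 * L" \<beta>])
    fix f x y assume f: "f \<in> G" and xy: "x \<in> U f" "y \<in> U f"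
    have "\<bar>f x - f y\<bar> \<le> d x y powr \<beta> * (g f x + g f y)"
      using gE[OF f] xy unfolding hajlasz_pair_def U_def by blast
    also have "\<dots> \<le> d x y powr \<beta> * (2 * L)" using xy by (intro mult_left_mono) (auto simp: U_def)
    finally show "\<bar>f x - f y\<bar> \<le> 2 * L * d x y powr \<beta>" by (simp add: mult_ac)
  qed (use pos \<beta> in \<open>auto simp: U_def\<close>)
  then obtain K where K: "finite K" "K \<subseteq> G" "\<And>f. f \<in> G \<Longrightarrow> \<exists>k\<in>K. \<forall>x\<in>U f \<inter> U k. \<bar>f x - k x\<bar> \<le> \<eta>"
    by blast
  have "(\<integral>\<^sup>+x. ennreal (\<bar>f x - k x\<bar> powr q) \<partial>M) \<le> ennreal \<epsilon>"
    if f: "f \<in> G" and k: "k \<in> G" and close: "\<forall>x\<in>U f \<inter> U k. \<bar>f x - k x\<bar> \<le> \<eta>" for f k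
  proof -
    have [measurable]: "f \<in> borel_measurable M" "k \<in> borel_measurable M"
      "g f \<in> borel_measurable M" "g k \<in> borel_measurable M"
      and E: "E f \<union> E k \<in> null_sets M"
      and int: "(\<integral>\<^sup>+x. ennreal (\<bar>f x\<bar> powr u) \<partial>M) \<le> ennreal (A powr u)"
        "(\<integral>\<^sup>+x. ennreal (\<bar>g f x\<bar> powr u) \<partial>M) \<le> ennreal (A powr u)"
        "(\<integral>\<^sup>+x. ennreal (\<bar>k x\<bar> powr u) \<partial>M) \<le> ennreal (A powr u)"
        "(\<integral>\<^sup>+x. ennreal (\<bar>g k x\<bar> powr u) \<partial>M) \<le> ennreal (A powr u)"
      using gE[OF f] gE[OF k] unfolding hajlasz_pair_def by blast+
    have int_diff: "(\<integral>\<^sup>+x. ennreal (\<bar>f x - k x\<bar> powr w) \<partial>M) \<le> ennreal D"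
      unfolding D_def using int_w[OF f] int_w[OF k] B q
      by (intro nn_integral_powr_diff_le[where h = "\<lambda>_. 0"]) auto
    define S where "S x = \<bar>f x\<bar> powr u + \<bar>g f x\<bar> powr u + (\<bar>k x\<bar> powr u + \<bar>g k x\<bar> powr u)" for x
    have S_nonneg: "0 \<le> S x" for x by (simp add: S_def)
    have pointwise: "\<bar>f x - k x\<bar> powr q \<le> \<eta> powr q + N powr (q - w) * \<bar>f x - k x\<bar> powr w + Q * S x"
      if x: "x \<in> X" "x \<notin> E f \<union> E k" for x
    proof (cases "x \<in> U f \<inter> U k")
      case True
      then have "\<bar>f x - k x\<bar> powr q \<le> \<eta> powr q" using close q by (intro powr_mono2) auto
      then show ?thesis using Q S_nonneg by (simp add: add_increasing2)
    next
      case False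
      then have "L < \<bar>f x\<bar> \<or> L < \<bar>g f x\<bar> \<or> L < \<bar>k x\<bar> \<or> L < \<bar>g k x\<bar>" using x by (auto simp: U_def)
      then have "L powr u \<le> S x"
      proof (elim disjE)
        assume "L < \<bar>f x\<bar>"
        then have "L powr u \<le> \<bar>f x\<bar> powr u" using pos u by (intro powr_mono2) auto
        then show ?thesis unfolding S_def by (simp add: add_increasing2)
      next
        assume "L < \<bar>g f x\<bar>"
        then have "L powr u \<le> \<bar>g f x\<bar> powr u" using pos u by (intro powr_mono2) auto
        then show ?thesis unfolding S_def by (simp add: add_increasing add_increasing2)
      next
        assume "L < \<bar>k x\<bar>"
        then have "L powr u \<le> \<bar>k x\<bar> powr u" using pos u by (intro powr_mono2) auto
        then show ?thesis unfolding S_def by (simp add: add_increasing add_increasing2)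
      next
        assume "L < \<bar>g k x\<bar>"
        then have "L powr u \<le> \<bar>g k x\<bar> powr u" using pos u by (intro powr_mono2) auto
        then show ?thesis unfolding S_def by (simp add: add_increasing)
      qed
      then have "Q * L powr u \<le> Q * S x" using Q by (intro mult_left_mono) auto
      then have "N powr q \<le> Q * S x" using pos by (simp add: Q_def powr_minus)
      moreover have "\<bar>f x - k x\<bar> powr q \<le> N powr q + N powr (q - w) * \<bar>f x - k x\<bar> powr w"
        using pos q by (intro split_powr_le) auto
      moreover have "0 \<le> \<eta> powr q" by simp
      ultimately show ?thesis by linarith
    qed
    have "(\<integral>\<^sup>+x. ennreal (\<bar>f x - k x\<bar> powr q) \<partial>M) \<le> (\<integral>\<^sup>+x. ennreal (\<eta> powr q) +
        ennreal (N powr (q - w)) * ennreal (\<bar>f x - k x\<bar> powr w) +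
        ennreal Q * (ennreal (\<bar>f x\<bar> powr u) + ennreal (\<bar>g f x\<bar> powr u) +
          (ennreal (\<bar>k x\<bar> powr u) + ennreal (\<bar>g k x\<bar> powr u))) \<partial>M)"
    proof (rule nn_integral_mono_AE, rule AE_I'[OF E], rule subsetI, rule ccontr)
      fix x assume x: "x \<in> {x \<in> X. \<not> ennreal (\<bar>f x - k x\<bar> powr q) \<le> ennreal (\<eta> powr q) +
        ennreal (N powr (q - w)) * ennreal (\<bar>f x - k x\<bar> powr w) +
        ennreal Q * (ennreal (\<bar>f x\<bar> powr u) + ennreal (\<bar>g f x\<bar> powr u) +
          (ennreal (\<bar>k x\<bar> powr u) + ennreal (\<bar>g k x\<bar> powr u)))}" "x \<notin> E f \<union> E k"
      then have "ennreal (\<bar>f x - k x\<bar> powr q) \<le>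
          ennreal (\<eta> powr q + N powr (q - w) * \<bar>f x - k x\<bar> powr w + Q * S x)"
        using pointwise by (intro ennreal_leI) auto
      also have "\<dots> = ennreal (\<eta> powr q) +
        ennreal (N powr (q - w)) * ennreal (\<bar>f x - k x\<bar> powr w) +
        ennreal Q * (ennreal (\<bar>f x\<bar> powr u) + ennreal (\<bar>g f x\<bar> powr u) +
          (ennreal (\<bar>k x\<bar> powr u) + ennreal (\<bar>g k x\<bar> powr u)))"
        using Q S_nonneg[of x] by (simp add: S_def ennreal_mult ennreal_plus)
      finally show False using x by blast
    qed
    also have "\<dots> = ennreal (\<eta> powr q) * ennreal V +
        ennreal (N powr (q - w)) * (\<integral>\<^sup>+x. ennreal (\<bar>f x - k x\<bar> powr w) \<partial>M) +
        ennreal Q * ((\<integral>\<^sup>+x. ennreal (\<bar>f x\<bar> powr u) \<partial>M) + (\<integral>\<^sup>+x. ennreal (\<bar>g f x\<bar> powr u) \<partial>M) +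
          ((\<integral>\<^sup>+x. ennreal (\<bar>k x\<bar> powr u) \<partial>M) + (\<integral>\<^sup>+x. ennreal (\<bar>g k x\<bar> powr u) \<partial>M)))"
      by (simp add: nn_integral_add nn_integral_cmult emeasure_space V_def)
    also have "\<dots> \<le> ennreal (\<eta> powr q) * ennreal V + ennreal (N powr (q - w)) * ennreal D +
        ennreal Q * (ennreal (A powr u) + ennreal (A powr u) + (ennreal (A powr u) + ennreal (A powr u)))"
      using int int_diff by (intro add_mono mult_left_mono) auto
    also have "\<dots> = ennreal (\<eta> powr q * V + N powr (q - w) * D + Q * (4 * A powr u))"
      using V D Q by (simp flip: ennreal_mult ennreal_plus)
    also have "\<dots> \<le> ennreal \<epsilon>" using N_D \<eta>_V Q_A by (intro ennreal_leI) linarith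
    finally show ?thesis .
  qed
  then show ?thesis using K by (intro exI[of _ K]) blast
qed

text \<open>
  Any bound in an exponent \<open>w\<close> larger than \<open>q\<close> suffices for compactness in \<open>L\<^sup>q\<close>, so
  this applies on both sides of the critical exponent.
\<close>

lemma compact_embedding_Lq:
  assumes u: "0 < u" and \<beta>: "0 < \<beta>" and q: "0 < q" "q < w" and K: "0 < K"
    and bound: "\<And>A f g E. 0 < A \<Longrightarrow> hajlasz_pair M d \<beta> u A f g E \<Longrightarrow>
      (\<integral>\<^sup>+x. ennreal (\<bar>f x\<bar> powr w) \<partial>M) \<le> ennreal ((K * A) powr w)"
  shows "compact_embedding M (hajlasz_sobolev_space M d \<beta> u) (Lp_space M q)"
  unfolding compact_embedding_def
proof (intro conjI allI impI)
  let ?H = "hajlasz_sobolev_space M d \<beta> u"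
  define V where "V = measure M X"
  have V: "0 < V" using measure_space_pos by (simp add: V_def)
  show "continuous_embedding M ?H (Lp_space M q)"
  proof (rule continuous_embedding_LpI[OF u q(1)])
    show "0 \<le> (V + K powr w) powr (1 / q)" by simp
    fix A :: real and f g E assume A: "0 < A" and pair: "hajlasz_pair M d \<beta> u A f g E"
    have [measurable]: "f \<in> borel_measurable M" using pair unfolding hajlasz_pair_def by blast
    have "(\<integral>\<^sup>+x. ennreal (\<bar>f x\<bar> powr q) \<partial>M) \<le>
        (\<integral>\<^sup>+x. ennreal (A powr q) + ennreal (A powr (q - w)) * ennreal (\<bar>f x\<bar> powr w) \<partial>M)"
      using split_powr_le[OF _ A q(1) less_imp_le[OF q(2)]]
      by (intro nn_integral_mono) (simp flip: ennreal_mult ennreal_plus)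
    also have "\<dots> = ennreal (A powr q) * ennreal V + ennreal (A powr (q - w)) * (\<integral>\<^sup>+x. ennreal (\<bar>f x\<bar> powr w) \<partial>M)"
      by (simp add: nn_integral_add nn_integral_cmult emeasure_space V_def)
    also have "\<dots> \<le> ennreal (A powr q) * ennreal V + ennreal (A powr (q - w)) * ennreal ((K * A) powr w)"
      by (intro add_left_mono mult_left_mono bound[OF A pair]) simp
    also have "\<dots> = ennreal (A powr q * V + A powr (q - w) * (K * A) powr w)"
      using V by (simp flip: ennreal_mult ennreal_plus)
    also have "A powr q * V + A powr (q - w) * (K * A) powr w = ((V + K powr w) powr (1 / q) * A) powr q"
      using V A K q by (simp add: powr_mult powr_powr powr_diff field_simps)
    finally show "(\<integral>\<^sup>+x. ennreal (\<bar>f x\<bar> powr q) \<partial>M) \<le> ennreal (((V + K powr w) powr (1 / q) * A) powr q)" .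
  qed
  fix F assume F: "fs_bounded ?H F"
  define G where "G = ae_image M (Lp_space M q) F"
  obtain B where B: "\<And>f. f \<in> F \<Longrightarrow> fs_norm ?H f \<le> ennreal B" and FH: "F \<subseteq> fs_carrier ?H"
    using F unfolding fs_bounded_def by blast
  \<comment> \<open>Strictly above the bound B, as required for the choice of gradients.\<close>
  define A where "A = max 0 B + 1"
  have A: "0 < A" and BA: "ennreal B < ennreal A" unfolding A_def by (simp, intro ennreal_lessI) auto
  have pair: "\<exists>g E. hajlasz_pair M d \<beta> u A h g E" if h: "h \<in> G" for h
  proof -
    obtain f where f: "f \<in> F" "AE x in M. f x = h x" using h by (auto simp: G_def ae_image_def)
    have "h \<in> borel_measurable M" using h by (auto simp: G_def ae_image_def Lp_space_def)
    moreover obtain g E where "hajlasz_pair M d \<beta> u A f g E"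
      using hajlasz_pair_if_norm_less[of f M d \<beta> u A] f(1) FH le_less_trans[OF B BA] u by blast
    ultimately show ?thesis using hajlasz_pair_cong_AE[OF _ f(2)] by blast
  qed
  have int_w: "(\<integral>\<^sup>+x. ennreal (\<bar>f x\<bar> powr w) \<partial>M) \<le> ennreal ((K * A) powr w)" if "f \<in> G" for f
    using pair[OF that] bound[OF A] by blast
  show "fs_totally_bounded (Lp_space M q) (ae_image M (Lp_space M q) F)"
    unfolding fs_totally_bounded_def G_def[symmetric]
  proof (intro conjI allI impI)
    show "G \<subseteq> fs_carrier (Lp_space M q)" by (auto simp: G_def ae_image_def)
    fix \<epsilon> :: real assume \<epsilon>: "0 < \<epsilon>"
    then have \<epsilon>': "0 < (\<epsilon> / 2) powr q" by simp
    have "\<exists>N. finite N \<and> N \<subseteq> G \<and> (\<forall>f\<in>G. \<exists>k\<in>N.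
        (\<integral>\<^sup>+x. ennreal (\<bar>f x - k x\<bar> powr q) \<partial>M) \<le> ennreal ((\<epsilon> / 2) powr q))"
      using pair int_w by (intro Lq_net[OF u \<beta> A q powr_ge_zero _ _ \<epsilon>'])
    then obtain N where N: "finite N" "N \<subseteq> G" "\<And>f. f \<in> G \<Longrightarrow> \<exists>k\<in>N.
        (\<integral>\<^sup>+x. ennreal (\<bar>f x - k x\<bar> powr q) \<partial>M) \<le> ennreal ((\<epsilon> / 2) powr q)"
      by blast
    have "\<exists>k\<in>N. fs_norm (Lp_space M q) (\<lambda>x. f x - k x) < ennreal \<epsilon>" if f: "f \<in> G" for f
    proof -
      obtain k where k: "k \<in> N" "(\<integral>\<^sup>+x. ennreal (\<bar>f x - k x\<bar> powr q) \<partial>M) \<le> ennreal ((\<epsilon> / 2) powr q)"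
        using N(3)[OF f] by blast
      have "Lp_norm M q (\<lambda>x. f x - k x) \<le> ennreal (\<epsilon> / 2)" using k(2) q(1) \<epsilon> by (intro Lp_norm_le) auto
      also have "\<dots> < ennreal \<epsilon>" using \<epsilon> by (intro ennreal_lessI) auto
      finally show ?thesis using k(1) by (auto simp: Lp_space_def)
    qed
    then show "\<exists>K. finite K \<and> K \<subseteq> G \<and> (\<forall>g\<in>G. \<exists>k\<in>K. fs_norm (Lp_space M q) (\<lambda>x. g x - k x) < ennreal \<epsilon>)"
      using N by blast
  qed
qed

section \<open>Hoelder representatives and compactness in Hoelder spaces\<close>

lemma d_pos: "x \<in> X \<Longrightarrow> y \<in> X \<Longrightarrow> x \<noteq> y \<Longrightarrow> 0 < d x y"
  using d_nonneg[of x y] d_zero_iff[of x y] by linarith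

lemma dense_off_null_set:
  assumes "N \<in> null_sets M" "x \<in> X" "0 < r"
  shows "\<exists>y\<in>X - N. d x y < r"
proof (rule ccontr)
  assume "\<not> ?thesis"
  then have "qm_ball X d x r \<subseteq> N" by (auto simp: qm_ball_def)
  then have "emeasure M (qm_ball X d x r) \<le> emeasure M N"
    using assms(1) by (intro emeasure_mono) auto
  then have "emeasure M (qm_ball X d x r) = 0" using assms(1) by (simp add: null_sets_def)
  then show False using quasi_metric_measure_spaceD(4)[OF M assms(2,3)] by simp
qed

text \<open>
  A quasi-metric need not be continuous; this estimate takes the place of continuity in
  limits of Hoelder bounds.
\<close>

lemma nearby_pair_dist:
  assumes X: "x \<in> X" "y \<in> X" "x' \<in> X" "y' \<in> X" and "d x x' \<le> d x y" "d y y' \<le> d x y"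
  shows "d x' y' \<le> C\<^sup>2 * d x y"
proof -
  have "d x' x \<le> C * d x x'" using sym X by blast
  also have "\<dots> \<le> C * d x y" using assms C by (intro mult_left_mono) auto
  finally have "d x' x \<le> C * d x y" .
  moreover have "d x y' \<le> C * max (d x y) (d y y')" using tri X by blast
  then have "d x y' \<le> C * d x y" using assms by simp
  ultimately have "C * max (d x' x) (d x y') \<le> C * (C * d x y)" using C by (intro mult_left_mono) auto
  then show ?thesis using tri[of x' y' x] X by (simp add: power2_eq_square mult.assoc)
qed

text \<open>
  Null sets have dense complement because balls have positive measure.  A function that is Hoelder
  continuous of some order \<open>\<gamma>\<close> therefore has everywhere, up to a constant factor, the bounds
  that it has almost everywhere, also those of another order \<open>e\<close>.  This makes the bounds valid for every Hoelder
  representative.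
\<close>

lemma hoelder_bounds_extend:
  assumes N: "N \<in> null_sets M" and "0 < \<gamma>" "0 \<le> H" "0 < e" "0 \<le> b'"
    and cont: "\<And>x y. x \<in> X \<Longrightarrow> y \<in> X \<Longrightarrow> \<bar>h x - h y\<bar> \<le> H * d x y powr \<gamma>"
    and sup: "\<And>x. x \<in> X - N \<Longrightarrow> \<bar>h x\<bar> \<le> a"
    and hoelder: "\<And>x y. x \<in> X - N \<Longrightarrow> y \<in> X - N \<Longrightarrow> \<bar>h x - h y\<bar> \<le> b' * d x y powr e"
    and x: "x \<in> X" and y: "y \<in> X"
  shows "\<bar>h x\<bar> \<le> a" and "\<bar>h x - h y\<bar> \<le> b' * (C\<^sup>2) powr e * d x y powr e"
proof -
  have approx: "\<exists>x'\<in>X - N. d x x' \<le> t \<and> \<bar>h x - h x'\<bar> \<le> \<epsilon>" if "0 < \<epsilon>" "0 < t" "x \<in> X" for x \<epsilon> t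
  proof -
    define r where "r = min t ((\<epsilon> / (H + 1)) powr (1 / \<gamma>))"
    have "0 < r" using that assms(2,3) by (simp add: r_def)
    then obtain x' where x': "x' \<in> X - N" "d x x' < r" using dense_off_null_set[OF N \<open>x \<in> X\<close>] by blast
    have "d x x' powr \<gamma> \<le> ((\<epsilon> / (H + 1)) powr (1 / \<gamma>)) powr \<gamma>"
      using x' d_nonneg[of x x'] that assms(2) by (intro powr_mono2) (auto simp: r_def)
    also have "\<dots> = \<epsilon> / (H + 1)" using that assms(2,3) by (simp add: powr_powr)
    finally have "(H + 1) * d x x' powr \<gamma> \<le> \<epsilon>" using assms(3) by (simp add: pos_le_divide_eq mult.commute)
    moreover have "H * d x x' powr \<gamma> \<le> (H + 1) * d x x' powr \<gamma>" by (intro mult_right_mono) auto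
    ultimately have "\<bar>h x - h x'\<bar> \<le> \<epsilon>" using cont[of x x'] x' that by auto
    then show ?thesis using x' by (intro bexI[of _ x']) (auto simp: r_def)
  qed
  show "\<bar>h x\<bar> \<le> a"
  proof (rule field_le_epsilon)
    fix \<epsilon> :: real assume "0 < \<epsilon>"
    then obtain x' where "x' \<in> X - N" "\<bar>h x - h x'\<bar> \<le> \<epsilon>" using approx[of \<epsilon> 1 x] x by auto
    then show "\<bar>h x\<bar> \<le> a + \<epsilon>" using sup[of x'] by linarith
  qed
  show "\<bar>h x - h y\<bar> \<le> b' * (C\<^sup>2) powr e * d x y powr e"
  proof (cases "x = y")
    case False
    have dxy: "0 < d x y" using d_pos x y False by blast
    show ?thesis
    proof (rule field_le_epsilon)
      fix \<epsilon> :: real assume "0 < \<epsilon>"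
      then have \<epsilon>: "0 < \<epsilon> / 2" by simp
      obtain x' where x': "x' \<in> X - N" "d x x' \<le> d x y" "\<bar>h x - h x'\<bar> \<le> \<epsilon> / 2"
        using approx[OF \<epsilon> dxy x] by blast
      obtain y' where y': "y' \<in> X - N" "d y y' \<le> d x y" "\<bar>h y - h y'\<bar> \<le> \<epsilon> / 2"
        using approx[OF \<epsilon> dxy y] by blast
      have "d x' y' \<le> C\<^sup>2 * d x y" using nearby_pair_dist x y x' y' by auto
      then have "d x' y' powr e \<le> (C\<^sup>2 * d x y) powr e"
        using x' y' d_nonneg[of x' y'] assms(4) by (intro powr_mono2) auto
      also have "\<dots> = (C\<^sup>2) powr e * d x y powr e" using dxy by (simp add: powr_mult)
      finally have "b' * d x' y' powr e \<le> b' * ((C\<^sup>2) powr e * d x y powr e)"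
        using assms(5) by (intro mult_left_mono) auto
      then have "\<bar>h x' - h y'\<bar> \<le> b' * (C\<^sup>2) powr e * d x y powr e"
        using hoelder[OF x'(1) y'(1)] by (simp add: mult.assoc)
      then show "\<bar>h x - h y\<bar> \<le> b' * (C\<^sup>2) powr e * d x y powr e + \<epsilon>" using x'(3) y'(3) by linarith
    qed
  qed (use assms(5) in simp)
qed

text \<open>
  Extension by limits along sequences off the null set.  An extension formula of McShane type
  would fail, since powers of the quasi-metric need not be Hoelder continuous of order \<open>e\<close>.
\<close>

lemma hoelder_representative:
  assumes N: "N \<in> null_sets M" and e: "0 < e" and b': "0 \<le> b'"
    and hoelder: "\<And>x y. x \<in> X - N \<Longrightarrow> y \<in> X - N \<Longrightarrow> \<bar>f x - f y\<bar> \<le> b' * d x y powr e"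
  shows "\<exists>h. (\<forall>x\<in>X - N. h x = f x) \<and>
    (\<forall>x\<in>X. \<forall>y\<in>X. \<bar>h x - h y\<bar> \<le> b' * (C\<^sup>2) powr e * d x y powr e)"
proof -
  have "\<exists>y. \<forall>n. y n \<in> X - N \<and> d x (y n) < 1 / real (Suc n)" if "x \<in> X" for x
  proof (intro choice allI)
    fix n
    have "0 < 1 / real (Suc n)" by simp
    then show "\<exists>y. y \<in> X - N \<and> d x y < 1 / real (Suc n)" using dense_off_null_set[OF N that] by blast
  qed
  then obtain p where p: "\<And>x n. x \<in> X \<Longrightarrow> p x n \<in> X - N" "\<And>x n. x \<in> X \<Longrightarrow> d x (p x n) < 1 / real (Suc n)"
    by metis
  have p0: "(\<lambda>n. d x (p x n)) \<longlonglongrightarrow> 0" if "x \<in> X" for x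
  proof (rule tendsto_sandwich[OF _ _ tendsto_const LIMSEQ_Suc[OF lim_const_over_n[of 1]]])
    show "\<forall>\<^sub>F n in sequentially. 0 \<le> d x (p x n)"
      using p(1)[OF that] d_nonneg that by auto
    show "\<forall>\<^sub>F n in sequentially. d x (p x n) \<le> 1 / real (Suc n)"
      using less_imp_le[OF p(2)[OF that]] by auto
  qed
  have conv: "convergent (\<lambda>n. f (p x n))" if x: "x \<in> X" for x
  proof -
    have "Cauchy (\<lambda>n. f (p x n))"
    proof (rule metric_CauchyI)
      fix \<epsilon> :: real assume "0 < \<epsilon>"
      define r where "r = (\<epsilon> / (b' + 1)) powr (1 / e) / C\<^sup>2"
      have r: "0 < r" using \<open>0 < \<epsilon>\<close> b' C by (simp add: r_def)
      obtain n0 where n0: "\<And>n. n \<ge> n0 \<Longrightarrow> d x (p x n) < r"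
        using order_tendstoD(2)[OF p0[OF x] r] by (auto simp: eventually_sequentially)
      have "dist (f (p x m)) (f (p x n)) < \<epsilon>" if mn: "m \<ge> n0" "n \<ge> n0" for m n
      proof -
        let ?y = "p x m" and ?z = "p x n"
        have yz: "?y \<in> X - N" "?z \<in> X - N" using p(1)[OF x] by auto
        have "d ?y x \<le> C * d x ?y" using sym x yz by auto
        also have "\<dots> \<le> C * r" using n0[OF mn(1)] C by (intro mult_left_mono) auto
        finally have "d ?y x \<le> C * r" .
        moreover have "r \<le> C * r" using C r mult_right_mono[of 1 C r] by linarith
        ultimately have "C * max (d ?y x) (d x ?z) \<le> C * (C * r)"
          using n0[OF mn(2)] C by (intro mult_left_mono) auto
        then have "d ?y ?z \<le> C\<^sup>2 * r" using tri[of ?y ?z x] x yz by (simp add: power2_eq_square mult.assoc)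
        then have "d ?y ?z powr e \<le> (C\<^sup>2 * r) powr e"
          using yz d_nonneg[of ?y ?z] e by (intro powr_mono2) auto
        also have "\<dots> = \<epsilon> / (b' + 1)" using C e \<open>0 < \<epsilon>\<close> b' by (simp add: r_def powr_powr)
        finally have "b' * d ?y ?z powr e \<le> b' * (\<epsilon> / (b' + 1))" using b' by (intro mult_left_mono) auto
        also have "\<dots> < \<epsilon>" using b' \<open>0 < \<epsilon>\<close> by (simp add: field_simps)
        finally show ?thesis using hoelder[OF yz] by (simp add: dist_real_def)
      qed
      then show "\<exists>n0. \<forall>m\<ge>n0. \<forall>n\<ge>n0. dist (f (p x m)) (f (p x n)) < \<epsilon>" by blast
    qed
    then show ?thesis by (rule Cauchy_convergent)
  qed
  define h where "h x = lim (\<lambda>n. f (p x n))" for x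
  have lim: "(\<lambda>n. f (p x n)) \<longlonglongrightarrow> h x" if "x \<in> X" for x
    using conv[OF that] by (simp add: h_def convergent_LIMSEQ_iff)
  have "h x = f x" if x: "x \<in> X - N" for x
  proof -
    have xX: "x \<in> X" using x by simp
    have to_zero: "(\<lambda>n. b' * d x (p x n) powr e) \<longlonglongrightarrow> b' * 0"
      using p0[OF xX] e p(1)[OF xX] d_nonneg[OF xX]
      by (intro tendsto_mult_left tendsto_zero_powrI[where b = e]) auto
    have "\<forall>\<^sub>F n in sequentially. norm (f (p x n) - f x) \<le> b' * d x (p x n) powr e"
      using hoelder[OF x p(1)[OF xX]] by (auto simp: abs_minus_commute)
    then have "(\<lambda>n. f (p x n) - f x) \<longlonglongrightarrow> 0"
      using to_zero[unfolded mult_zero_right] by (rule Lim_null_comparison)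
    then have "(\<lambda>n. f (p x n)) \<longlonglongrightarrow> f x" by (simp add: LIM_zero_iff)
    then show ?thesis using lim[OF xX] LIMSEQ_unique by blast
  qed
  moreover have "\<bar>h x - h y\<bar> \<le> b' * (C\<^sup>2) powr e * d x y powr e" if xy: "x \<in> X" "y \<in> X" for x y
  proof (cases "x = y")
    case False
    have dxy: "0 < d x y" using d_pos xy False by blast
    have lim_diff: "(\<lambda>n. \<bar>f (p x n) - f (p y n)\<bar>) \<longlonglongrightarrow> \<bar>h x - h y\<bar>"
      by (intro tendsto_rabs tendsto_diff lim xy)
    have "\<forall>\<^sub>F n in sequentially. d x (p x n) < d x y \<and> d y (p y n) < d x y"
      using order_tendstoD(2)[OF p0[OF xy(1)] dxy] order_tendstoD(2)[OF p0[OF xy(2)] dxy]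
      by (rule eventually_conj)
    then have "\<forall>\<^sub>F n in sequentially. \<bar>f (p x n) - f (p y n)\<bar> \<le> b' * (C\<^sup>2) powr e * d x y powr e"
    proof eventually_elim
      case (elim n)
      have P: "p x n \<in> X - N" "p y n \<in> X - N" using p(1) xy by auto
      have "d (p x n) (p y n) \<le> C\<^sup>2 * d x y" using nearby_pair_dist xy P elim by auto
      then have "d (p x n) (p y n) powr e \<le> (C\<^sup>2 * d x y) powr e"
        using P d_nonneg e by (intro powr_mono2) auto
      also have "\<dots> = (C\<^sup>2) powr e * d x y powr e" using dxy by (simp add: powr_mult)
      finally have "b' * d (p x n) (p y n) powr e \<le> b' * ((C\<^sup>2) powr e * d x y powr e)"
        using b' by (intro mult_left_mono) auto
      then show ?case using hoelder[OF P] by (simp add: mult.assoc)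
    qed
    then show ?thesis by (rule tendsto_upperbound[OF lim_diff]) simp
  qed (use b' in simp)
  ultimately show ?thesis by blast
qed

lemma hoelder_powr_le:
  assumes "\<gamma> \<le> e" "x \<in> X" "y \<in> X"
  shows "d x y powr e \<le> R powr (e - \<gamma>) * d x y powr \<gamma>"
proof (cases "x = y")
  case False
  then have dxy: "0 < d x y" using d_pos assms by blast
  have "d x y powr e = d x y powr (e - \<gamma>) * d x y powr \<gamma>" using dxy by (simp flip: powr_add)
  also have "\<dots> \<le> R powr (e - \<gamma>) * d x y powr \<gamma>"
    using dxy assms diam[of x y] by (intro mult_right_mono powr_mono2) auto
  finally show ?thesis .
next
  case True
  then have "d x y = 0" using d_zero_iff assms by blast
  then show ?thesis by simp
qed

text \<open>
  The conclusion of the supercritical estimate is taken as an assumption in this block, with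
  \<open>e\<close> in place of \<open>\<beta> - s / u\<close>.
\<close>

context
  fixes u \<beta> e K :: real
  assumes u: "0 < u" and e: "0 < e" and K: "0 < K"
    and bound: "\<And>A f g E. 0 < A \<Longrightarrow> hajlasz_pair M d \<beta> u A f g E \<Longrightarrow>
      (\<forall>x\<in>X - E. \<bar>f x\<bar> \<le> K * A) \<and> (\<forall>x\<in>X - E. \<forall>y\<in>X - E. \<bar>f x - f y\<bar> \<le> K * A * d x y powr e)"
begin

lemma hoelder_representative_bounds:
  assumes "0 < \<gamma>" and h: "h \<in> ae_image M (hoelder_space X d \<gamma>) {f}"
    and f: "f \<in> fs_carrier (hajlasz_sobolev_space M d \<beta> u)"
    and A: "fs_norm (hajlasz_sobolev_space M d \<beta> u) f < ennreal A"
    and x: "x \<in> X" and y: "y \<in> X"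
  shows "\<bar>h x\<bar> \<le> K * A" and "\<bar>h x - h y\<bar> \<le> K * A * (C\<^sup>2) powr e * d x y powr e"
proof -
  have A0: "0 < A" using A by (cases "A > 0") (auto simp: ennreal_neg)
  obtain g E where pair: "hajlasz_pair M d \<beta> u A f g E"
    using hajlasz_pair_if_norm_less[OF f A u] by blast
  have "AE x in M. f x = h x" using h by (simp add: ae_image_def)
  then obtain N where N: "{x \<in> X. f x \<noteq> h x} \<subseteq> N" "N \<in> null_sets M"
    by (auto simp: eventually_ae_filter)
  have EN: "E \<union> N \<in> null_sets M" using pair N unfolding hajlasz_pair_def by blast
  have eq: "h x = f x" if "x \<in> X - (E \<union> N)" for x using that N by auto
  have "hoelder_norm X d \<gamma> h < \<infinity>" using h by (simp add: ae_image_def hoelder_space_def)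
  then obtain H where H: "0 \<le> H" "\<And>x y. x \<in> X \<Longrightarrow> y \<in> X \<Longrightarrow> \<bar>h x - h y\<bar> \<le> H * d x y powr \<gamma>"
    using hoelder_norm_finiteD[of X d \<gamma> h] d_pos by blast
  have sup: "\<bar>h x\<bar> \<le> K * A" if "x \<in> X - (E \<union> N)" for x
    using eq[OF that] bound[OF A0 pair] that by auto
  have hoelder: "\<bar>h x - h y\<bar> \<le> K * A * d x y powr e" if "x \<in> X - (E \<union> N)" "y \<in> X - (E \<union> N)" for x y
    using eq[OF that(1)] eq[OF that(2)] bound[OF A0 pair] that by auto
  have KA: "0 \<le> K * A" using K A0 by simp
  show "\<bar>h x\<bar> \<le> K * A"
    by (rule hoelder_bounds_extend(1)[OF EN assms(1) H(1) e KA H(2) sup hoelder x y])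
  show "\<bar>h x - h y\<bar> \<le> K * A * (C\<^sup>2) powr e * d x y powr e"
    by (rule hoelder_bounds_extend(2)[OF EN assms(1) H(1) e KA H(2) sup hoelder x y])
qed

lemma continuous_embedding_hoelder:
  assumes \<gamma>: "0 < \<gamma>" "\<gamma> \<le> e"
  shows "continuous_embedding M (hajlasz_sobolev_space M d \<beta> u) (hoelder_space X d \<gamma>)"
  unfolding continuous_embedding_def
proof (intro conjI ballI)
  let ?H = "hajlasz_sobolev_space M d \<beta> u" and ?B = "hoelder_space X d \<gamma>"
  define Q where "Q = (C\<^sup>2) powr e * R powr (e - \<gamma>)"
  have Q: "0 \<le> Q" by (simp add: Q_def)
  have norm: "hoelder_norm X d \<gamma> h \<le> ennreal (a + b' * Q)"
    if "0 \<le> a" "0 \<le> b'" "\<And>x. x \<in> X \<Longrightarrow> \<bar>h x\<bar> \<le> a"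
      "\<And>x y. x \<in> X \<Longrightarrow> y \<in> X \<Longrightarrow> \<bar>h x - h y\<bar> \<le> b' * (C\<^sup>2) powr e * d x y powr e" for a b' h
  proof (rule hoelder_norm_le)
    fix x y assume xy: "x \<in> X" "y \<in> X" "x \<noteq> y"
    have "\<bar>h x - h y\<bar> \<le> b' * (C\<^sup>2) powr e * d x y powr e" using that xy by blast
    also have "\<dots> \<le> b' * (C\<^sup>2) powr e * (R powr (e - \<gamma>) * d x y powr \<gamma>)"
      using that(2) \<gamma> xy by (intro mult_left_mono hoelder_powr_le) auto
    finally show "0 < d x y \<and> \<bar>h x - h y\<bar> \<le> b' * Q * d x y powr \<gamma>"
      using d_pos xy by (simp add: Q_def mult.assoc)
  qed (use that Q in auto)
  {
    fix f assume f: "f \<in> fs_carrier ?H"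
    then have "fs_norm ?H f < \<infinity>" by (simp add: hajlasz_sobolev_space_def)
    then obtain n where n: "fs_norm ?H f = ennreal n" "0 \<le> n" by (cases "fs_norm ?H f") auto
    define A where "A = n + 1"
    have A: "0 < A" "fs_norm ?H f < ennreal A" using n by (auto simp: A_def ennreal_less_iff)
    obtain g E where pair: "hajlasz_pair M d \<beta> u A f g E"
      using hajlasz_pair_if_norm_less[OF f A(2) u] by blast
    have E: "E \<in> null_sets M" using pair unfolding hajlasz_pair_def by blast
    have KA: "0 \<le> K * A" using K A by simp
    obtain h where h: "\<And>x. x \<in> X - E \<Longrightarrow> h x = f x"
      "\<And>x y. x \<in> X \<Longrightarrow> y \<in> X \<Longrightarrow> \<bar>h x - h y\<bar> \<le> K * A * (C\<^sup>2) powr e * d x y powr e"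
      using hoelder_representative[OF E e KA, of f] bound[OF A(1) pair] by blast
    have b_nonneg: "0 \<le> K * A * (C\<^sup>2) powr e" using KA by simp
    have "\<bar>h x\<bar> \<le> K * A" if x: "x \<in> X" for x
    proof (rule hoelder_bounds_extend(1)[OF E e b_nonneg e b_nonneg h(2) _ _ x x])
      show "\<bar>h x\<bar> \<le> K * A" if "x \<in> X - E" for x using h(1)[OF that] bound[OF A(1) pair] that by auto
      show "\<bar>h x - h y\<bar> \<le> K * A * (C\<^sup>2) powr e * d x y powr e" if "x \<in> X - E" "y \<in> X - E" for x y
        using h(2) that by auto
    qed
    then have "hoelder_norm X d \<gamma> h \<le> ennreal (K * A + K * A * Q)"
      using norm[OF KA KA] h(2) by blast
    then have "hoelder_norm X d \<gamma> h < \<infinity>"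
      unfolding infinity_ennreal_def using ennreal_less_top by (rule le_less_trans)
    moreover have "AE x in M. f x = h x"
      by (rule AE_I'[OF E]) (use h(1) in force)
    ultimately have "h \<in> ae_image M ?B {f}" by (auto simp: ae_image_def hoelder_space_def)
    then show "ae_image M ?B {f} \<noteq> {}" by blast
  }
  show "\<exists>C. \<forall>f\<in>fs_carrier ?H. \<forall>g\<in>ae_image M ?B {f}. fs_norm ?B g \<le> ennreal C * fs_norm ?H f"
  proof (intro exI[of _ "K + K * Q"] ballI ennreal_le_mult_if_bounds)
    fix f h assume f: "f \<in> fs_carrier ?H" and h: "h \<in> ae_image M ?B {f}"
    show "fs_norm ?H f < \<infinity>" using f by (simp add: hajlasz_sobolev_space_def)
    fix A assume A: "fs_norm ?H f < ennreal A"
    then have "0 < A" by (cases "A > 0") (auto simp: ennreal_neg)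
    then have KA: "0 \<le> K * A" using K by simp
    have "hoelder_norm X d \<gamma> h \<le> ennreal (K * A + K * A * Q)"
      by (rule norm[OF KA KA]) (rule hoelder_representative_bounds[OF \<gamma>(1) h f A]; assumption)+
    then show "fs_norm ?B h \<le> ennreal ((K + K * Q) * A)"
      by (simp add: hoelder_space_def algebra_simps)
  qed (use K Q in simp)
qed

text \<open>
  The image is bounded in the Hoelder space of order \<open>e\<close>, so it has finite nets for the supremum norm.
  For two points at distance at most \<open>\<tau>\<close> the difference quotient of order \<open>\<gamma>\<close> is small because
  \<open>\<gamma> < e\<close>, and for the others because the supremum norm is small.
\<close>

lemma compact_embedding_hoelder:
  assumes \<gamma>: "0 < \<gamma>" "\<gamma> < e"
  shows "compact_embedding M (hajlasz_sobolev_space M d \<beta> u) (hoelder_space X d \<gamma>)"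
  unfolding compact_embedding_def
proof (intro conjI allI impI)
  let ?H = "hajlasz_sobolev_space M d \<beta> u" and ?B = "hoelder_space X d \<gamma>"
  show "continuous_embedding M ?H ?B" using \<gamma> by (intro continuous_embedding_hoelder) auto
  fix F assume F: "fs_bounded ?H F"
  define G where "G = ae_image M ?B F"
  obtain B where B: "\<And>f. f \<in> F \<Longrightarrow> fs_norm ?H f \<le> ennreal B" and FH: "F \<subseteq> fs_carrier ?H"
    using F unfolding fs_bounded_def by blast
  define A where "A = max 0 B + 1"
  have A: "0 < A" and BA: "ennreal B < ennreal A" unfolding A_def by (simp, intro ennreal_lessI) auto
  define b' where "b' = K * A * (C\<^sup>2) powr e"
  have b': "0 \<le> b'" and KA: "0 \<le> K * A" using K A by (auto simp: b'_def)
  have G: "\<bar>h x\<bar> \<le> K * A" "\<bar>h x - h y\<bar> \<le> b' * d x y powr e" if h: "h \<in> G" and xy: "x \<in> X" "y \<in> X" for h x y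
  proof -
    obtain f where f: "f \<in> F" "h \<in> ae_image M ?B {f}" using h by (auto simp: G_def ae_image_def)
    have fH: "f \<in> fs_carrier ?H" and nA: "fs_norm ?H f < ennreal A"
      using f(1) FH le_less_trans[OF B BA] by auto
    show "\<bar>h x\<bar> \<le> K * A" "\<bar>h x - h y\<bar> \<le> b' * d x y powr e"
      unfolding b'_def by (rule hoelder_representative_bounds[OF \<gamma>(1) f(2) fH nA xy])+
  qed
  show "fs_totally_bounded ?B (ae_image M ?B F)"
    unfolding fs_totally_bounded_def G_def[symmetric]
  proof (intro conjI allI impI)
    show "G \<subseteq> fs_carrier ?B" by (auto simp: G_def ae_image_def)
    fix \<epsilon> :: real assume \<epsilon>: "0 < \<epsilon>"
    define \<tau> where "\<tau> = (\<epsilon> / (8 * (b' + 1))) powr (1 / (e - \<gamma>))"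
    have \<tau>: "0 < \<tau>" using \<epsilon> b' by (simp add: \<tau>_def)
    have \<tau>_small: "2 * b' * \<tau> powr (e - \<gamma>) \<le> \<epsilon> / 4"
    proof -
      have "\<tau> powr (e - \<gamma>) = \<epsilon> / (8 * (b' + 1))" using \<epsilon> b' \<gamma> by (simp add: \<tau>_def powr_powr)
      then have "(b' + 1) * \<tau> powr (e - \<gamma>) = \<epsilon> / 8" using b' by (simp add: field_simps)
      then have "b' * \<tau> powr (e - \<gamma>) + \<tau> powr (e - \<gamma>) = \<epsilon> / 8" by (simp add: distrib_right)
      then show ?thesis using powr_ge_zero[of \<tau> "e - \<gamma>"] by linarith
    qed
    define \<eta> where "\<eta> = min (\<epsilon> / 4) (\<epsilon> * \<tau> powr \<gamma> / 8)"
    have \<eta>: "0 < \<eta>" "\<eta> \<le> \<epsilon> / 4" "2 * \<eta> \<le> \<epsilon> / 4 * \<tau> powr \<gamma>" using \<epsilon> \<tau> by (auto simp: \<eta>_def)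
    have "\<exists>N. finite N \<and> N \<subseteq> G \<and> (\<forall>f\<in>G. \<exists>k\<in>N. \<forall>x\<in>X \<inter> X. \<bar>f x - k x\<bar> \<le> \<eta>)"
      by (rule equicontinuous_net[where U = "\<lambda>_. X", OF KA b' e \<eta>(1)]) (use G in auto)
    then obtain N where N: "finite N" "N \<subseteq> G" "\<And>f. f \<in> G \<Longrightarrow> \<exists>k\<in>N. \<forall>x\<in>X. \<bar>f x - k x\<bar> \<le> \<eta>"
      by auto
    have "fs_norm ?B (\<lambda>x. f x - k x) < ennreal \<epsilon>"
      if f: "f \<in> G" and k: "k \<in> G" and close: "\<And>x. x \<in> X \<Longrightarrow> \<bar>f x - k x\<bar> \<le> \<eta>" for f k
    proof -
      have "hoelder_norm X d \<gamma> (\<lambda>x. f x - k x) \<le> ennreal (\<eta> + \<epsilon> / 4)"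
      proof (rule hoelder_norm_le)
        fix x y assume xy: "x \<in> X" "y \<in> X" "x \<noteq> y"
        have dxy: "0 < d x y" using d_pos xy by blast
        have "\<bar>(f x - k x) - (f y - k y)\<bar> \<le> \<epsilon> / 4 * d x y powr \<gamma>"
        proof (cases "d x y \<le> \<tau>")
          case True
          have "\<bar>(f x - k x) - (f y - k y)\<bar> \<le> 2 * b' * d x y powr e"
            using G(2)[OF f xy(1,2)] G(2)[OF k xy(1,2)] by linarith
          also have "d x y powr e = d x y powr (e - \<gamma>) * d x y powr \<gamma>" using dxy by (simp flip: powr_add)
          also have "2 * b' * (d x y powr (e - \<gamma>) * d x y powr \<gamma>) \<le> 2 * b' * (\<tau> powr (e - \<gamma>) * d x y powr \<gamma>)"
            using True dxy \<gamma> b' by (intro mult_left_mono mult_right_mono powr_mono2) auto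
          also have "\<dots> = 2 * b' * \<tau> powr (e - \<gamma>) * d x y powr \<gamma>" by simp
          also have "\<dots> \<le> \<epsilon> / 4 * d x y powr \<gamma>" using \<tau>_small by (intro mult_right_mono) auto
          finally show ?thesis .
        next
          case False
          have "\<bar>(f x - k x) - (f y - k y)\<bar> \<le> 2 * \<eta>" using close[OF xy(1)] close[OF xy(2)] by linarith
          also have "\<dots> \<le> \<epsilon> / 4 * \<tau> powr \<gamma>" by (rule \<eta>)
          also have "\<dots> \<le> \<epsilon> / 4 * d x y powr \<gamma>"
            using False \<tau> \<gamma> \<epsilon> by (intro mult_left_mono powr_mono2) auto
          finally show ?thesis .
        qed
        then show "0 < d x y \<and> \<bar>(f x - k x) - (f y - k y)\<bar> \<le> \<epsilon> / 4 * d x y powr \<gamma>" using dxy by simp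
      qed (use \<eta> \<epsilon> close in auto)
      also have "\<dots> < ennreal \<epsilon>" using \<eta> \<epsilon> by (intro ennreal_lessI) auto
      finally show ?thesis by (simp add: hoelder_space_def)
    qed
    then show "\<exists>K. finite K \<and> K \<subseteq> G \<and> (\<forall>g\<in>G. \<exists>k\<in>K. fs_norm ?B (\<lambda>x. g x - k x) < ennreal \<epsilon>)"
      using N by (intro exI[of _ N]) blast
  qed
qed

end

end

section \<open>The embeddings\<close>

theorem theorem1p5:
  fixes M :: "'a measure" and d :: "'a \<Rightarrow> 'a \<Rightarrow> real" and \<alpha> p pt :: real
  assumes "quasi_metric_measure_space M d"
    and "doubling_measure M d"
    and "0 < \<alpha>" and "0 < p" and "0 < pt" and "pt \<le> p"
    and "below_smoothness_index \<alpha> (space M) d"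
    and "compact_embedding M (hajlasz_sobolev_space M d \<alpha> p) (Lp_space M pt)"
  shows "\<forall>(\<beta>::real) (u::real) (s::real). 0 < \<beta> \<longrightarrow> 0 < u \<longrightarrow> dimensional_exponent M d s \<longrightarrow>
    (\<beta> * u < s \<longrightarrow>
       continuous_embedding M (hajlasz_sobolev_space M d \<beta> u)
         (Lp_space M (s * u / (s - \<beta> * u))) \<and>
       (\<forall>q. 0 < q \<and> q < s * u / (s - \<beta> * u) \<longrightarrow>
         compact_embedding M (hajlasz_sobolev_space M d \<beta> u) (Lp_space M q))) \<and>
    (\<beta> * u > s \<longrightarrow>
       continuous_embedding M (hajlasz_sobolev_space M d \<beta> u)
         (hoelder_space (space M) d (\<beta> - s / u)) \<and>
       (\<forall>\<gamma>. 0 < \<gamma> \<and> \<gamma> < \<beta> - s / u \<longrightarrow>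
         compact_embedding M (hajlasz_sobolev_space M d \<beta> u) (hoelder_space (space M) d \<gamma>)) \<and>
       (\<forall>q>0. compact_embedding M (hajlasz_sobolev_space M d \<beta> u) (Lp_space M q)))"
proof (intro allI impI)
  fix \<beta> u s :: real
  assume \<beta>: "0 < \<beta>" and u: "0 < u" and dim: "dimensional_exponent M d s"
  let ?H = "hajlasz_sobolev_space M d \<beta> u"
  obtain R where R: "0 < R" "\<forall>x\<in>space M. \<forall>y\<in>space M. d x y < R"
    using bounded_if_compact_embedding[OF assms(1) dim assms(3-8)] by blast
  obtain C b where "lower_regular_space M d C R b s"
    using lower_regular_spaceI[OF assms(1) dim R] by blast
  then interpret lower_regular_space M d C R b s .
  show "(\<beta> * u < s \<longrightarrow> continuous_embedding M ?H (Lp_space M (s * u / (s - \<beta> * u))) \<and>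
       (\<forall>q. 0 < q \<and> q < s * u / (s - \<beta> * u) \<longrightarrow> compact_embedding M ?H (Lp_space M q))) \<and>
    (\<beta> * u > s \<longrightarrow> continuous_embedding M ?H (hoelder_space (space M) d (\<beta> - s / u)) \<and>
       (\<forall>\<gamma>. 0 < \<gamma> \<and> \<gamma> < \<beta> - s / u \<longrightarrow> compact_embedding M ?H (hoelder_space (space M) d \<gamma>)) \<and>
       (\<forall>q>0. compact_embedding M ?H (Lp_space M q)))"
  proof (rule conjI; rule impI)
    assume crit: "\<beta> * u < s"
    let ?w = "s * u / (s - \<beta> * u)"
    have w: "0 < ?w" using crit u s by simp
    obtain K where K: "0 < K" and bound: "\<And>A f g E. 0 < A \<Longrightarrow> hajlasz_pair M d \<beta> u A f g E \<Longrightarrow>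
        (\<integral>\<^sup>+x. ennreal (\<bar>f x\<bar> powr ?w) \<partial>M) \<le> ennreal ((K * A) powr ?w)"
      using subcritical_bound[OF u \<beta> crit] by blast
    have "continuous_embedding M ?H (Lp_space M ?w)"
      by (rule continuous_embedding_LpI[OF u w less_imp_le[OF K]]) (rule bound)
    moreover have "compact_embedding M ?H (Lp_space M q)" if "0 < q \<and> q < ?w" for q
      by (rule compact_embedding_Lq[OF u \<beta> conjunct1[OF that] conjunct2[OF that] K]) (rule bound)
    ultimately show "continuous_embedding M ?H (Lp_space M ?w) \<and>
       (\<forall>q. 0 < q \<and> q < ?w \<longrightarrow> compact_embedding M ?H (Lp_space M q))" by blast
  next
    assume crit: "\<beta> * u > s"
    let ?e = "\<beta> - s / u"
    have e: "0 < ?e" using crit u by (simp add: field_simps)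
    obtain K where K: "0 < K" and "\<forall>A>0. \<forall>f g E. hajlasz_pair M d \<beta> u A f g E \<longrightarrow>
        (\<forall>x\<in>X - E. \<bar>f x\<bar> \<le> K * A) \<and> (\<forall>x\<in>X - E. \<forall>y\<in>X - E. \<bar>f x - f y\<bar> \<le> K * A * d x y powr ?e)"
      using supercritical_bound[OF u \<beta> crit] by (elim exE conjE)
    then have bound: "\<And>A f g E. 0 < A \<Longrightarrow> hajlasz_pair M d \<beta> u A f g E \<Longrightarrow>
        (\<forall>x\<in>X - E. \<bar>f x\<bar> \<le> K * A) \<and> (\<forall>x\<in>X - E. \<forall>y\<in>X - E. \<bar>f x - f y\<bar> \<le> K * A * d x y powr ?e)"
      by simp
    have "continuous_embedding M ?H (hoelder_space X d ?e)"
      by (rule continuous_embedding_hoelder[OF u e K _ e order.refl]) (rule bound)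
    moreover have "compact_embedding M ?H (hoelder_space X d \<gamma>)" if "0 < \<gamma> \<and> \<gamma> < ?e" for \<gamma>
      by (rule compact_embedding_hoelder[OF u e K _ conjunct1[OF that] conjunct2[OF that]]) (rule bound)
    moreover have "compact_embedding M ?H (Lp_space M q)" if "0 < q" for q
    \<comment> \<open>Bounded functions on a space of finite measure: the higher exponent may be q + 1.\<close>
    proof (rule compact_embedding_Lq[OF u \<beta> that])
      define V where "V = measure M X"
      have V: "0 < V" using measure_space_pos by (simp add: V_def)
      show "q < q + 1" "0 < K * V powr (1 / (q + 1))" using K V by auto
      fix A :: real and f g E assume A: "0 < A" and pair: "hajlasz_pair M d \<beta> u A f g E"
      have E: "E \<in> null_sets M" using pair unfolding hajlasz_pair_def by blast
      have "(\<integral>\<^sup>+x. ennreal (\<bar>f x\<bar> powr (q + 1)) \<partial>M) \<le> (\<integral>\<^sup>+x. ennreal ((K * A) powr (q + 1)) \<partial>M)"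
      proof (rule nn_integral_mono_AE, rule AE_I'[OF E], rule subsetI, rule ccontr)
        fix x assume x: "x \<in> {x \<in> X. \<not> ennreal (\<bar>f x\<bar> powr (q + 1)) \<le> ennreal ((K * A) powr (q + 1))}" "x \<notin> E"
        then have "\<bar>f x\<bar> \<le> K * A" using bound[OF A pair] by blast
        then have "\<bar>f x\<bar> powr (q + 1) \<le> (K * A) powr (q + 1)" using that by (intro powr_mono2) auto
        then show False using x by (auto intro: ennreal_leI)
      qed
      also have "\<dots> = ennreal ((K * A) powr (q + 1) * V)"
        using V by (simp add: emeasure_space V_def ennreal_mult)
      also have "(K * A) powr (q + 1) * V = (K * V powr (1 / (q + 1)) * A) powr (q + 1)"
        using K A V that by (simp add: powr_mult powr_powr)
      finally show "(\<integral>\<^sup>+x. ennreal (\<bar>f x\<bar> powr (q + 1)) \<partial>M)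
          \<le> ennreal ((K * V powr (1 / (q + 1)) * A) powr (q + 1))" .
    qed
    ultimately show "continuous_embedding M ?H (hoelder_space X d ?e) \<and>
       (\<forall>\<gamma>. 0 < \<gamma> \<and> \<gamma> < ?e \<longrightarrow> compact_embedding M ?H (hoelder_space X d \<gamma>)) \<and>
       (\<forall>q>0. compact_embedding M ?H (Lp_space M q))" by blast
  qed
qed

end
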